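(* Let $a_0>b_0=c_0>0$, and let $t_0=\inf\{t:\rho^{(a_0,b_0)}(t)>0\}$, where $\rho^{(a_0,b_0)}$ is the Dirichlet eigenvalue counting function defined in the context. Then $$\rho^{(a_0,b_0)}(t)\asymp t^{\frac{\log 3}{\log(9/2)}},\qquad t>t_0,$$ i.e. there is a constant $C>0$ such that $C^{-1}t^{\log3/\log(9/2)}\le\rho^{(a_0,b_0)}(t)\le Ct^{\log3/\log(9/2)}$ for all $t>t_0$.
   Context: Identify $\mathbb R^2$ with $\mathbb C$ and let $p_1=0$, $p_2=1$, $p_3=e^{\pi\sqrt{-1}/3}$, $F_i(x)=\frac12(x-p_i)+p_i$ ($i=1,2,3$). The Sierpinski gasket $K$ is the unique nonempty compact set with $K=\bigcup_{i=1}^3F_i(K)$. Let $V_0=\{p_1,p_2,p_3\}$, $W_n=\{1,2,3\}^n$, $F_\omega=F_{\omega_1}\circ\cdots\circ F_{\omega_n}$ for $\omega\in W_n$, and let $\mu$ be the normalized $\frac{\log3}{\log2}$-dimensional Hausdorff measure on $K$. Given $a_0>b_0=c_0>0$, let $\eta_0=a_0b_0+b_0c_0+c_0a_0$, $(x_0,y_0,z_0)=(a_0,b_0,c_0)/\eta_0$ (so $x_0>y_0=z_0$), and let $\{(x_n,y_n,z_n)\}_{n\ge 0}$ be the unique sequence of positive triples, starting from $(x_0,y_0,z_0)$, satisfying for all $n\ge1$ $$x_{n-1}=x_n+\phi(x_n;y_n,z_n),\quad y_{n-1}=y_n+\phi(y_n;z_n,x_n),\quad z_{n-1}=z_n+\phi(z_n;x_n,y_n),$$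 with $\phi(x;y,z)=\frac{(x+y)(x+z)}{2(x+y+z)}$; it satisfies $y_n=z_n$. Put $r_n=x_ny_n+y_nz_n+z_nx_n$, $(a_n,b_n,c_n)=(x_n,y_n,z_n)/r_n$. For $u\in C(K)$, writing $u_\omega=u\circ F_\omega$, let $$\mathcal E_n^{(a_0,b_0)}(u)=\sum_{\omega\in W_n}\Big[b_n(u_\omega(p_1)-u_\omega(p_2))^2+b_n(u_\omega(p_1)-u_\omega(p_3))^2+a_n(u_\omega(p_2)-u_\omega(p_3))^2\Big],$$ which is nondecreasing in $n$; let $\mathcal E^{(a_0,b_0)}(u)=\lim_{n\to\infty}\mathcal E_n^{(a_0,b_0)}(u)\in[0,\infty]$ and $\mathcal F=\{u\in C(K):\mathcal E^{(a_0,b_0)}(u)<\infty\}$. $(\mathcal E^{(a_0,b_0)},\mathcal F)$ is a regular Dirichlet form on $L^2(K,\mu)$; let $\Delta^{(a_0,b_0)}$ be its infinitesimal generator (the Laplacian). A number $\lambda$ is an eigenvalue of $-\Delta^{(a_0,b_0)}$ with the Dirichlet boundary condition (D.B.C.) if there is a nonzero $u\in\mathcal F_0=\{u\in\mathcal F:u|_{V_0}=0\}$ with $\mathcal E^{(a_0,b_0)}(u,v)=\lambda\int_Kuv\,d\mu$ for all $v\in\mathcal F_0$, where $\mathcal E^{(a_0,b_0)}(\cdot,\cdot)$ is the bilinear form obtained by polarization. Then $\rho^{(a_0,b_0)}(t)=\#\{\lambda\le t:\lambda$ is an eigenvalue of $-\Delta^{(a_0,b_0)}$ with D.B.C.$\}$,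 counted with multiplicity. *)

theory Defs
  imports "HOL-Analysis.Analysis" "HOL-Library.Function_Algebras"
begin

section \<open>The Sierpinski gasket\<close>

definition gasket_vertex :: "nat \<Rightarrow> complex" where
  "gasket_vertex i = (if i = 1 then 0 else if i = 2 then 1 else exp (of_real pi * \<i> / 3))"

definition gasket_map :: "nat \<Rightarrow> complex \<Rightarrow> complex" where
  "gasket_map i x = (1 / 2) * (x - gasket_vertex i) + gasket_vertex i"

definition gasket :: "complex set" where
  "gasket = (THE A. compact A \<and> A \<noteq> {} \<and> A = (\<Union>i\<in>{1, 2, 3}. gasket_map i ` A))"

definition gasket_boundary :: "complex set" where
  "gasket_boundary = {gasket_vertex 1, gasket_vertex 2, gasket_vertex 3}"

definition words :: "nat \<Rightarrow> nat list set" where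
  "words n = {\<omega>. length \<omega> = n \<and> set \<omega> \<subseteq> {1, 2, 3}}"

definition gasket_word_map :: "nat list \<Rightarrow> complex \<Rightarrow> complex" where
  "gasket_word_map \<omega> = foldr (\<lambda>i g. gasket_map i \<circ> g) \<omega> id"

section \<open>Hausdorff measure\<close>

text \<open>
  For exponents s > 0 the empty set contributes 0 to the sums below, so countable covers
  include the finite ones. Boundedness is required explicitly because \<^const>\<open>diameter\<close> is
  real-valued and carries no information for unbounded sets.
\<close>

definition hausdorff_premeasure :: "real \<Rightarrow> real \<Rightarrow> 'a::metric_space set \<Rightarrow> ennreal" where
  "hausdorff_premeasure s \<delta> A =
     (INF U \<in> {U :: nat \<Rightarrow> 'a set. A \<subseteq> (\<Union>i. U i) \<and> (\<forall>i. bounded (U i) \<and> diameter (U i) \<le> \<delta>)}.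
        \<Sum>i. ennreal (diameter (U i) powr s))"

definition hausdorff_outer_measure :: "real \<Rightarrow> 'a::metric_space set \<Rightarrow> ennreal" where
  "hausdorff_outer_measure s A = (SUP \<delta> \<in> {0<..}. hausdorff_premeasure s \<delta> A)"

definition hausdorff_measure :: "real \<Rightarrow> 'a::metric_space measure" where
  "hausdorff_measure s = measure_of UNIV (sets borel) (hausdorff_outer_measure s)"

text \<open>
  \<^const>\<open>uniform_measure\<close> conditions on \<^const>\<open>gasket\<close> and normalizes. The result is a Borel measure
  on the whole plane that is concentrated on \<^const>\<open>gasket\<close>.
\<close>

definition gasket_measure :: "complex measure" where
  "gasket_measure = uniform_measure (hausdorff_measure (ln 3 / ln 2)) gasket"

section \<open>The renormalization sequence\<close>

definition phi :: "real \<Rightarrow> real \<Rightarrow> real \<Rightarrow> real" where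
  "phi x y z = (x + y) * (x + z) / (2 * (x + y + z))"

definition resistance_seq :: "real \<Rightarrow> real \<Rightarrow> real \<Rightarrow> nat \<Rightarrow> real \<times> real \<times> real" where
  "resistance_seq a0 b0 c0 = (THE s.
     (let \<eta>0 = a0 * b0 + b0 * c0 + c0 * a0 in s 0 = (a0 / \<eta>0, b0 / \<eta>0, c0 / \<eta>0)) \<and>
     (\<forall>n. case s n of (x, y, z) \<Rightarrow> 0 < x \<and> 0 < y \<and> 0 < z) \<and>
     (\<forall>n. case s (Suc n) of (x, y, z) \<Rightarrow>
        s n = (x + phi x y z, y + phi y z x, z + phi z x y)))"

definition conductance_seq :: "real \<Rightarrow> real \<Rightarrow> real \<Rightarrow> nat \<Rightarrow> real \<times> real \<times> real" where
  "conductance_seq a0 b0 c0 n = (case resistance_seq a0 b0 c0 n of (x, y, z) \<Rightarrow>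
     (let r = x * y + y * z + z * x in (x / r, y / r, z / r)))"

text \<open>The Dirichlet forms concern the case c0 = b0, where the third component equals the second.\<close>

definition a_seq :: "real \<Rightarrow> real \<Rightarrow> nat \<Rightarrow> real" where
  "a_seq a0 b0 n = fst (conductance_seq a0 b0 b0 n)"

definition b_seq :: "real \<Rightarrow> real \<Rightarrow> nat \<Rightarrow> real" where
  "b_seq a0 b0 n = fst (snd (conductance_seq a0 b0 b0 n))"

section \<open>The Dirichlet form\<close>

definition energy_n :: "real \<Rightarrow> real \<Rightarrow> nat \<Rightarrow> (complex \<Rightarrow> real) \<Rightarrow> real" where
  "energy_n a0 b0 n u = (\<Sum>\<omega>\<in>words n. let v = u \<circ> gasket_word_map \<omega> in
       b_seq a0 b0 n * (v (gasket_vertex 1) - v (gasket_vertex 2))\<^sup>2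
     + b_seq a0 b0 n * (v (gasket_vertex 1) - v (gasket_vertex 3))\<^sup>2
     + a_seq a0 b0 n * (v (gasket_vertex 2) - v (gasket_vertex 3))\<^sup>2)"

definition energy :: "real \<Rightarrow> real \<Rightarrow> (complex \<Rightarrow> real) \<Rightarrow> ereal" where
  "energy a0 b0 u = lim (\<lambda>n. ereal (energy_n a0 b0 n u))"

text \<open>
  A function on \<^const>\<open>gasket\<close> is represented by its extension by 0 to the plane, so that equality,
  linear independence and dimension are those of functions on \<^const>\<open>gasket\<close>.
\<close>

definition gasket_functions :: "(complex \<Rightarrow> real) set" where
  "gasket_functions = {u. continuous_on gasket u \<and> (\<forall>x. x \<notin> gasket \<longrightarrow> u x = 0)}"

definition form_domain :: "real \<Rightarrow> real \<Rightarrow> (complex \<Rightarrow> real) set" where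
  "form_domain a0 b0 = {u \<in> gasket_functions. energy a0 b0 u < \<infinity>}"

definition form_domain0 :: "real \<Rightarrow> real \<Rightarrow> (complex \<Rightarrow> real) set" where
  "form_domain0 a0 b0 = {u \<in> form_domain a0 b0. \<forall>x\<in>gasket_boundary. u x = 0}"

definition form :: "real \<Rightarrow> real \<Rightarrow> (complex \<Rightarrow> real) \<Rightarrow> (complex \<Rightarrow> real) \<Rightarrow> real" where
  "form a0 b0 u v =
     (real_of_ereal (energy a0 b0 (u + v)) - real_of_ereal (energy a0 b0 (u - v))) / 4"

section \<open>Dirichlet eigenvalues and their counting function\<close>

definition eigenspace :: "real \<Rightarrow> real \<Rightarrow> real \<Rightarrow> (complex \<Rightarrow> real) set" where
  "eigenspace a0 b0 l = {u \<in> form_domain0 a0 b0.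
     \<forall>v\<in>form_domain0 a0 b0. form a0 b0 u v = l * (LINT x:gasket|gasket_measure. u x * v x)}"

definition is_eigenvalue :: "real \<Rightarrow> real \<Rightarrow> real \<Rightarrow> bool" where
  "is_eigenvalue a0 b0 l \<longleftrightarrow> (\<exists>u\<in>eigenspace a0 b0 l. u \<noteq> 0)"

global_interpretation real_fun: vector_space "\<lambda>(c::real) (f::complex \<Rightarrow> real) x. c * f x"
  by standard (auto simp: fun_eq_iff algebra_simps)

text \<open>
  Multiplicities and counts take values in \<^typ>\<open>enat\<close>, because \<^const>\<open>real_fun.dim\<close> is 0 on
  infinite-dimensional spaces and finiteness of the counts is part of what is to be shown.
\<close>

definition eigen_mult :: "real \<Rightarrow> real \<Rightarrow> real \<Rightarrow> enat" where
  "eigen_mult a0 b0 l =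
     (if \<exists>B. finite B \<and> eigenspace a0 b0 l \<subseteq> real_fun.span B
      then enat (real_fun.dim (eigenspace a0 b0 l)) else \<infinity>)"

definition eigen_count :: "real \<Rightarrow> real \<Rightarrow> real \<Rightarrow> enat" where
  "eigen_count a0 b0 t = (\<Sum>\<^sub>\<infinity>l\<in>{l. l \<le> t \<and> is_eigenvalue a0 b0 l}. eigen_mult a0 b0 l)"

end

theory Submission
  imports Defs "HOL-Complex_Analysis.Great_Picard"
begin

text \<open>
  Why the exponent is $\log 3/\log(9/2)$. Write $x_n > y_n = z_n$ for the resistances. One
  renormalization step multiplies the ratio $y/x$ by a factor that stays below a constant less
  than one, so the ratio decays geometrically and its squares are summable
  (\<open>tau_decay\<close>). Hence $x_n$ is comparable with $(2/3)^n$, and the conductance $b_n = 1/(2x_n+y_n)$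
  is comparable with $(3/2)^n$ (\<open>b_seq_bounds\<close>), whereas $a_n$ grows like $2^n$. A cell of level $n$
  has measure $3^{-n}$, so energy divided by squared norm lives on the scale
  $(3/2)^n \cdot 3^n = (9/2)^n$ in such a cell, and there are $3^n$ of these cells.

  For the upper bound only the edges at the first vertex of each cell, those of conductance $b_n$,
  are used. A chain of such edges reaches every point of a cell, so the oscillation of a function
  on a cell of level $n$ is at most a constant times $(2/3)^{n/2}$ times the square root of its
  energy there (\<open>Cosc\<close>). A function that vanishes at the first corner of all $3^n$ cells
  therefore has squared norm at most a constant times $(2/9)^n$ times its energy
  (\<open>poincare\<close>); a linear combination of more than $3^n$ independent eigenfunctions with
  eigenvalues below $c(9/2)^n$ could be made to vanish there, which is absurd
  (\<open>eig_independent_bound\<close>).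

  For the lower bound the expensive edges of conductance $a_n$ have to be avoided: the test
  functions depend only on the height above the first vertex, so both ends of every such edge
  carry the same value. As a function of the height the distribution function of a
  Bernoulli$(2/3,1/3)$ digit sequence is taken; its increments are such that its level-$n$ energies
  remain bounded. Two copies of it glued into a bump give, in each of the $3^n$ cells, a function supported
  in that cell whose Rayleigh quotient is at most a constant times $(9/2)^n$
  (\<open>test_functions\<close>). Passing from test functions to eigenvalues is the usual variational
  argument: if there were fewer than $3^n$ eigenvalues below that level, some combination of the
  test functions would be orthogonal to all their eigenfunctions, and a minimizer of the Rayleigh
  quotient on the orthogonal complement would be one more eigenfunction
  (\<open>minimizer_exists\<close>, \<open>minimizer_eigenfunction\<close>, \<open>eigen_count_lower\<close>).
  The compactness behind the minimizer comes again from the oscillation estimate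
  (\<open>F0_compact\<close>).

  The argument rests on four facts about the objects themselves: the gasket is the
  attractor (\<open>gasket_props\<close>), Hausdorff measure is a Borel measure
  (\<open>metric_outer_measure_borel\<close>) that is positive and finite on the gasket and gives
  every cell its share (\<open>emeasure_cell\<close>), the resistances exist and are unique
  (\<open>resistance_seq_eq\<close>), and the discrete energies increase (\<open>tri_mono\<close>).
\<close>

section \<open>Linear algebra\<close>

text \<open>
  Fewer equations than unknowns: Gaussian elimination of one unknown per equation. Both halves of
  the eigenvalue estimate produce their contradiction from this.
\<close>

lemma homogeneous_system_nontrivial:
  fixes A :: "'j \<Rightarrow> 'i \<Rightarrow> real"
  assumes "finite J" "finite I" "card J < card I"
  shows "\<exists>c. (\<exists>i\<in>I. c i \<noteq> 0) \<and> (\<forall>j\<in>J. (\<Sum>i\<in>I. c i * A j i) = 0)"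
  using assms
proof (induction J arbitrary: I A rule: finite_induct)
  case empty
  then obtain i where "i \<in> I" by (metis card.empty card_gt_0_iff ex_in_conv)
  then show ?case by (intro exI[of _ "\<lambda>_. 1"]) auto
next
  case (insert j J)
  show ?case
  proof (cases "\<exists>k\<in>I. A j k \<noteq> 0")
    case False
    have "card J < card I" using insert by simp
    from insert.IH[OF insert.prems(1) this, of A] obtain c
      where "\<exists>i\<in>I. c i \<noteq> 0" "\<forall>j\<in>J. (\<Sum>i\<in>I. c i * A j i) = 0" by blast
    with False show ?thesis by (intro exI[of _ c]) auto
  next
    case True
    then obtain k where k: "k \<in> I" "A j k \<noteq> 0" by blast
    define I' where "I' = I - {k}"
    have I': "finite I'" "card J < card I'" "k \<notin> I'" "I = insert k I'"
      using insert k by (auto simp: I'_def)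
    from insert.IH[OF I'(1,2), of "\<lambda>j' i. A j' i - A j' k * A j i / A j k"] obtain c
      where c: "\<exists>i\<in>I'. c i \<noteq> 0"
        "\<And>j'. j' \<in> J \<Longrightarrow> (\<Sum>i\<in>I'. c i * (A j' i - A j' k * A j i / A j k)) = 0" by blast
    define d where "d = (\<lambda>i. if i = k then - (\<Sum>i\<in>I'. c i * A j i) / A j k else c i)"
    have sum_d: "(\<Sum>i\<in>I. d i * A j' i) = d k * A j' k + (\<Sum>i\<in>I'. c i * A j' i)" for j'
    proof -
      have "(\<Sum>i\<in>I'. d i * A j' i) = (\<Sum>i\<in>I'. c i * A j' i)"
        using I' by (intro sum.cong) (auto simp: d_def)
      then show ?thesis using I' by simp
    qed
    have dk: "d k = - (\<Sum>i\<in>I'. c i * A j i) / A j k" by (simp add: d_def)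
    have "(\<Sum>i\<in>I. d i * A j' i) = 0" if "j' \<in> insert j J" for j'
    proof (cases "j' = j")
      case True
      then show ?thesis unfolding sum_d dk using k by simp
    next
      case False
      then have "(\<Sum>i\<in>I'. c i * A j' i) - (\<Sum>i\<in>I'. c i * A j i) * (A j' k / A j k) = 0"
      proof -
        have "(\<Sum>i\<in>I'. c i * A j' i - (c i * A j i) * (A j' k / A j k)) = 0"
          using c(2)[of j'] that False by (simp add: algebra_simps)
        then show ?thesis by (simp only: sum_subtractf sum_distrib_right)
      qed
      moreover have "(\<Sum>i\<in>I'. c i * A j i) * (A j' k / A j k) = (\<Sum>i\<in>I'. c i * A j i) / A j k * A j' k" by simp
      ultimately show ?thesis unfolding sum_d dk by linarith
    qed
    moreover have "\<exists>i\<in>I. d i \<noteq> 0" using c(1) I' by (auto simp: d_def)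
    ultimately show ?thesis by blast
  qed
qed

text \<open>
  Turns an infinite multiplicity into arbitrarily large finite independent sets, to which the
  counting bounds apply.
\<close>

lemma independent_subset_of_card:
  assumes "\<And>B. finite B \<Longrightarrow> \<not> S \<subseteq> real_fun.span B"
  shows "\<exists>B. finite B \<and> B \<subseteq> S \<and> real_fun.independent B \<and> card B = k"
proof (induction k)
  case 0
  show ?case by (intro exI[of _ "{}"]) (simp add: real_fun.independent_empty)
next
  case (Suc k)
  then obtain B where B: "finite B" "B \<subseteq> S" "real_fun.independent B" "card B = k" by blast
  then obtain x where x: "x \<in> S" "x \<notin> real_fun.span B" using assms by blast
  then have "x \<notin> B" using real_fun.span_base by blast
  then show ?case using B x
    by (intro exI[of _ "insert x B"]) (simp add: real_fun.independent_insertI)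
qed

section \<open>Metric outer measures\<close>

text \<open>
  Caratheodory's criterion. A set $E$ is cut by the distance to $C$ into the part \<open>D n\<close> at distance at
  least $1/(n+1)$ and the shells \<open>R k\<close> further in. Additivity on separated sets applies to
  $E \cap C$ and \<open>D n\<close>; it also applies to every other shell, so that the shells have a convergent
  sum and the part of $E - C$ missed by \<open>D n\<close> is negligible as $n$ grows.
\<close>

lemma metric_outer_measure_closed_measurable:
  fixes f :: "'a::metric_space set \<Rightarrow> ennreal"
  assumes oms: "outer_measure_space (Pow UNIV) f"
    and sep: "\<And>A B d. \<lbrakk>0 < d; \<And>x y. x \<in> A \<Longrightarrow> y \<in> B \<Longrightarrow> d \<le> dist x y\<rbrakk> \<Longrightarrow> f A + f B \<le> f (A \<union> B)"
    and C: "closed C"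
  shows "C \<in> lambda_system UNIV (Pow UNIV) f"
proof (cases "C = {}")
  case True
  interpret sigma_algebra UNIV "Pow UNIV :: 'a set set" by (rule sigma_algebra_Pow)
  show ?thesis using True oms lambda_system_empty by (auto simp: outer_measure_space_def)
next
  case False
  interpret sigma_algebra UNIV "Pow UNIV :: 'a set set" by (rule sigma_algebra_Pow)
  have pos: "f {} = 0" and mono: "\<And>A B. A \<subseteq> B \<Longrightarrow> f A \<le> f B"
    and csa: "countably_subadditive (Pow UNIV) f"
    using oms by (auto simp: outer_measure_space_def positive_def increasing_def)
  have posi: "positive (Pow UNIV) f" using pos by (simp add: positive_def)
  have sa: "f (A \<union> B) \<le> f A + f B" for A B
  proof -
    have "f (A \<union> (B - A)) \<le> f A + f (B - A)"
      using countably_subadditive_subadditive[OF posi csa] unfolding subadditive_def by blast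
    also have "\<dots> \<le> f A + f B" by (intro add_left_mono mono) auto
    finally show ?thesis by simp
  qed
  have csaD: "f (\<Union>i. A i) \<le> (\<Sum>i. f (A i))" for A :: "nat \<Rightarrow> 'a set"
  proof -
    have "f (\<Union>i. A i) = f (\<Union>i. disjointed A i)" by (simp add: UN_disjointed_eq)
    also have "\<dots> \<le> (\<Sum>i. f (disjointed A i))"
      using csa disjoint_family_disjointed[of A] by (auto simp: countably_subadditive_def)
    also have "\<dots> \<le> (\<Sum>i. f (A i))" by (intro suminf_le mono disjointed_subset) auto
    finally show ?thesis .
  qed
  have key: "f (E \<inter> C) + f (E - C) \<le> f E" for E
  proof (cases "f E = top")
    case fin: False
    define D where "D n = {x \<in> E. 1 / (real n + 1) \<le> infdist x C}" for n
    define R where "R n = D (Suc n) - D n" for n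
    have D_mono: "D n \<subseteq> D m" if "n \<le> m" for n m
    proof
      fix x assume x: "x \<in> D n"
      have "1 / (real m + 1) \<le> 1 / (real n + 1)" using that by (intro divide_left_mono) auto
      then show "x \<in> D m" using x by (auto simp: D_def)
    qed
    have D_un: "E - C \<subseteq> (\<Union>n. D n)"
    proof
      fix x assume x: "x \<in> E - C"
      then have "infdist x C > 0" using C False
        by (metis Diff_iff in_closed_iff_infdist_zero infdist_nonneg order_le_less)
      then obtain n where "inverse (real (Suc n)) < infdist x C" using reals_Archimedean by blast
      then show "x \<in> (\<Union>n. D n)" using x by (auto simp: D_def inverse_eq_divide add.commute intro!: exI[of _ n])
    qed
    have infd: "infdist x C \<le> infdist y C + dist x y" for x y by (rule infdist_triangle)
    have alt: "(\<Sum>k<m. f (R (2 * k + p))) \<le> f (\<Union>k<m. R (2 * k + p))" for m p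
    proof (induction m)
      case (Suc m)
      define d where "d = 1 / (real (2 * m + p)) - 1 / (real (2 * m + p) + 1)"
      have "f (\<Union>k<m. R (2 * k + p)) + f (R (2 * m + p)) \<le> f ((\<Union>k<m. R (2 * k + p)) \<union> R (2 * m + p))"
      proof (cases "m = 0")
        case m: False
        show ?thesis
        proof (rule sep)
          have "real (2 * m + p) > 0" using m by simp
          then have "1 / (real (2 * m + p) + 1) < 1 / real (2 * m + p)"
            by (intro divide_strict_left_mono mult_pos_pos) auto
          then show "0 < d" unfolding d_def by simp
          fix x y assume x: "x \<in> (\<Union>k<m. R (2 * k + p))" and y: "y \<in> R (2 * m + p)"
          from x obtain k where k: "k < m" "x \<in> D (Suc (2 * k + p))" by (auto simp: R_def)
          have "Suc (2 * k + p) \<le> 2 * m + p - 1" using k(1) by arith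
          then have "x \<in> D (2 * m + p - 1)" using k D_mono by blast
          then have "1 / (real (2 * m + p)) \<le> infdist x C" using m by (auto simp: D_def of_nat_diff)
          moreover have "infdist y C \<le> 1 / (real (2 * m + p) + 1)" using y by (auto simp: R_def D_def)
          ultimately show "d \<le> dist x y" using infd[of x y] by (simp add: d_def)
        qed
      qed (simp add: pos)
      also have "(\<Union>k<m. R (2 * k + p)) \<union> R (2 * m + p) = (\<Union>k<Suc m. R (2 * k + p))"
        by (auto simp: less_Suc_eq)
      finally have "f (\<Union>k<m. R (2 * k + p)) + f (R (2 * m + p)) \<le> f (\<Union>k<Suc m. R (2 * k + p))" .
      then show ?case using add_right_mono[OF Suc, of "f (R (2 * m + p))"]
        unfolding sum.lessThan_Suc by (rule order_trans[rotated])
    qed (simp add: pos)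
    have RE: "R k \<subseteq> E" for k by (auto simp: R_def D_def)
    have alt': "(\<Sum>k<m. f (R (2 * k + p))) \<le> f E" for m p
    proof -
      have "(\<Union>k<m. R (2 * k + p)) \<subseteq> E" using RE by blast
      from order_trans[OF alt mono[OF this]] show ?thesis .
    qed
    \<comment> \<open>Even and odd shells are summed separately: neighbouring shells may touch.\<close>
    have part: "(\<Sum>k<n. f (R k)) \<le> f E + f E" for n
    proof -
      have "(\<Sum>k<n. f (R k)) \<le> (\<Sum>k<2 * n. f (R k))" by (intro sum_mono2) auto
      also have "\<dots> = (\<Sum>k<n. f (R (2 * k + 0))) + (\<Sum>k<n. f (R (2 * k + 1)))"
        by (induction n) (simp_all add: algebra_simps)
      also have "\<dots> \<le> f E + f E" by (intro add_mono alt')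
      finally show ?thesis .
    qed
    have S: "(\<Sum>k. f (R k)) \<le> f E + f E" by (intro suminf_le_const summableI part)
    then have S': "(\<Sum>k. f (R k)) \<noteq> top" using fin by (metis ennreal_add_eq_top neq_top_trans)
    define r where "r k = enn2real (f (R k))" for k
    have fr: "f (R k) = ennreal (r k)" for k
    proof -
      have "f (R k) \<noteq> top" using fin mono[OF RE[of k]] neq_top_trans by blast
      then show ?thesis by (simp add: r_def top.not_eq_extremum)
    qed
    have r0: "r k \<ge> 0" for k by (simp add: r_def)
    have rs: "summable r" using S' r0 by (intro summable_suminf_not_top) (auto simp: fr)
    show ?thesis
    proof (rule ennreal_le_epsilon)
      fix e :: real assume e: "0 < e"
      obtain n where n: "norm (\<Sum>i. r (i + n)) < e" using suminf_exist_split[OF e rs] by blast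
      have tail: "(\<Sum>i. f (R (i + n))) \<le> ennreal e"
      proof -
        have "(\<Sum>i. f (R (i + n))) = ennreal (\<Sum>i. r (i + n))"
          unfolding fr using r0 rs by (intro suminf_ennreal2) (auto simp: summable_iff_shift)
        then show ?thesis using n by (simp add: ennreal_leI)
      qed
      have "E - C \<subseteq> D n \<union> (\<Union>i. R (i + n))"
      proof
        fix x assume "x \<in> E - C"
        then obtain m where m: "x \<in> D m" using D_un by blast
        define l where "l = (LEAST m. x \<in> D m)"
        have l: "x \<in> D l" "\<And>k. k < l \<Longrightarrow> x \<notin> D k" unfolding l_def using m
          by (auto intro: LeastI dest: not_less_Least)
        show "x \<in> D n \<union> (\<Union>i. R (i + n))"
        proof (cases "l \<le> n")
          case True then show ?thesis using l D_mono by blast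
        next
          case False
          then have "x \<in> R (l - 1 - n + n)" using l(1) l(2)[of "l - 1"] by (auto simp: R_def)
          then show ?thesis by blast
        qed
      qed
      then have "f (E - C) \<le> f (D n \<union> (\<Union>i. R (i + n)))" by (rule mono)
      also have "\<dots> \<le> f (D n) + (\<Sum>i. f (R (i + n)))" by (rule order_trans[OF sa add_left_mono[OF csaD]])
      also have "\<dots> \<le> f (D n) + ennreal e" using tail by (rule add_left_mono)
      finally have "f (E \<inter> C) + f (E - C) \<le> (f (E \<inter> C) + f (D n)) + ennreal e"
        by (simp add: add.assoc add_left_mono)
      also have "f (E \<inter> C) + f (D n) \<le> f ((E \<inter> C) \<union> D n)"
      proof (rule sep)
        show "0 < 1 / (real n + 1)" by simp
        fix x y assume "x \<in> E \<inter> C" "y \<in> D n"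
        then have "infdist x C = 0" "1 / (real n + 1) \<le> infdist y C" by (auto simp: D_def)
        then show "1 / (real n + 1) \<le> dist x y" using infd[of y x] by (simp add: dist_commute)
      qed
      also have "\<dots> \<le> f E" by (intro mono) (auto simp: D_def)
      finally show "f (E \<inter> C) + f (E - C) \<le> f E + ennreal e" by (simp add: add_right_mono)
    qed
  qed simp
  have "f (E \<inter> C) + f (E - C) = f E" for E
    using key[of E] sa[of "E \<inter> C" "E - C"] by (simp add: Int_Diff_Un antisym)
  then show ?thesis unfolding lambda_system_eq by simp
qed

lemma metric_outer_measure_borel:
  fixes f :: "'a::metric_space set \<Rightarrow> ennreal"
  assumes oms: "outer_measure_space (Pow UNIV) f"
    and sep: "\<And>A B d. \<lbrakk>0 < d; \<And>x y. x \<in> A \<Longrightarrow> y \<in> B \<Longrightarrow> d \<le> dist x y\<rbrakk> \<Longrightarrow> f A + f B \<le> f (A \<union> B)"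
  shows "measure_space UNIV (sets borel) f"
proof -
  interpret sigma_algebra UNIV "Pow UNIV :: 'a set set" by (rule sigma_algebra_Pow)
  define L where "L = lambda_system UNIV (Pow UNIV) f"
  have L: "measure_space UNIV L f" unfolding L_def by (rule caratheodory_lemma[OF oms])
  then have sL: "sigma_algebra UNIV L" by (simp add: measure_space_def)
  have "sets borel = sigma_sets UNIV (Collect closed :: 'a set set)"
    unfolding borel_eq_closed by simp
  also have "\<dots> \<subseteq> L"
    using metric_outer_measure_closed_measurable[OF oms sep]
    by (intro sigma_algebra.sigma_sets_subset[OF sL]) (auto simp: L_def)
  finally have sub: "sets borel \<subseteq> L" .
  have "sigma_algebra UNIV (sets (borel :: 'a measure))"
    by (metis sets.sigma_algebra_axioms space_borel)
  moreover have "countably_additive (sets borel) f"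
    using L sub unfolding measure_space_def countably_additive_def by (meson order_trans subsetD)
  moreover have "positive (sets borel) f" using L by (simp add: measure_space_def positive_def)
  ultimately show ?thesis by (simp add: measure_space_def)
qed

section \<open>Hausdorff measures\<close>

lemma hausdorff_premeasure_le:
  assumes "A \<subseteq> (\<Union>i. U i)" "\<And>i. bounded (U i)" "\<And>i. diameter (U i) \<le> d"
  shows "hausdorff_premeasure s d A \<le> (\<Sum>i. ennreal (diameter (U i) powr s))"
  unfolding hausdorff_premeasure_def using assms by (intro INF_lower) auto

lemma hausdorff_premeasure_mono:
  "A \<subseteq> B \<Longrightarrow> hausdorff_premeasure s d A \<le> hausdorff_premeasure s d B"
  unfolding hausdorff_premeasure_def by (intro INF_superset_mono) auto

lemma hausdorff_premeasure_antimono: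
  "d \<le> e \<Longrightarrow> hausdorff_premeasure s e A \<le> hausdorff_premeasure s d A"
  unfolding hausdorff_premeasure_def by (intro INF_superset_mono) (auto intro: order_trans)

lemma hausdorff_premeasure_empty: "0 \<le> d \<Longrightarrow> hausdorff_premeasure s d {} = 0"
  using hausdorff_premeasure_le[of "{}" "\<lambda>_. {}" d s] by (simp add: diameter_def)

text \<open>
  Near-optimal covers of the pieces, with errors $\varepsilon 2^{-i-1}$, are interleaved into one
  cover of the union.
\<close>

lemma hausdorff_premeasure_countably_subadditive:
  fixes A :: "nat \<Rightarrow> 'a::metric_space set"
  shows "hausdorff_premeasure s d (\<Union>i. A i) \<le> (\<Sum>i. hausdorff_premeasure s d (A i))"
proof (cases "(\<Sum>i. hausdorff_premeasure s d (A i)) = top")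
  case False
  define h where "h i = hausdorff_premeasure s d (A i)" for i
  have h: "h i \<noteq> top" for i
    using ennreal_suminf_lessD[of "\<lambda>i. hausdorff_premeasure s d (A i)" top i] False
    by (simp add: h_def top.not_eq_extremum)
  show ?thesis
  proof (rule ennreal_le_epsilon)
    fix e :: real assume e: "0 < e"
    have "\<exists>U :: nat \<Rightarrow> 'a set. A i \<subseteq> (\<Union>j. U j) \<and> (\<forall>j. bounded (U j) \<and> diameter (U j) \<le> d) \<and>
       (\<Sum>j. ennreal (diameter (U j) powr s)) \<le> h i + ennreal (e * (1 / 2) ^ Suc i)" for i
    proof -
      have "h i < h i + ennreal (e * (1 / 2) ^ Suc i)" using h[of i] e
        by (simp add: ennreal_lessI top.not_eq_extremum)
      then show ?thesis unfolding h_def[of i] hausdorff_premeasure_def INF_less_iff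
        by (auto intro: less_imp_le)
    qed
    then obtain U where U: "\<And>i. A i \<subseteq> (\<Union>j. U i j)" "\<And>i j. bounded (U i j :: 'a set)"
      "\<And>i j. diameter (U i j) \<le> d"
      "\<And>i. (\<Sum>j. ennreal (diameter (U i j) powr s)) \<le> h i + ennreal (e * (1 / 2) ^ Suc i)"
      by metis
    define V where "V n = (case prod_decode n of (i, j) \<Rightarrow> U i j)" for n
    have "hausdorff_premeasure s d (\<Union>i. A i) \<le> (\<Sum>n. ennreal (diameter (V n) powr s))"
    proof (rule hausdorff_premeasure_le)
      show "(\<Union>i. A i) \<subseteq> (\<Union>n. V n)"
      proof
        fix x assume "x \<in> (\<Union>i. A i)"
        then obtain i j where "x \<in> U i j" using U(1) by blast
        then have "x \<in> V (prod_encode (i, j))" by (simp add: V_def)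
        then show "x \<in> (\<Union>n. V n)" by blast
      qed
    qed (auto simp: V_def U split: prod.splits)
    also have "\<dots> = (\<Sum>n. (\<lambda>(i, j). ennreal (diameter (U i j) powr s)) (prod_decode n))"
      by (simp add: V_def case_prod_beta)
    also have "\<dots> = (\<Sum>i. \<Sum>j. ennreal (diameter (U i j) powr s))"
      by (rule suminf_ennreal_2dimen) simp
    also have "\<dots> \<le> (\<Sum>i. h i + ennreal (e * (1 / 2) ^ Suc i))"
      by (intro suminf_le U summableI)
    also have "\<dots> = (\<Sum>i. h i) + (\<Sum>i. ennreal (e * (1 / 2) ^ Suc i))"
      by (intro suminf_add[symmetric] summableI)
    also have "(\<Sum>i. ennreal (e * (1 / 2) ^ Suc i)) = ennreal e"
    proof -
      have "(\<lambda>i. e * (1 / 2) ^ Suc i) sums (e * 1)" by (intro sums_mult power_half_series)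
      then show ?thesis using e by (intro suminf_ennreal_eq) auto
    qed
    finally show "hausdorff_premeasure s d (\<Union>i. A i) \<le> (\<Sum>i. hausdorff_premeasure s d (A i)) + ennreal e"
      by (simp add: h_def)
  qed
qed simp

text \<open>
  A covering set of diameter less than the gap meets at most one of the two pieces, so each cover
  splits into two.
\<close>

lemma hausdorff_premeasure_separated:
  fixes A B :: "'a::metric_space set"
  assumes d: "d < e" "0 \<le> d" and sep: "\<And>x y. x \<in> A \<Longrightarrow> y \<in> B \<Longrightarrow> e \<le> dist x y"
  shows "hausdorff_premeasure s d A + hausdorff_premeasure s d B \<le> hausdorff_premeasure s d (A \<union> B)"
  unfolding hausdorff_premeasure_def[of s d "A \<union> B"]
proof (rule INF_greatest)
  fix U :: "nat \<Rightarrow> 'a set"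
  assume "U \<in> {U. A \<union> B \<subseteq> (\<Union>i. U i) \<and> (\<forall>i. bounded (U i) \<and> diameter (U i) \<le> d)}"
  then have U: "A \<union> B \<subseteq> (\<Union>i. U i)" "\<And>i. bounded (U i)" "\<And>i. diameter (U i) \<le> d" by auto
  define V where "V S i = (if U i \<inter> S = {} then {} else U i)" for S i
  have V: "hausdorff_premeasure s d S \<le> (\<Sum>i. ennreal (diameter (V S i) powr s))" if SAB: "S \<subseteq> A \<union> B" for S
  proof (rule hausdorff_premeasure_le)
    show "S \<subseteq> (\<Union>i. V S i)"
    proof
      fix x assume x: "x \<in> S"
      then obtain i where "x \<in> U i" using U(1) SAB by blast
      then have "x \<in> V S i" using x by (auto simp: V_def)
      then show "x \<in> (\<Union>i. V S i)" by blast
    qed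
    show "bounded (V S i)" "diameter (V S i) \<le> d" for i using U d by (auto simp: V_def)
  qed
  have one: "ennreal (diameter (V A i) powr s) + ennreal (diameter (V B i) powr s) \<le> ennreal (diameter (U i) powr s)" for i
  proof (cases "U i \<inter> A = {} \<or> U i \<inter> B = {}")
    case True then show ?thesis by (auto simp: V_def)
  next
    case False
    then obtain x y where "x \<in> U i" "x \<in> A" "y \<in> U i" "y \<in> B" by blast
    then have "e \<le> d" using sep[of x y] diameter_bounded_bound[OF U(2), of x i y] U(3)[of i] by linarith
    then show ?thesis using d by simp
  qed
  have "hausdorff_premeasure s d A + hausdorff_premeasure s d B
      \<le> (\<Sum>i. ennreal (diameter (V A i) powr s)) + (\<Sum>i. ennreal (diameter (V B i) powr s))"
    by (intro add_mono V) auto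
  also have "\<dots> = (\<Sum>i. ennreal (diameter (V A i) powr s) + ennreal (diameter (V B i) powr s))"
    by (intro suminf_add summableI)
  also have "\<dots> \<le> (\<Sum>i. ennreal (diameter (U i) powr s))" by (intro suminf_le one summableI)
  finally show "hausdorff_premeasure s d A + hausdorff_premeasure s d B \<le> (\<Sum>i. ennreal (diameter (U i) powr s))" .
qed

lemma hausdorff_outer_measure_space: "outer_measure_space (Pow UNIV) (hausdorff_outer_measure s :: 'a::metric_space set \<Rightarrow> ennreal)"
  unfolding outer_measure_space_def
proof (intro conjI)
  show "positive (Pow UNIV) (hausdorff_outer_measure s :: 'a set \<Rightarrow> ennreal)"
    by (simp add: positive_def hausdorff_outer_measure_def hausdorff_premeasure_empty)
  show "increasing (Pow UNIV) (hausdorff_outer_measure s :: 'a set \<Rightarrow> ennreal)"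
    unfolding increasing_def hausdorff_outer_measure_def
    by (auto intro!: SUP_mono' hausdorff_premeasure_mono)
  show "countably_subadditive (Pow UNIV) (hausdorff_outer_measure s :: 'a set \<Rightarrow> ennreal)"
    unfolding countably_subadditive_def
  proof (intro allI impI)
    fix A :: "nat \<Rightarrow> 'a set"
    show "hausdorff_outer_measure s (\<Union>i. A i) \<le> (\<Sum>i. hausdorff_outer_measure s (A i))"
      unfolding hausdorff_outer_measure_def[of s "\<Union>i. A i"]
    proof (rule SUP_least)
      fix d :: real assume d: "d \<in> {0<..}"
      have "hausdorff_premeasure s d (\<Union>i. A i) \<le> (\<Sum>i. hausdorff_premeasure s d (A i))"
        by (rule hausdorff_premeasure_countably_subadditive)
      also have "\<dots> \<le> (\<Sum>i. hausdorff_outer_measure s (A i))"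
        unfolding hausdorff_outer_measure_def using d by (intro suminf_le summableI SUP_upper)
      finally show "hausdorff_premeasure s d (\<Union>i. A i) \<le> (\<Sum>i. hausdorff_outer_measure s (A i))" .
    qed
  qed
qed

lemma hausdorff_outer_measure_separated:
  fixes A B :: "'a::metric_space set"
  assumes e: "0 < e" and sep: "\<And>x y. x \<in> A \<Longrightarrow> y \<in> B \<Longrightarrow> e \<le> dist x y"
  shows "hausdorff_outer_measure s A + hausdorff_outer_measure s B \<le> hausdorff_outer_measure s (A \<union> B)"
proof -
  let ?h = "hausdorff_premeasure s"
  have "hausdorff_outer_measure s A + hausdorff_outer_measure s B = (SUP d\<in>{0<..}. ?h d A + ?h d B)"
    unfolding hausdorff_outer_measure_def
  proof (rule SUP_add_directed_ennreal[symmetric])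
    fix d d' :: real assume "d \<in> {0<..}" "d' \<in> {0<..}"
    then show "\<exists>k\<in>{0<..}. ?h d A + ?h d' B \<le> ?h k A + ?h k B"
      by (intro bexI[of _ "min d d'"] add_mono hausdorff_premeasure_antimono) auto
  qed
  also have "\<dots> \<le> hausdorff_outer_measure s (A \<union> B)"
  proof (rule SUP_least)
    fix d :: real assume d: "d \<in> {0<..}"
    define k where "k = min d (e / 2)"
    have k: "0 < k" "k < e" "k \<le> d" using d e by (auto simp: k_def)
    have "?h d A + ?h d B \<le> ?h k A + ?h k B" using k by (intro add_mono hausdorff_premeasure_antimono)
    also have "\<dots> \<le> ?h k (A \<union> B)" using k sep by (intro hausdorff_premeasure_separated) auto
    also have "\<dots> \<le> hausdorff_outer_measure s (A \<union> B)"
      unfolding hausdorff_outer_measure_def using k by (intro SUP_upper) auto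
    finally show "?h d A + ?h d B \<le> hausdorff_outer_measure s (A \<union> B)" .
  qed
  finally show ?thesis .
qed

lemma
  shows sets_hausdorff_measure: "sets (hausdorff_measure s :: 'a::metric_space measure) = sets borel"
    and space_hausdorff_measure: "space (hausdorff_measure s :: 'a::metric_space measure) = UNIV"
    and emeasure_hausdorff_measure: "A \<in> sets borel \<Longrightarrow> emeasure (hausdorff_measure s) A = hausdorff_outer_measure s (A :: 'a::metric_space set)"
proof -
  have ms: "measure_space UNIV (sets borel) (hausdorff_outer_measure s :: 'a set \<Rightarrow> _)"
    by (intro metric_outer_measure_borel hausdorff_outer_measure_space hausdorff_outer_measure_separated)
  have sa: "sigma_algebra UNIV (sets (borel :: 'a measure))"
    by (metis sets.sigma_algebra_axioms space_borel)
  show "sets (hausdorff_measure s :: 'a measure) = sets borel" "space (hausdorff_measure s :: 'a measure) = UNIV"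
    unfolding hausdorff_measure_def
    by (simp_all add: sets_measure_of_conv space_measure_of_conv sigma_algebra.sigma_sets_eq[OF sa])
  show "emeasure (hausdorff_measure s) A = hausdorff_outer_measure s A" if "A \<in> sets borel"
    using ms that sa unfolding hausdorff_measure_def
    by (intro emeasure_measure_of_sigma) (auto simp: measure_space_def)
qed

section \<open>The gasket as an attractor\<close>

abbreviation letters :: "nat set" where "letters \<equiv> {1, 2, 3}"

lemma gasket_map_eq: "gasket_map i x = (x + gasket_vertex i) / 2"
  by (simp add: gasket_map_def field_simps)

text \<open>
  The simplifier writes the index $1$ as \<^term>\<open>Suc 0\<close>, hence the doubled entry.
\<close>

lemma gasket_vertex_simps:
  "gasket_vertex 1 = 0" "gasket_vertex (Suc 0) = 0" "gasket_vertex 2 = 1" "gasket_vertex 3 = Complex (1 / 2) (sqrt 3 / 2)"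
proof -
  have "exp (of_real pi * \<i> / 3) = cis (pi / 3)" by (simp add: cis_conv_exp mult.commute)
  then show "gasket_vertex 3 = Complex (1 / 2) (sqrt 3 / 2)"
    by (simp add: gasket_vertex_def complex_eq_iff cos_60 sin_60)
qed (simp_all add: gasket_vertex_def)

lemma norm_gasket_vertex: "norm (gasket_vertex i) \<le> 1"
  by (simp add: gasket_vertex_def)

lemma dist_gasket_map: "dist (gasket_map i x) (gasket_map i y) = dist x y / 2"
proof -
  have "gasket_map i x - gasket_map i y = (x - y) / 2" by (simp add: gasket_map_eq field_simps)
  moreover have "norm ((x - y) / 2) = norm (x - y) / 2" by (simp add: norm_divide)
  ultimately show ?thesis by (simp only: dist_norm)
qed

lemma inj_gasket_map: "inj (gasket_map i)"
  by (auto simp: inj_def gasket_map_eq)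

lemma continuous_gasket_map: "continuous_on A (gasket_map i)"
  unfolding gasket_map_def[abs_def] by (intro continuous_intros)

definition hutchinson :: "complex set \<Rightarrow> complex set" where
  "hutchinson A = (\<Union>i\<in>letters. gasket_map i ` A)"

lemma hutchinson_iff: "x \<in> hutchinson A \<longleftrightarrow> (\<exists>i\<in>letters. \<exists>y\<in>A. x = gasket_map i y)"
  by (simp add: hutchinson_def image_iff)

lemma hutchinson_mono: "A \<subseteq> B \<Longrightarrow> hutchinson A \<subseteq> hutchinson B"
  by (auto simp: hutchinson_def)

lemma compact_hutchinson: "compact A \<Longrightarrow> compact (hutchinson A)"
  unfolding hutchinson_def by (intro compact_UN compact_continuous_image continuous_gasket_map) auto

lemma gasket_word_map_simps [simp]:
  "gasket_word_map [] = id" "gasket_word_map (i # w) = gasket_map i \<circ> gasket_word_map w"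
  by (simp_all add: gasket_word_map_def)

abbreviation cell :: "nat list \<Rightarrow> complex set" where "cell w \<equiv> gasket_word_map w ` gasket"

abbreviation corner :: "nat list \<Rightarrow> nat \<Rightarrow> complex" where
  "corner w i \<equiv> gasket_word_map w (gasket_vertex i)"

lemma gasket_word_map_append: "gasket_word_map (v @ w) = gasket_word_map v \<circ> gasket_word_map w"
  by (induction v) auto

lemma dist_gasket_word_map: "dist (gasket_word_map w x) (gasket_word_map w y) = dist x y / 2 ^ length w"
  by (induction w) (auto simp: dist_gasket_map)

lemma continuous_gasket_word_map: "continuous_on A (gasket_word_map w)"
proof (induction w)
  case (Cons i w)
  show ?case unfolding gasket_word_map_simps
    by (intro continuous_on_compose Cons continuous_gasket_map)
qed (simp add: continuous_on_id)

lemma words_0 [simp]: "words 0 = {[]}"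
  by (auto simp: words_def)

lemma words_Suc: "words (Suc n) = (\<lambda>(i, w). i # w) ` (letters \<times> words n)"
  by (auto simp: words_def length_Suc_conv image_iff)

lemma words_SucE:
  assumes "w \<in> words (Suc n)"
  obtains i v where "w = i # v" "i \<in> letters" "v \<in> words n"
proof -
  obtain i v where "w = i # v" using assms by (cases w) (auto simp: words_def)
  then show ?thesis using assms by (intro that[of i v]) (auto simp: words_def)
qed

lemma length_words: "w \<in> words n \<Longrightarrow> length w = n"
  by (simp add: words_def)

lemma finite_words [simp]: "finite (words n)"
  by (induction n) (auto simp: words_Suc)

lemma card_words: "card (words n) = 3 ^ n"
proof (induction n)
  case (Suc n)
  have "card (words (Suc n)) = card (letters \<times> words n)"
    unfolding words_Suc by (intro card_image) (auto simp: inj_on_def)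
  then show ?case using Suc by simp
qed simp

lemma append_words: "v \<in> words m \<Longrightarrow> w \<in> words n \<Longrightarrow> v @ w \<in> words (m + n)"
  by (auto simp: words_def)

lemma words_add: "words (m + n) = (\<lambda>(v, w). v @ w) ` (words m \<times> words n)"
proof -
  have "\<exists>v\<in>words m. \<exists>w'\<in>words n. w = v @ w'" if "w \<in> words (m + n)" for w
    using that by (intro bexI[of _ "take m w"] bexI[of _ "drop m w"])
      (auto simp: words_def dest: in_set_takeD in_set_dropD)
  then show ?thesis by (fastforce intro: append_words)
qed

lemma sum_words_add: "sum g (words (m + n)) = (\<Sum>v\<in>words m. \<Sum>w\<in>words n. g (v @ w))"
proof -
  have "inj_on (\<lambda>(v, w). v @ w) (words m \<times> words n)"
    by (auto simp: inj_on_def words_def)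
  then have "sum g (words (m + n)) = (\<Sum>(v, w)\<in>words m \<times> words n. g (v @ w))"
    unfolding words_add by (subst sum.reindex) (auto simp: case_prod_beta intro!: sum.cong)
  then show ?thesis by (simp add: sum.cartesian_product)
qed

lemma sum_words_Suc: "sum g (words (Suc n)) = (\<Sum>w\<in>words n. g (1 # w) + g (2 # w) + g (3 # w))"
proof -
  have "sum g (words (Suc n)) = (\<Sum>(i, w)\<in>letters \<times> words n. g (i # w))"
    unfolding words_Suc by (subst sum.reindex) (auto simp: inj_on_def case_prod_beta intro!: sum.cong)
  also have "\<dots> = (\<Sum>i\<in>letters. \<Sum>w\<in>words n. g (i # w))" by (simp add: sum.cartesian_product)
  also have "\<dots> = (\<Sum>w\<in>words n. \<Sum>i\<in>letters. g (i # w))" by (rule sum.swap)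
  finally show ?thesis by (simp add: add.assoc)
qed

lemma invariant_words:
  assumes "A = hutchinson A"
  shows "A = (\<Union>w\<in>words n. gasket_word_map w ` A)"
proof (induction n)
  case (Suc n)
  have "A = hutchinson (\<Union>w\<in>words n. gasket_word_map w ` A)" using assms Suc by simp
  also have "\<dots> = (\<Union>w\<in>words (Suc n). gasket_word_map w ` A)"
  proof (intro set_eqI iffI)
    fix x assume "x \<in> hutchinson (\<Union>w\<in>words n. gasket_word_map w ` A)"
    then obtain i y where i: "i \<in> letters" "x = gasket_map i y" "y \<in> (\<Union>w\<in>words n. gasket_word_map w ` A)"
      by (simp only: hutchinson_iff) blast
    from i(3) obtain w a where x: "w \<in> words n" "a \<in> A" "y = gasket_word_map w a"
      by (elim UN_E imageE)
    have "i # w \<in> words (Suc n)" using i x by (simp add: words_def)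
    moreover have "x = gasket_word_map (i # w) a" using i x by simp
    ultimately
    show "x \<in> (\<Union>w\<in>words (Suc n). gasket_word_map w ` A)" using x(2) by blast
  next
    fix x assume "x \<in> (\<Union>w\<in>words (Suc n). gasket_word_map w ` A)"
    then obtain v a where v: "v \<in> words (Suc n)" "a \<in> A" "x = gasket_word_map v a"
      by (elim UN_E imageE)
    from words_SucE[OF v(1)] obtain i w where w: "v = i # w" "i \<in> letters" "w \<in> words n" .
    then have x: "i \<in> letters" "w \<in> words n" "a \<in> A" "x = gasket_word_map (i # w) a"
      using v by simp_all
    then have "x = gasket_map i (gasket_word_map w a)" by simp
    then show "x \<in> hutchinson (\<Union>w\<in>words n. gasket_word_map w ` A)"
      unfolding hutchinson_iff using x(1-3) by (intro bexI[of _ i] bexI[of _ "gasket_word_map w a"] UN_I[of w]) auto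
  qed
  finally show ?case .
qed simp

lemma word_map_invariant:
  assumes "hutchinson B \<subseteq> B" "b \<in> B" "set w \<subseteq> letters"
  shows "gasket_word_map w b \<in> B"
  using assms(3)
proof (induction w)
  case (Cons i w)
  then have "gasket_map i (gasket_word_map w b) \<in> hutchinson B" by (auto simp: hutchinson_def)
  then show ?case using assms by auto
qed (use assms in simp)

text \<open>
  Contraction: a point of $A$ lies in $F_w(A)$ for words $w$ of every length, hence arbitrarily close
  to the image $F_w(b)$ of a chosen point $b$ of $B$. Applied both ways this is uniqueness of the attractor;
  with $B$ a simple invariant set it localizes the gasket.
\<close>

lemma invariant_subset:
  assumes A: "compact A" "A = hutchinson A" and B: "closed B" "B \<noteq> {}" "hutchinson B \<subseteq> B"
  shows "A \<subseteq> B"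
proof
  fix x assume x: "x \<in> A"
  obtain b where b: "b \<in> B" using B by blast
  have "bounded (insert b A)" using compact_imp_bounded[OF A(1)] by simp
  then obtain D where D: "\<And>y z. y \<in> insert b A \<Longrightarrow> z \<in> insert b A \<Longrightarrow> dist y z \<le> D"
    using bounded_two_points by metis
  have "x \<in> closure B" unfolding closure_approachable
  proof (intro allI impI)
    fix e :: real assume e: "0 < e"
    have "D \<ge> 0" using D[of b b] by simp
    obtain n where n: "D + 1 < e * 2 ^ n"
      using real_arch_pow[of 2 "(D + 1) / e"] e by (auto simp: field_simps)
    obtain w y where w: "w \<in> words n" "y \<in> A" "x = gasket_word_map w y"
      using invariant_words[OF A(2), of n] x by blast
    have "dist (gasket_word_map w b) x = dist b y / 2 ^ n" using w by (simp add: dist_gasket_word_map words_def)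
    also have "\<dots> < e" using D[of b y] w n by (simp add: field_simps)
    finally show "\<exists>y\<in>B. dist y x < e"
      using word_map_invariant[OF B(3) b, of w] w by (auto simp: words_def)
  qed
  then show "x \<in> B" using B by simp
qed

lemma hutchinson_unit_ball: "hutchinson (cball 0 1) \<subseteq> cball 0 1"
proof
  fix z assume "z \<in> hutchinson (cball 0 1)"
  then obtain i x where z: "z = gasket_map i x" "norm x \<le> 1" by (auto simp: hutchinson_def)
  have "norm z = norm (x + gasket_vertex i) / 2" unfolding z(1) gasket_map_eq
    by (simp only: norm_divide) simp
  also have "\<dots> \<le> 1" using norm_triangle_le[of x "gasket_vertex i" 2] norm_gasket_vertex[of i] z by simp
  finally show "z \<in> cball 0 1" by simp
qed

text \<open>
  The iterated images of the closed unit ball decrease, and their intersection is invariant: a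
  point of it has preimages in all iterates, under one and the same map infinitely often.
\<close>

lemma attractor_exists: "\<exists>A. compact A \<and> A \<noteq> {} \<and> A = hutchinson A"
proof -
  define Q where "Q n = (hutchinson ^^ n) (cball 0 1)" for n :: nat
  note Q1 = hutchinson_unit_ball
  have QS: "Q (Suc n) = hutchinson (Q n)" for n by (simp add: Q_def)
  have dec: "Q (Suc n) \<subseteq> Q n" for n
    by (induction n) (use Q1 hutchinson_mono in \<open>auto simp: Q_def\<close>)
  then have anti: "Q n \<subseteq> Q m" if "m \<le> n" for m n using that by (rule lift_Suc_antimono_le)
  have comp: "compact (Q n)" for n by (induction n) (auto simp: QS compact_hutchinson, simp add: Q_def)
  have ne: "Q n \<noteq> {}" for n by (induction n) (auto simp: QS hutchinson_def, simp add: Q_def)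
  define A where "A = (\<Inter>n. Q n)"
  have "compact A" unfolding A_def using comp by (intro compact_Inter) auto
  moreover have "A \<noteq> {}" unfolding A_def by (intro compact_nest) (use comp ne anti in auto)
  moreover have "A = hutchinson A"
  proof
    have "hutchinson A \<subseteq> Q n" for n
    proof -
      have "hutchinson A \<subseteq> Q (Suc n)" unfolding QS by (rule hutchinson_mono) (auto simp: A_def)
      then show ?thesis using dec by blast
    qed
    then show "hutchinson A \<subseteq> A" by (auto simp: A_def)
    show "A \<subseteq> hutchinson A"
    proof
      fix x assume "x \<in> A"
      then have "x \<in> Q (Suc n)" for n by (auto simp: A_def)
      then have "\<exists>i. i \<in> letters \<and> x \<in> gasket_map i ` Q n" for n
        unfolding QS hutchinson_iff by blast
      then have "\<exists>c. \<forall>n. c n \<in> letters \<and> x \<in> gasket_map (c n) ` Q n" by (intro choice allI)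
      then obtain c where "\<forall>n. c n \<in> letters \<and> x \<in> gasket_map (c n) ` Q n" ..
      then have c: "c n \<in> letters" "x \<in> gasket_map (c n) ` Q n" for n by simp_all
      have "finite (range c)" by (rule finite_subset[of _ letters]) (use c(1) in blast, simp)
      from pigeonhole_infinite[OF infinite_UNIV_nat this] obtain n0 where "infinite {n. c n = c n0}" by auto
      define i where "i = c n0"
      have i: "infinite {n. c n = i}" by (simp add: i_def \<open>infinite {n. c n = c n0}\<close>)
      define y where "y = 2 * x - gasket_vertex i"
      have xy: "x = gasket_map i y" by (simp add: gasket_map_eq y_def)
      have "y \<in> Q n" for n
      proof -
        obtain m where m: "m \<ge> n" "c m = i" using i by (auto simp: infinite_nat_iff_unbounded_le)
        then obtain y' where "y' \<in> Q m" "x = gasket_map i y'" using c(2)[of m] by auto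
        then have "y \<in> Q m" using xy inj_gasket_map[of i] by (auto simp: inj_def)
        then show ?thesis using anti[OF m(1)] by blast
      qed
      then show "x \<in> hutchinson A" using xy c(1)[of n0]
        unfolding hutchinson_iff A_def i_def by blast
    qed
  qed
  ultimately show ?thesis by blast
qed

lemma gasket_props: "compact gasket" "gasket \<noteq> {}" "gasket = hutchinson gasket"
proof -
  have "\<exists>!A. compact A \<and> A \<noteq> {} \<and> A = hutchinson A"
  proof (rule ex_ex1I[OF attractor_exists])
    fix A B assume "compact A \<and> A \<noteq> {} \<and> A = hutchinson A" and "compact B \<and> B \<noteq> {} \<and> B = hutchinson B"
    then have A: "compact A" "A \<noteq> {}" "A = hutchinson A" and B: "compact B" "B \<noteq> {}" "B = hutchinson B"
      by blast+
    show "A = B"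
      using invariant_subset[OF A(1,3) compact_imp_closed[OF B(1)] B(2) equalityD1[OF B(3)[symmetric]]]
        invariant_subset[OF B(1,3) compact_imp_closed[OF A(1)] A(2) equalityD1[OF A(3)[symmetric]]]
      by (rule equalityI)
  qed
  from theI'[OF this] have "compact gasket \<and> gasket \<noteq> {} \<and> gasket = hutchinson gasket"
    unfolding gasket_def hutchinson_def .
  then show "compact gasket" "gasket \<noteq> {}" "gasket = hutchinson gasket" by blast+
qed

lemma gasket_cells: "gasket = (\<Union>w\<in>words n. cell w)"
  by (rule invariant_words[OF gasket_props(3)])

lemma word_map_gasket: "x \<in> gasket \<Longrightarrow> w \<in> words n \<Longrightarrow> gasket_word_map w x \<in> gasket"
  using gasket_cells[of n] by blast

text \<open>
  The vertex is the fixed point of one of the contractions, hence a limit of gasket points.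
\<close>

lemma vertex_in_gasket: "i \<in> letters \<Longrightarrow> gasket_vertex i \<in> gasket"
proof -
  assume i: "i \<in> letters"
  have "{gasket_vertex i} \<subseteq> gasket"
  proof -
    define w where "w n = replicate n i" for n
    obtain b where b: "b \<in> gasket" using gasket_props(2) by blast
    have fx: "corner (w n) i = gasket_vertex i" for n
      by (induction n) (auto simp: w_def gasket_map_eq)
    have "gasket_vertex i \<in> closure gasket" unfolding closure_approachable
    proof (intro allI impI)
      fix e :: real assume e: "0 < e"
      obtain n where n: "dist b (gasket_vertex i) < e * 2 ^ n"
        using real_arch_pow[of 2 "dist b (gasket_vertex i) / e"] e by (auto simp: field_simps)
      have "w n \<in> words n" using i by (auto simp: w_def words_def)
      then have "gasket_word_map (w n) b \<in> gasket" using b by (rule word_map_gasket[rotated])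
      moreover have "dist (gasket_word_map (w n) b) (gasket_vertex i) < e"
      proof -
        have "dist b (gasket_vertex i) / 2 ^ n < e" using n by (simp add: divide_less_eq)
        then show ?thesis using dist_gasket_word_map[of "w n" b "gasket_vertex i"] unfolding fx
          by (simp add: w_def)
      qed
      ultimately show "\<exists>y\<in>gasket. dist y (gasket_vertex i) < e" by blast
    qed
    moreover have "closure gasket = gasket" using compact_imp_closed[OF gasket_props(1)] by simp
    ultimately show ?thesis by simp
  qed
  then show ?thesis by simp
qed

section \<open>Affine coordinates and the position of cells\<close>

text \<open>
  The coordinates with respect to the real basis $p_2, p_3$ of the plane. In them the cells of level $n$
  are the triangles $2^{-n}(k + T)$ with integer corners $k$ and $T$ the unit triangle. Points $p_2$ and $p_3$ have the same height.
\<close>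

definition coord1 :: "complex \<Rightarrow> real" where "coord1 z = Re z - Im z / sqrt 3"
definition coord2 :: "complex \<Rightarrow> real" where "coord2 z = 2 * Im z / sqrt 3"
definition height :: "complex \<Rightarrow> real" where "height z = coord1 z + coord2 z"

lemma coord_vertex: "i \<in> letters \<Longrightarrow> coord1 (gasket_vertex i) = (if i = 2 then 1 else 0)"
  "i \<in> letters \<Longrightarrow> coord2 (gasket_vertex i) = (if i = 3 then 1 else 0)"
  by (auto simp: coord1_def coord2_def gasket_vertex_simps)

lemma coord_map:
  "coord1 (gasket_map i z) = (coord1 z + coord1 (gasket_vertex i)) / 2"
  "coord2 (gasket_map i z) = (coord2 z + coord2 (gasket_vertex i)) / 2"
  by (simp_all add: gasket_map_eq coord1_def coord2_def add_divide_distrib diff_divide_distrib)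

lemma height_map: "i \<in> letters \<Longrightarrow> height (gasket_map i z) = (height z + (if i = 1 then 0 else 1)) / 2"
  by (auto simp: height_def coord_map coord_vertex add_divide_distrib)

lemma height_vertex: "height (gasket_vertex 1) = 0" "height (gasket_vertex 2) = 1" "height (gasket_vertex 3) = 1"
  by (auto simp: height_def coord_vertex)

lemma continuous_height: "continuous_on A height"
  unfolding height_def coord1_def coord2_def by (intro continuous_intros) auto

lemma gasket_triangle:
  assumes "z \<in> gasket"
  shows "0 \<le> coord1 z" "0 \<le> coord2 z" "height z \<le> 1"
proof -
  define T where "T = {z. 0 \<le> coord1 z \<and> 0 \<le> coord2 z \<and> height z \<le> 1}"
  have T: "closed T" unfolding T_def height_def coord1_def coord2_def
    by (intro closed_Collect_conj closed_Collect_le continuous_intros) auto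
  have "0 \<in> T" by (auto simp: T_def height_def coord1_def coord2_def)
  then have T0: "T \<noteq> {}" by blast
  have hT: "hutchinson T \<subseteq> T"
    by (auto simp: hutchinson_def T_def coord_map height_map coord_vertex)
  have "gasket \<subseteq> T" by (rule invariant_subset[OF gasket_props(1,3) T T0 hT])
  then show "0 \<le> coord1 z" "0 \<le> coord2 z" "height z \<le> 1" using assms by (auto simp: T_def)
qed

text \<open>
  \<open>code j w\<close> reads $w$ as a binary number with digit one in the places where the letter is
  $j$; it gives the integer corner of the cell of $w$.
\<close>

fun code :: "nat \<Rightarrow> nat list \<Rightarrow> nat" where
  "code j [] = 0"
| "code j (i # w) = (if i = j then 2 ^ length w else 0) + code j w"

lemma coord_word_map: "w \<in> words n \<Longrightarrow> coord1 (gasket_word_map w z) = (real (code 2 w) + coord1 z) / 2 ^ n"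
  "w \<in> words n \<Longrightarrow> coord2 (gasket_word_map w z) = (real (code 3 w) + coord2 z) / 2 ^ n"
proof -
  have "coord1 (gasket_word_map w z) = (real (code 2 w) + coord1 z) / 2 ^ length w \<and>
     coord2 (gasket_word_map w z) = (real (code 3 w) + coord2 z) / 2 ^ length w"
    if "set w \<subseteq> letters" using that
    by (induction w) (auto simp: coord_map coord_vertex add_divide_distrib)
  then show "w \<in> words n \<Longrightarrow> coord1 (gasket_word_map w z) = (real (code 2 w) + coord1 z) / 2 ^ n"
    "w \<in> words n \<Longrightarrow> coord2 (gasket_word_map w z) = (real (code 3 w) + coord2 z) / 2 ^ n"
    by (auto simp: words_def)
qed

lemma code_less: "code j w < 2 ^ length w"
  by (induction w) auto

lemma code_inj:
  assumes "v \<in> words n" "w \<in> words n" "code 2 v = code 2 w" "code 3 v = code 3 w"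
  shows "v = w"
  using assms
proof (induction n arbitrary: v w)
  case (Suc n)
  obtain i v' where v: "v = i # v'" "i \<in> letters" "v' \<in> words n" using Suc.prems(1) by (auto simp: words_Suc)
  obtain j w' where w: "w = j # w'" "j \<in> letters" "w' \<in> words n" using Suc.prems(2) by (auto simp: words_Suc)
  have l: "length v' = n" "length w' = n" using v w by (auto simp: words_def)
  have lt: "code k v' < 2 ^ n" "code k w' < 2 ^ n" for k using code_less[of k v'] code_less[of k w'] l by auto
  have "i = 2 \<longleftrightarrow> j = 2" and 2: "code 2 v' = code 2 w'"
    using Suc.prems(3) lt[of 2] by (auto simp: v w l split: if_splits)
  moreover have "i = 3 \<longleftrightarrow> j = 3" and 3: "code 3 v' = code 3 w'"
    using Suc.prems(4) lt[of 3] by (auto simp: v w l split: if_splits)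
  ultimately have "i = j" using v w by auto
  then show ?case using Suc.IH[OF v(3) w(3) 2 3] v w by simp
qed simp

text \<open>
  Two different lattice triangles meet only in a common corner, and a corner has height
  $0$ or $1$ as seen from its cell.
\<close>

lemma cells_meet_height:
  assumes w: "v \<in> words n" "w \<in> words n" "v \<noteq> w" and yz: "y \<in> gasket" "z \<in> gasket"
    and eq: "gasket_word_map v y = gasket_word_map w z"
  shows "height y = 0 \<or> height y = 1"
proof -
  define i where "i = int (code 2 w) - int (code 2 v)"
  define j where "j = int (code 3 w) - int (code 3 v)"
  have "real (code 2 v) + coord1 y = real (code 2 w) + coord1 z"
       "real (code 3 v) + coord2 y = real (code 3 w) + coord2 z"
    using coord_word_map[OF w(1), of y] coord_word_map[OF w(2), of z] eq by auto
  then have ij: "coord1 y = coord1 z + i" "coord2 y = coord2 z + j" by (auto simp: i_def j_def)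
  have nz: "i \<noteq> 0 \<or> j \<noteq> 0" using code_inj[OF w(1,2)] w(3) by (auto simp: i_def j_def)
  note y = gasket_triangle[OF yz(1), unfolded height_def] and z = gasket_triangle[OF yz(2), unfolded height_def]
  have "real_of_int i < 2" "real_of_int i > -2" "real_of_int j < 2" "real_of_int j > -2"
    using y z ij by linarith+
  then have "i \<in> {-1, 0, 1}" "j \<in> {-1, 0, 1}" by auto
  then show ?thesis using nz ij y z unfolding height_def by auto
qed

lemma dist_gasket: assumes "x \<in> gasket" "y \<in> gasket" shows "dist x y \<le> 2"
proof -
  have "gasket \<subseteq> cball 0 1"
    by (rule invariant_subset[OF gasket_props(1,3) closed_cball _ hutchinson_unit_ball]) auto
  then have "norm x \<le> 1" "norm y \<le> 1" using assms by auto
  then show ?thesis using norm_triangle_ineq4[of x y] by (simp add: dist_norm)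
qed

lemma cell_closed: "compact (cell w)"
  by (intro compact_continuous_image continuous_gasket_word_map gasket_props(1))

section \<open>The Hausdorff measure of the gasket and its cells\<close>

abbreviation hdim :: real where "hdim \<equiv> ln 3 / ln 2"

lemma two_powr_hdim: "2 powr hdim = 3"
  by (simp add: powr_def)

text \<open>
  The dimension is chosen so that halving lengths divides the measure by three.
\<close>

lemma half_powr_hdim: "(d / 2 ^ n) powr hdim = d powr hdim / 3 ^ n" if "0 \<le> d"
proof -
  have "(2 ^ n :: real) powr hdim = 3 ^ n"
  proof -
    have "(2 ^ n :: real) powr hdim = (2 powr real n) powr hdim" by (simp add: powr_realpow)
    also have "\<dots> = (2 powr hdim) powr real n" by (simp only: powr_powr mult.commute)
    also have "\<dots> = 3 ^ n" by (simp only: two_powr_hdim powr_realpow zero_less_numeral)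
    finally show ?thesis .
  qed
  then show ?thesis using that by (simp add: powr_divide)
qed

lemma diameter_map_half:
  fixes f :: "complex \<Rightarrow> complex"
  assumes "bounded U" "\<And>x y. dist (f x) (f y) = dist x y / (c::real)" "c > 0"
  shows "diameter (f ` U) \<le> diameter U / c" "bounded (f ` U)"
proof -
  show "diameter (f ` U) \<le> diameter U / c"
  proof (cases "U = {}")
    case False
    show ?thesis
    proof (rule diameter_le)
      fix x y assume "x \<in> f ` U" "y \<in> f ` U"
      then obtain a b where ab: "a \<in> U" "b \<in> U" "x = f a" "y = f b" by blast
      then have "dist a b \<le> diameter U" using assms(1) by (simp add: diameter_bounded_bound)
      then have "dist x y \<le> diameter U / c" using ab assms by (simp add: divide_right_mono)
      then show "norm (x - y) \<le> diameter U / c" by (simp add: dist_norm)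
    qed (use False in simp)
  qed (simp add: diameter_def)
  obtain z e where "\<forall>y\<in>U. dist z y \<le> e" using assms(1) by (auto simp: bounded_def)
  then have "\<forall>y\<in>f ` U. dist (f z) y \<le> e / c" using assms by (auto simp: divide_right_mono)
  then show "bounded (f ` U)" unfolding bounded_def by blast
qed

lemma hausdorff_outer_map:
  "3 * hausdorff_outer_measure hdim (gasket_map i ` A) \<le> hausdorff_outer_measure hdim A"
proof -
  have "3 * hausdorff_premeasure hdim d (gasket_map i ` A) \<le> hausdorff_premeasure hdim d A" if d: "0 < d" for d
    unfolding hausdorff_premeasure_def[of hdim d A]
  proof (rule INF_greatest)
    fix U :: "nat \<Rightarrow> complex set"
    assume "U \<in> {U. A \<subseteq> (\<Union>i. U i) \<and> (\<forall>i. bounded (U i) \<and> diameter (U i) \<le> d)}"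
    then have U: "A \<subseteq> (\<Union>i. U i)" "\<And>i. bounded (U i)" "\<And>i. diameter (U i) \<le> d" by auto
    have half: "bounded (gasket_map i ` U j)" "diameter (gasket_map i ` U j) \<le> diameter (U j) / 2" for j
      using diameter_map_half[OF U(2)[of j], of "gasket_map i" 2] dist_gasket_map by simp_all
    have "hausdorff_premeasure hdim d (gasket_map i ` A)
        \<le> (\<Sum>j. ennreal (diameter (gasket_map i ` U j) powr hdim))"
    proof (rule hausdorff_premeasure_le)
      show "gasket_map i ` A \<subseteq> (\<Union>j. gasket_map i ` U j)" using U(1) by blast
      show "bounded (gasket_map i ` U j)" for j by (rule half)
      show "diameter (gasket_map i ` U j) \<le> d" for j
        using half(2)[of j] U(3)[of j] diameter_ge_0[OF U(2)[of j]] by linarith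
    qed
    also have "\<dots> \<le> (\<Sum>j. ennreal (1 / 3) * ennreal (diameter (U j) powr hdim))"
    proof (intro suminf_le summableI)
      fix j
      have "diameter (gasket_map i ` U j) powr hdim \<le> (diameter (U j) / 2 ^ 1) powr hdim"
        using half[of j] by (intro powr_mono2) (auto intro: diameter_ge_0)
      also have "\<dots> = diameter (U j) powr hdim / 3" using diameter_ge_0[OF U(2)[of j]] by (subst half_powr_hdim) auto
      finally show "ennreal (diameter (gasket_map i ` U j) powr hdim) \<le> ennreal (1 / 3) * ennreal (diameter (U j) powr hdim)"
        by (subst ennreal_mult[symmetric]) (auto intro!: ennreal_leI)
    qed
    also have "\<dots> = ennreal (1 / 3) * (\<Sum>j. ennreal (diameter (U j) powr hdim))" by simp
    finally have "3 * hausdorff_premeasure hdim d (gasket_map i ` A)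
       \<le> 3 * (ennreal (1 / 3) * (\<Sum>j. ennreal (diameter (U j) powr hdim)))" by (intro mult_left_mono) auto
    also have "\<dots> = (\<Sum>j. ennreal (diameter (U j) powr hdim))"
    proof -
      have "3 * ennreal (1 / 3) = 1" using ennreal_mult[of 3 "1 / 3"] by simp
      then show ?thesis by (simp only: mult.assoc[symmetric]) simp
    qed
    finally show "3 * hausdorff_premeasure hdim d (gasket_map i ` A) \<le> (\<Sum>j. ennreal (diameter (U j) powr hdim))" .
  qed
  then have "(SUP d\<in>{0<..}. 3 * hausdorff_premeasure hdim d (gasket_map i ` A)) \<le> hausdorff_outer_measure hdim A"
    unfolding hausdorff_outer_measure_def by (intro SUP_mono) auto
  then show ?thesis unfolding hausdorff_outer_measure_def by (simp add: SUP_mult_left_ennreal)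
qed

lemma hausdorff_outer_word_map:
  "3 ^ length w * hausdorff_outer_measure hdim (gasket_word_map w ` A) \<le> hausdorff_outer_measure hdim A"
proof (induction w)
  case (Cons i w)
  have "3 ^ length (i # w) * hausdorff_outer_measure hdim (gasket_word_map (i # w) ` A)
     = 3 ^ length w * (3 * hausdorff_outer_measure hdim (gasket_map i ` (gasket_word_map w ` A)))"
    by (simp add: image_comp ac_simps)
  also have "\<dots> \<le> 3 ^ length w * hausdorff_outer_measure hdim (gasket_word_map w ` A)"
    by (intro mult_left_mono hausdorff_outer_map) auto
  finally show ?case using Cons by (rule order_trans)
qed simp

lemma diameter_cell: "w \<in> words n \<Longrightarrow> diameter (cell w) \<le> 2 / 2 ^ n"
proof -
  assume w: "w \<in> words n"
  have b: "bounded gasket" by (rule compact_imp_bounded[OF gasket_props(1)])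
  have "diameter gasket \<le> 2"
    by (rule diameter_le) (use dist_gasket in \<open>auto simp: dist_norm\<close>)
  moreover have "diameter (cell w) \<le> diameter gasket / 2 ^ n"
    using diameter_map_half(1)[OF b, of "gasket_word_map w" "2 ^ n"] dist_gasket_word_map length_words[OF w]
    by auto
  ultimately show ?thesis by (meson divide_right_mono order_trans zero_le_numeral zero_le_power)
qed

lemma bounded_cell: "bounded (cell w)"
  by (rule compact_imp_bounded[OF cell_closed])

text \<open>
  Cover by the $3^n$ cells of level $n$.
\<close>

lemma hausdorff_gasket_finite: "hausdorff_outer_measure hdim gasket \<le> 3"
  unfolding hausdorff_outer_measure_def
proof (rule SUP_least)
  fix d :: real assume "d \<in> {0<..}"
  then have d: "d > 0" by simp
  obtain n where n: "2 / d < 2 ^ n" using real_arch_pow[of 2 "2 / d"] by auto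
  have n': "2 / 2 ^ n \<le> d" using n d by (simp add: field_simps)
  obtain g where g: "bij_betw g {0..<card (words n)} (words n)"
    using ex_bij_betw_nat_finite[OF finite_words] by blast
  define U where "U i = (if i < card (words n) then cell (g i) else {})" for i
  have gi: "g i \<in> words n" if "i < card (words n)" for i using g that by (auto simp: bij_betw_def)
  have dU: "diameter (U i) \<le> 2 / 2 ^ n" for i using diameter_cell[OF gi] by (auto simp: U_def)
  have bU: "bounded (U i)" for i by (auto simp: U_def bounded_cell)
  have "hausdorff_premeasure hdim d gasket \<le> (\<Sum>i. ennreal (diameter (U i) powr hdim))"
  proof (rule hausdorff_premeasure_le)
    show "gasket \<subseteq> (\<Union>i. U i)"
    proof
      fix x assume "x \<in> gasket"
      then obtain w where w: "w \<in> words n" "x \<in> cell w" using gasket_cells[of n] by blast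
      then obtain i where "i < card (words n)" "g i = w" using g by (metis bij_betw_iff_bijections atLeastLessThan_iff)
      then have "x \<in> U i" using w by (simp add: U_def)
      then show "x \<in> (\<Union>i. U i)" by blast
    qed
    show "diameter (U i) \<le> d" for i using dU[of i] n' by linarith
  qed (rule bU)
  also have "\<dots> = (\<Sum>i<card (words n). ennreal (diameter (U i) powr hdim))"
    by (rule suminf_finite) (auto simp: U_def)
  also have "\<dots> \<le> (\<Sum>i<card (words n). ennreal (3 / 3 ^ n))"
  proof (intro sum_mono ennreal_leI)
    fix i
    have "diameter (U i) powr hdim \<le> (2 / 2 ^ n) powr hdim" using dU[of i] diameter_ge_0[OF bU]
      by (intro powr_mono2) auto
    also have "\<dots> = 3 / 3 ^ n" by (simp add: half_powr_hdim two_powr_hdim)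
    finally show "diameter (U i) powr hdim \<le> 3 / 3 ^ n" .
  qed
  also have "\<dots> = ennreal (3 ^ n * (3 / 3 ^ n))"
    by (simp only: sum_constant card_lessThan card_words ennreal_of_nat_eq_real_of_nat)
      (subst ennreal_mult[symmetric], auto)
  also have "3 ^ n * (3 / 3 ^ n) = (3 :: real)" by simp
  finally show "hausdorff_premeasure hdim d gasket \<le> 3" by simp
qed

text \<open>
  Translates distances into differences of lattice positions.
\<close>

lemma abs_coord_le: "\<bar>coord1 z\<bar> \<le> 2 * norm z" "\<bar>coord2 z\<bar> \<le> 2 * norm z"
proof -
  have s: "1 \<le> sqrt 3" by simp
  have i: "\<bar>Im z\<bar> / sqrt 3 \<le> \<bar>Im z\<bar> / 1" using s by (intro divide_left_mono) auto
  have "\<bar>coord1 z\<bar> \<le> \<bar>Re z\<bar> + \<bar>Im z\<bar> / sqrt 3" unfolding coord1_def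
    using abs_triangle_ineq4[of "Re z" "Im z / sqrt 3"] by simp
  then show "\<bar>coord1 z\<bar> \<le> 2 * norm z" using i abs_Re_le_cmod[of z] abs_Im_le_cmod[of z] by simp
  show "\<bar>coord2 z\<bar> \<le> 2 * norm z" unfolding coord2_def using i abs_Im_le_cmod[of z] by (simp add: abs_mult)
qed

definition cells_meeting :: "nat \<Rightarrow> complex set \<Rightarrow> nat list set" where
  "cells_meeting n U = {w \<in> words n. cell w \<inter> U \<noteq> {}}"

lemma finite_cells_meeting [simp]: "finite (cells_meeting n U)"
  by (simp add: cells_meeting_def)

text \<open>
  The corners of the cells met by a set of diameter at most $2^{-n}$ lie in a lattice square of side
  seven, and different cells have different corners.
\<close>

lemma card_cells_meeting:
  assumes U: "\<And>x y. x \<in> U \<Longrightarrow> y \<in> U \<Longrightarrow> dist x y \<le> 1 / 2 ^ n"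
  shows "card (cells_meeting n U) \<le> 49"
proof (cases "cells_meeting n U = {}")
  case False
  then obtain w0 where w0: "w0 \<in> cells_meeting n U" by blast
  define f where "f w = (int (code 2 w) - int (code 2 w0), int (code 3 w) - int (code 3 w0))" for w
  have box: "f w \<in> {-3..3} \<times> {-3..3}" if w: "w \<in> cells_meeting n U" for w
  proof -
    from w obtain y where y: "w \<in> words n" "y \<in> gasket" "gasket_word_map w y \<in> U"
      by (auto simp: cells_meeting_def)
    from w0 obtain z where z: "w0 \<in> words n" "z \<in> gasket" "gasket_word_map w0 z \<in> U"
      by (auto simp: cells_meeting_def)
    define d where "d = gasket_word_map w y - gasket_word_map w0 z"
    have "norm d \<le> 1 / 2 ^ n" using U[OF y(3) z(3)] by (simp add: d_def dist_norm)
    then have "\<bar>coord1 d\<bar> \<le> 2 / 2 ^ n" "\<bar>coord2 d\<bar> \<le> 2 / 2 ^ n" using abs_coord_le[of d] by auto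
    moreover have "coord1 d = (real (code 2 w) + coord1 y - real (code 2 w0) - coord1 z) / 2 ^ n"
    proof -
      have "coord1 d = coord1 (gasket_word_map w y) - coord1 (gasket_word_map w0 z)"
        by (simp add: d_def coord1_def diff_divide_distrib)
      then show ?thesis unfolding coord_word_map(1)[OF y(1)] coord_word_map(1)[OF z(1)]
        by (simp add: diff_divide_distrib add_divide_distrib)
    qed
    moreover have "coord2 d = (real (code 3 w) + coord2 y - real (code 3 w0) - coord2 z) / 2 ^ n"
    proof -
      have "coord2 d = coord2 (gasket_word_map w y) - coord2 (gasket_word_map w0 z)"
        by (simp add: d_def coord2_def diff_divide_distrib right_diff_distrib)
      then show ?thesis unfolding coord_word_map(2)[OF y(1)] coord_word_map(2)[OF z(1)]
        by (simp add: diff_divide_distrib add_divide_distrib)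
    qed
    ultimately have "\<bar>real (code 2 w) + coord1 y - real (code 2 w0) - coord1 z\<bar> \<le> 2"
      "\<bar>real (code 3 w) + coord2 y - real (code 3 w0) - coord2 z\<bar> \<le> 2"
      by (simp_all add: divide_le_cancel)
    moreover note gasket_triangle[OF y(2), unfolded height_def] gasket_triangle[OF z(2), unfolded height_def]
    ultimately have "real (code 2 w) - real (code 2 w0) \<le> 3" "real (code 2 w) - real (code 2 w0) \<ge> -3"
      "real (code 3 w) - real (code 3 w0) \<le> 3" "real (code 3 w) - real (code 3 w0) \<ge> -3"
      unfolding abs_le_iff by linarith+
    then show ?thesis by (simp add: f_def)
  qed
  have "inj_on f (cells_meeting n U)"
    using code_inj by (auto simp: inj_on_def f_def cells_meeting_def)
  then have "card (cells_meeting n U) \<le> card ({-3..3 :: int} \<times> {-3..3 :: int})"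
    by (rule card_inj_on_le) (use box in \<open>blast, simp\<close>)
  also have "\<dots> = 49" by simp
  finally show ?thesis .
qed simp

lemma words_appendE:
  assumes "w \<in> words (m + n)"
  obtains u v where "w = u @ v" "u \<in> words m" "v \<in> words n"
proof
  show "w = take m w @ drop m w" by simp
  show "take m w \<in> words m" "drop m w \<in> words n"
    using assms by (auto simp: words_def dest: in_set_takeD in_set_dropD)
qed

lemma card_cells_meeting_fine:
  assumes U: "\<And>x y. x \<in> U \<Longrightarrow> y \<in> U \<Longrightarrow> dist x y \<le> 1 / 2 ^ k" and kn: "k \<le> n"
  shows "card (cells_meeting n U) \<le> 49 * 3 ^ (n - k)"
proof -
  have "cells_meeting n U \<subseteq> (\<lambda>(v, w). v @ w) ` (cells_meeting k U \<times> words (n - k))"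
  proof
    fix w assume "w \<in> cells_meeting n U"
    then obtain y where y: "w \<in> words (k + (n - k))" "y \<in> gasket" "gasket_word_map w y \<in> U"
      using kn by (auto simp: cells_meeting_def)
    then obtain v u where vu: "v \<in> words k" "u \<in> words (n - k)" "w = v @ u" by (elim words_appendE)
    have "gasket_word_map v (gasket_word_map u y) \<in> U" using y vu by (simp add: gasket_word_map_append)
    then have "v \<in> cells_meeting k U"
      using vu(1) word_map_gasket[OF y(2) vu(2)] by (auto simp: cells_meeting_def)
    then show "w \<in> (\<lambda>(v, w). v @ w) ` (cells_meeting k U \<times> words (n - k))" using vu by force
  qed
  then have "card (cells_meeting n U) \<le> card (cells_meeting k U \<times> words (n - k))"
    by (intro surj_card_le) auto
  also have "\<dots> \<le> 49 * 3 ^ (n - k)"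
    using card_cells_meeting[OF U] by (simp add: card_cartesian_product card_words)
  finally show ?thesis .
qed

lemma dyadic_scale:
  assumes "0 < m" "m < (1::real)"
  obtains k where "m < 1 / 2 ^ k" "1 / 2 ^ Suc k \<le> m"
proof -
  have "(1 / 2 :: real) < 1" by simp
  from real_arch_pow_inv[OF assms(1) this] obtain n where n: "(1 / 2) ^ n < m" ..
  define l where "l = (LEAST n. (1 / 2) ^ n \<le> m)"
  have l: "(1 / 2) ^ l \<le> m" unfolding l_def
    using LeastI[of "\<lambda>n. (1 / 2) ^ n \<le> m" n] n by simp
  have l0: "l \<noteq> 0" using l assms by (cases l) auto
  have "\<not> (1 / 2) ^ (l - 1) \<le> m"
    using not_less_Least[of "l - 1" "\<lambda>n. (1 / 2) ^ n \<le> m"] l0 unfolding l_def by simp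
  then show ?thesis using l l0 by (intro that[of "l - 1"]) (auto simp: power_divide)
qed

text \<open>
  By compactness a finite subfamily of slightly enlarged covering sets suffices. A set on the scale
  $2^{-k}$ meets at most $49 \cdot 3^{N-k}$ of the $3^N$ cells of a fine level $N$; all cells are met,
  which bounds the sum of the $3^{-k}$ from below.
\<close>

lemma hausdorff_gasket_positive: "hausdorff_outer_measure hdim gasket \<ge> ennreal (1 / 147)"
proof -
  have "ennreal (1 / 147) \<le> hausdorff_premeasure hdim (1 / 2) gasket"
    unfolding hausdorff_premeasure_def
  proof (rule INF_greatest)
    fix U :: "nat \<Rightarrow> complex set"
    assume "U \<in> {U. gasket \<subseteq> (\<Union>i. U i) \<and> (\<forall>i. bounded (U i) \<and> diameter (U i) \<le> 1 / 2)}"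
    then have U: "gasket \<subseteq> (\<Union>i. U i)" "\<And>i. bounded (U i)" "\<And>i. diameter (U i) \<le> 1 / 2" by auto
    show "ennreal (1 / 147) \<le> (\<Sum>i. ennreal (diameter (U i) powr hdim))"
    proof (rule ennreal_le_epsilon)
      fix e :: real assume e: "0 < e"
      define h where "h i = e * (1 / 2) ^ Suc i" for i
      have h: "h i > 0" for i using e by (simp add: h_def)
      have "\<exists>k. diameter (U i) < 1 / 2 ^ k \<and> (1 / 3) ^ Suc k \<le> diameter (U i) powr hdim + h i" for i
      proof -
        define t where "t = min (1 / 2) (h i powr (1 / hdim))"
        have t: "0 < t" "t \<le> 1 / 2" using h[of i] by (auto simp: t_def)
        have "t powr hdim \<le> (h i powr (1 / hdim)) powr hdim" using t by (intro powr_mono2) (auto simp: t_def)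
        also have "\<dots> = h i" using h[of i] by (simp add: powr_powr)
        finally have th: "t powr hdim \<le> h i" .
        \<comment> \<open>The cutoff $t$ treats covering sets of diameter zero, at a cost of at most \<open>h i\<close>.\<close>
      define m where "m = max (diameter (U i)) t"
        have m: "0 < m" "m < 1" using t U(3)[of i] by (auto simp: m_def)
        obtain k where k: "m < 1 / 2 ^ k" "1 / 2 ^ Suc k \<le> m" using dyadic_scale[OF m] .
        have "(1 / 3) ^ Suc k = (1 / 2 ^ Suc k) powr hdim"
          by (subst half_powr_hdim) (auto simp: power_divide)
        also have "\<dots> \<le> m powr hdim" using k by (intro powr_mono2) auto
        also have "\<dots> \<le> diameter (U i) powr hdim + h i"
          using th h[of i] by (auto simp: m_def max_def intro: add_increasing)
        finally show ?thesis using k by (intro exI[of _ k]) (auto simp: m_def)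
      qed
      then obtain k where k: "\<And>i. diameter (U i) < 1 / 2 ^ k i"
        "\<And>i. (1 / 3) ^ Suc (k i) \<le> diameter (U i) powr hdim + h i" by metis
      \<comment> \<open>The strict inequality for the diameter leaves room to pass to open neighbourhoods.\<close>
      define r where "r i = (1 / 2 ^ k i - diameter (U i)) / 2" for i
      have r: "r i > 0" for i using k(1)[of i] by (simp add: r_def)
      define V where "V i = (\<Union>x\<in>U i. ball x (r i))" for i
      have V: "dist x y \<le> 1 / 2 ^ k i" if xy: "x \<in> V i" "y \<in> V i" for x y i
      proof -
        obtain x' y' where *: "x' \<in> U i" "dist x' x < r i" "y' \<in> U i" "dist y' y < r i"
          using xy by (auto simp: V_def)
        have "dist x y \<le> dist x' x + dist x' y' + dist y' y"
          using dist_triangle[of x y x'] dist_triangle[of x' y y'] dist_commute[of x x'] by linarith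
        also have "\<dots> \<le> r i + diameter (U i) + r i"
          using * diameter_bounded_bound[OF U(2) *(1,3)] by linarith
        finally show ?thesis by (simp add: r_def)
      qed
      have "gasket \<subseteq> (\<Union>i. V i)"
      proof
        fix x assume "x \<in> gasket"
        then obtain i where "x \<in> U i" using U(1) by blast
        then have "x \<in> V i" using r[of i] by (auto simp: V_def intro!: bexI[of _ x])
        then show "x \<in> (\<Union>i. V i)" by blast
      qed
      moreover have "open (V i)" for i by (auto simp: V_def)
      ultimately obtain I where I: "finite I" "gasket \<subseteq> (\<Union>i\<in>I. V i)"
        using compactE_image[OF gasket_props(1), of UNIV V] by metis
      define N where "N = Max (insert 0 (k ` I))"
      have N: "k i \<le> N" if "i \<in> I" for i using I that by (auto simp: N_def)
      have "words N \<subseteq> (\<Union>i\<in>I. cells_meeting N (V i))"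
      proof
        fix w assume w: "w \<in> words N"
        obtain x where x: "x \<in> gasket" using gasket_props(2) by blast
        have "gasket_word_map w x \<in> gasket" using x w by (rule word_map_gasket)
        then obtain i where "i \<in> I" "gasket_word_map w x \<in> V i" using I by blast
        then show "w \<in> (\<Union>i\<in>I. cells_meeting N (V i))" using w x by (auto simp: cells_meeting_def)
      qed
      then have "card (words N) \<le> card (\<Union>i\<in>I. cells_meeting N (V i))"
        using I by (intro card_mono) auto
      also have "\<dots> \<le> (\<Sum>i\<in>I. card (cells_meeting N (V i)))" by (rule card_UN_le[OF I(1)])
      also have "\<dots> \<le> (\<Sum>i\<in>I. 49 * 3 ^ (N - k i))" by (intro sum_mono card_cells_meeting_fine V N)
      finally have "real (3 ^ N) \<le> real (\<Sum>i\<in>I. 49 * 3 ^ (N - k i))" by (simp only: card_words of_nat_le_iff)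
      also have "\<dots> = (\<Sum>i\<in>I. 147 * 3 ^ N * (1 / 3) ^ Suc (k i))"
      proof -
        have "real (49 * 3 ^ (N - k i)) = 147 * 3 ^ N * (1 / 3) ^ Suc (k i)" if "i \<in> I" for i
        proof -
          have "real (49 * 3 ^ (N - k i)) = 49 * 3 ^ (N - k i)" by (simp only: of_nat_mult of_nat_power of_nat_numeral)
          also have "(3 :: real) ^ (N - k i) = 3 ^ N / 3 ^ k i" by (rule power_diff) (use N[OF that] in auto)
          finally show ?thesis by (simp add: power_divide)
        qed
        then show ?thesis unfolding of_nat_sum by (intro sum.cong refl)
      qed
      also have "\<dots> = 3 ^ N * (147 * (\<Sum>i\<in>I. (1 / 3) ^ Suc (k i)))"
        by (simp add: sum_distrib_left mult.assoc mult.left_commute)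
      finally have "3 ^ N * 1 \<le> (3 :: real) ^ N * (147 * (\<Sum>i\<in>I. (1 / 3) ^ Suc (k i)))" by simp
      then have "1 \<le> 147 * (\<Sum>i\<in>I. (1 / 3 :: real) ^ Suc (k i))" by (simp only: mult_le_cancel_left) simp
      then have "1 / 147 \<le> (\<Sum>i\<in>I. (1 / 3 :: real) ^ Suc (k i))" by linarith
      also have "\<dots> \<le> (\<Sum>i\<in>I. diameter (U i) powr hdim + h i)" by (intro sum_mono k(2))
      finally have "ennreal (1 / 147) \<le> ennreal (\<Sum>i\<in>I. diameter (U i) powr hdim + h i)" by (rule ennreal_leI)
      also have "\<dots> = (\<Sum>i\<in>I. ennreal (diameter (U i) powr hdim + h i))"
        using h by (intro sum_ennreal[symmetric]) (simp add: less_imp_le)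
      also have "\<dots> \<le> (\<Sum>i. ennreal (diameter (U i) powr hdim + h i))" by (intro sum_le_suminf summableI I) auto
      also have "\<dots> = (\<Sum>i. ennreal (diameter (U i) powr hdim)) + (\<Sum>i. ennreal (h i))"
      proof -
        have "ennreal (diameter (U i) powr hdim + h i) = ennreal (diameter (U i) powr hdim) + ennreal (h i)" for i
          by (rule ennreal_plus) (use h[of i] in auto)
        then show ?thesis by (simp only: suminf_add[OF summableI summableI])
      qed
      also have "(\<Sum>i. ennreal (h i)) = ennreal e"
      proof -
        have "(\<lambda>i. e * (1 / 2) ^ Suc i) sums (e * 1)" by (intro sums_mult power_half_series)
        then show ?thesis unfolding h_def using e by (intro suminf_ennreal_eq) auto
      qed
      finally show "ennreal (1 / 147) \<le> (\<Sum>i. ennreal (diameter (U i) powr hdim)) + ennreal e" .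
    qed
  qed
  also have "\<dots> \<le> hausdorff_outer_measure hdim gasket"
    unfolding hausdorff_outer_measure_def by (intro SUP_upper) auto
  finally show ?thesis .
qed

lemma gasket_borel [measurable]: "gasket \<in> sets borel"
  using gasket_props(1) by (simp add: borel_closed compact_imp_closed)

lemma cell_borel [measurable]: "cell w \<in> sets borel"
  using cell_closed by (simp add: borel_closed compact_imp_closed)

lemma sets_gasket_measure [measurable_cong, simp]: "sets gasket_measure = sets borel"
  by (simp add: gasket_measure_def sets_hausdorff_measure)

lemma space_gasket_measure [simp]: "space gasket_measure = UNIV"
  by (simp add: gasket_measure_def space_hausdorff_measure)

text \<open>
  Each of the $3^n$ cells has at most the share $3^{-n}$ of the measure, by scaling, and together they
  cover the gasket; so every share is attained.
\<close>

lemma emeasure_cell: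
  assumes w: "w \<in> words n"
  shows "emeasure gasket_measure (cell w) = ennreal (1 / 3 ^ n)"
proof -
  define H where "H = hausdorff_outer_measure hdim gasket"
  have fin: "H < top" using hausdorff_gasket_finite by (simp add: H_def order_le_less_trans)
  have pos: "H > 0" using hausdorff_gasket_positive unfolding H_def
    by (rule less_le_trans[rotated]) simp
  define h where "h = enn2real H"
  have h: "H = ennreal h" "h > 0" using fin pos by (auto simp: h_def enn2real_positive_iff)
  define m where "m v = hausdorff_outer_measure hdim (cell v)" for v
  have upper: "m v \<le> ennreal (h / 3 ^ n)" if "v \<in> words n" for v
  proof -
    have "3 ^ n * m v \<le> ennreal h" using hausdorff_outer_word_map[of v gasket] that length_words
      by (simp add: m_def H_def[symmetric] h(1)[symmetric])
    then have "ennreal (1 / 3 ^ n) * (3 ^ n * m v) \<le> ennreal (1 / 3 ^ n) * ennreal h" by (intro mult_left_mono) auto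
    moreover have "ennreal (1 / 3 ^ n) * (3 ^ n) = 1"
    proof -
      have "(3 :: ennreal) ^ n = ennreal (3 ^ n)" by (metis ennreal_numeral ennreal_power zero_le_numeral)
      then show ?thesis by (simp add: ennreal_mult[symmetric])
    qed
    ultimately show ?thesis using h(2) by (simp add: mult.assoc[symmetric] ennreal_mult[symmetric])
  qed
  have "m w \<ge> ennreal (h / 3 ^ n)"
  proof -
    have "H \<le> (\<Sum>v\<in>words n. m v)"
    proof -
      have "H = emeasure (hausdorff_measure hdim) (\<Union>v\<in>words n. cell v)"
        unfolding gasket_cells[of n, symmetric] H_def by (simp add: emeasure_hausdorff_measure)
      also have "\<dots> \<le> (\<Sum>v\<in>words n. emeasure (hausdorff_measure hdim) (cell v))"
        by (intro emeasure_subadditive_finite) (auto simp: sets_hausdorff_measure)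
      also have "\<dots> = (\<Sum>v\<in>words n. m v)" by (simp add: m_def emeasure_hausdorff_measure)
      finally show ?thesis .
    qed
    also have "\<dots> = m w + (\<Sum>v\<in>words n - {w}. m v)" using w by (simp add: sum.remove)
    also have "\<dots> \<le> m w + (\<Sum>v\<in>words n - {w}. ennreal (h / 3 ^ n))"
      by (intro add_left_mono sum_mono upper) auto
    also have "(\<Sum>v\<in>words n - {w}. ennreal (h / 3 ^ n)) = ennreal (h - h / 3 ^ n)"
    proof -
      have "(\<Sum>v\<in>words n - {w}. ennreal (h / 3 ^ n)) = ennreal (\<Sum>v\<in>words n - {w}. h / 3 ^ n)"
        using h by (intro sum_ennreal) auto
      also have "(\<Sum>v\<in>words n - {w}. h / 3 ^ n) = (3 ^ n - 1) * (h / 3 ^ n)"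
        using w by (simp add: card_words of_nat_diff)
      also have "\<dots> = h - h / 3 ^ n" by (simp add: field_simps)
      finally show ?thesis .
    qed
    finally have *: "ennreal h \<le> m w + ennreal (h - h / 3 ^ n)" using h by simp
    have le: "h / 3 ^ n \<le> h" using h by (simp add: field_simps)
    have fw: "m w = ennreal (enn2real (m w))" using upper[OF w] by (metis ennreal_enn2real_if ennreal_neq_top neq_top_trans)
    have "ennreal h \<le> ennreal (enn2real (m w) + (h - h / 3 ^ n))"
      using * le by (subst ennreal_plus) (auto simp: fw[symmetric])
    moreover have "0 \<le> enn2real (m w) + (h - h / 3 ^ n)" using le by simp
    ultimately have "h \<le> enn2real (m w) + (h - h / 3 ^ n)" by (simp only: ennreal_le_iff)
    then have "h / 3 ^ n \<le> enn2real (m w)" by simp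
    then show ?thesis by (subst fw) (rule ennreal_leI)
  qed
  then have mw: "m w = ennreal (h / 3 ^ n)" using upper[OF w] by (rule antisym[rotated])
  have sub: "gasket \<inter> cell w = cell w"
    using word_map_gasket w by blast
  have "emeasure gasket_measure (cell w) = m w / H"
    unfolding gasket_measure_def
    by (subst emeasure_uniform_measure) (auto simp: sub sets_hausdorff_measure emeasure_hausdorff_measure m_def H_def)
  also have "\<dots> = ennreal (1 / 3 ^ n)" unfolding mw h(1) using h(2) by (subst divide_ennreal) auto
  finally show ?thesis .
qed

lemma measure_cell: "w \<in> words n \<Longrightarrow> measure gasket_measure (cell w) = 1 / 3 ^ n"
  by (simp add: measure_def emeasure_cell)

lemma finite_measure_gasket: "finite_measure gasket_measure"
proof
  define H where "H = hausdorff_outer_measure hdim gasket"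
  have fin: "H < top" using hausdorff_gasket_finite by (simp add: H_def order_le_less_trans)
  have pos: "H > 0" using hausdorff_gasket_positive unfolding H_def
    by (rule less_le_trans[rotated]) simp
  have "emeasure gasket_measure UNIV = emeasure gasket_measure (cell [])"
    unfolding gasket_measure_def
    by (subst (1 2) emeasure_uniform_measure) (auto simp: sets_hausdorff_measure)
  also have "\<dots> \<noteq> \<infinity>" by (subst emeasure_cell[of _ 0]) auto
  finally show "emeasure gasket_measure (space gasket_measure) \<noteq> \<infinity>" by simp
qed

section \<open>The renormalization sequence\<close>

text \<open>
  The resistances of the star that is equivalent to three copies of the star $(x,y,z)$ joined as
  in the first subdivision of the gasket.
\<close>

definition yjoin :: "real \<times> real \<times> real \<Rightarrow> real \<times> real \<times> real" where
  "yjoin = (\<lambda>(x, y, z). (x + phi x y z, y + phi y z x, z + phi z x y))"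

text \<open>
  The form $\phi = x/2 + yz/(2(x+y+z))$ makes differences of two components factor.
\<close>

lemma phi_eq:
  assumes "x + y + z \<noteq> 0"
  shows "phi x y z = x / 2 + y * z / (2 * (x + y + z))"
  using assms unfolding phi_def by (simp add: field_simps)

lemma yjoin_diff:
  assumes "0 < x" "0 < y" "0 < (z::real)"
  shows "(x + phi x y z) - (y + phi y z x) = (x - y) * (3 / 2 - z / (2 * (x + y + z)))"
proof -
  define s where "s = 2 * (x + y + z)"
  have n: "x + y + z \<noteq> 0" "y + z + x \<noteq> 0" "s \<noteq> 0" using assms by (auto simp: s_def)
  have "phi x y z = x / 2 + y * z / s" "phi y z x = y / 2 + z * x / s"
    using phi_eq[OF n(1)] phi_eq[OF n(2)] by (simp_all add: s_def ac_simps)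
  then show ?thesis unfolding s_def[symmetric]
    by (simp add: diff_divide_distrib algebra_simps)
qed

lemma yjoin_factor_pos:
  assumes "0 < x" "0 < y" "0 < (z::real)"
  shows "3 / 2 - z / (2 * (x + y + z)) > 0"
proof -
  have "z / (2 * (x + y + z)) < 3 / 2" using assms by (simp add: divide_less_eq)
  then show ?thesis by linarith
qed

text \<open>
  The difference of two components gets multiplied by a positive factor, so equal components come
  from equal components. This reduces uniqueness among all positive triples to the symmetric ones.
\<close>

lemma yjoin_symmetric_preimage:
  assumes pos: "0 < x" "0 < y" "0 < z" and eq: "yjoin (x, y, z) = (X, Y, Y)"
  shows "z = y"
proof -
  have "(y + phi y z x) - (z + phi z x y) = 0" using eq by (auto simp: yjoin_def)
  then have "(y - z) * (3 / 2 - x / (2 * (y + z + x))) = 0" using yjoin_diff[of y z x] pos by simp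
  then show ?thesis using yjoin_factor_pos[of y z x] pos by auto
qed

lemma yjoin_symmetric:
  assumes "0 < x" "0 < y"
  shows "yjoin (x, y, y) = (3 / 2 * x + y\<^sup>2 / (2 * (x + 2 * y)),
    3 / 2 * y + x * y / (2 * (x + 2 * y)), 3 / 2 * y + x * y / (2 * (x + 2 * y)))"
proof -
  have "x + y + y \<noteq> 0" "y + y + x \<noteq> 0" "y + x + y \<noteq> 0" using assms by auto
  moreover have "x + y + y = x + 2 * y" "y + y + x = x + 2 * y" "y + x + y = x + 2 * y" by auto
  ultimately show ?thesis unfolding yjoin_def by (simp add: phi_eq power2_eq_square mult.commute)
qed

text \<open>
  The positive root of $(6-T)t^2 + (4-6T)t - 3T = 0$.
\<close>

definition ratio_inv :: "real \<Rightarrow> real" where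
  "ratio_inv T = (- (2 - 3 * T) + sqrt ((2 - 3 * T)\<^sup>2 + (6 - T) * (3 * T))) / (6 - T)"

lemma ratio_quadratic_root:
  fixes T t :: real
  assumes T: "0 < T" "T < 6" and t: "0 < t"
  shows "(6 - T) * t\<^sup>2 + (4 - 6 * T) * t - 3 * T = 0 \<longleftrightarrow> t = ratio_inv T"
proof -
  define p where "p = 6 - T"
  define q where "q = 2 - 3 * T"
  define D where "D = q\<^sup>2 + p * (3 * T)"
  have p: "p > 0" and D0: "D > q\<^sup>2" using T by (auto simp: p_def D_def)
  then have D: "D \<ge> 0" by (meson less_eq_real_def order_less_le_trans zero_le_power2 not_le)
  have sq: "\<bar>q\<bar> < sqrt D" using D0 by (metis real_sqrt_abs real_sqrt_less_iff)
  have "(6 - T) * t\<^sup>2 + (4 - 6 * T) * t - 3 * T = 0 \<longleftrightarrow> p * (p * t\<^sup>2 + 2 * q * t - 3 * T) = 0"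
    using p by (auto simp: p_def q_def)
  also have "p * (p * t\<^sup>2 + 2 * q * t - 3 * T) = (p * t + q)\<^sup>2 - (sqrt D)\<^sup>2"
    using D by (simp add: D_def power2_eq_square algebra_simps)
  also have "\<dots> = 0 \<longleftrightarrow> (p * t + q = sqrt D \<or> p * t + q = - sqrt D)"
    by (simp add: power2_eq_iff)
  also have "\<dots> \<longleftrightarrow> p * t + q = sqrt D"
  proof -
    have "p * t > 0" using p t by simp
    then show ?thesis using sq by (auto simp: abs_if split: if_splits)
  qed
  also have "\<dots> \<longleftrightarrow> t = (- q + sqrt D) / p" using p by (auto simp: field_simps)
  finally show ?thesis by (simp add: ratio_inv_def p_def q_def D_def)
qed

lemma ratio_inv_pos: "0 < T \<Longrightarrow> T < 6 \<Longrightarrow> 0 < ratio_inv T"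
proof -
  assume T: "0 < T" "T < 6"
  then have "(2 - 3 * T)\<^sup>2 < (2 - 3 * T)\<^sup>2 + (6 - T) * (3 * T)" by simp
  then have "\<bar>2 - 3 * T\<bar> < sqrt ((2 - 3 * T)\<^sup>2 + (6 - T) * (3 * T))"
    by (metis real_sqrt_abs real_sqrt_less_iff)
  then show ?thesis using T unfolding ratio_inv_def by (intro divide_pos_pos) auto
qed

text \<open>
  With $t = y/x$ the ratio of the image is $(4t+6t^2)/(3+6t+t^2)$. Solving for $t$ is the
  quadratic above, and the scale is then determined linearly.
\<close>

lemma yjoin_symmetric_iff:
  assumes X: "0 < X" "0 < Y" "Y < 6 * X" and x: "0 < x" "0 < y"
  defines "t \<equiv> ratio_inv (Y / X)"
  shows "yjoin (x, y, y) = (X, Y, Y) \<longleftrightarrow>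
    (y = t * x \<and> x = X * (2 * (1 + 2 * t)) / (3 + 6 * t + t\<^sup>2))"
proof -
  define u where "u = y / x"
  have u: "u > 0" "y = u * x" using x by (auto simp: u_def)
  have T: "0 < Y / X" "Y / X < 6" using X by (auto simp: field_simps)
  have t: "t > 0" using ratio_inv_pos[OF T] by (simp add: t_def)
  have n: "x + 2 * (u * x) \<noteq> 0" "1 + 2 * u \<noteq> 0" "3 + 6 * u + u\<^sup>2 > 0" "3 + 6 * t + t\<^sup>2 > 0"
    using x u t by (auto intro!: add_pos_nonneg simp: add_pos_pos less_imp_neq[symmetric])
  have X1: "3 / 2 * x + y\<^sup>2 / (2 * (x + 2 * y)) = x * (3 + 6 * u + u\<^sup>2) / (2 * (1 + 2 * u))"
    using n x unfolding u(2) by (simp add: divide_simps) (simp add: algebra_simps power2_eq_square)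
  have Y1: "3 / 2 * y + x * y / (2 * (x + 2 * y)) = x * (4 * u + 6 * u\<^sup>2) / (2 * (1 + 2 * u))"
    using n x unfolding u(2) by (simp add: divide_simps) (simp add: algebra_simps power2_eq_square)
  have "yjoin (x, y, y) = (X, Y, Y) \<longleftrightarrow>
     x * (3 + 6 * u + u\<^sup>2) / (2 * (1 + 2 * u)) = X \<and> x * (4 * u + 6 * u\<^sup>2) / (2 * (1 + 2 * u)) = Y"
    using yjoin_symmetric[OF x] X1 Y1 by simp
  also have "\<dots> \<longleftrightarrow> x = X * (2 * (1 + 2 * u)) / (3 + 6 * u + u\<^sup>2) \<and>
       (4 * u + 6 * u\<^sup>2) / (3 + 6 * u + u\<^sup>2) = Y / X"
  proof -
    have *: "x * P / (2 * Q) = X \<and> x * R / (2 * Q) = Y \<longleftrightarrow> x = X * (2 * Q) / P \<and> R / P = Y / X"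
      if "P > 0" "Q > 0" for P Q R :: real
    proof -
      have "x * P / (2 * Q) = X \<longleftrightarrow> x = X * (2 * Q) / P" using that by (auto simp: field_simps)
      moreover have "x * R / (2 * Q) = Y \<longleftrightarrow> R / P = Y / X" if e: "x * P / (2 * Q) = X"
      proof -
        have "R / P = (x * R / (2 * Q)) / (x * P / (2 * Q))"
          using \<open>P > 0\<close> \<open>Q > 0\<close> x by simp
        then have "R / P = (x * R / (2 * Q)) / X" by (simp only: e)
        then have "R / P = Y / X \<longleftrightarrow> (x * R / (2 * Q)) / X = Y / X" by (simp only:)
        also have "\<dots> \<longleftrightarrow> x * R / (2 * Q) = Y" using X by (subst divide_cancel_right) auto
        finally show ?thesis by blast
      qed
      ultimately show ?thesis by blast
    qed
    show ?thesis using n u by (intro *) auto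
  qed
  also have "(4 * u + 6 * u\<^sup>2) / (3 + 6 * u + u\<^sup>2) = Y / X \<longleftrightarrow>
     (6 - Y / X) * u\<^sup>2 + (4 - 6 * (Y / X)) * u - 3 * (Y / X) = 0"
  proof -
    have "(4 * u + 6 * u\<^sup>2) / (3 + 6 * u + u\<^sup>2) = Y / X \<longleftrightarrow> 4 * u + 6 * u\<^sup>2 = Y / X * (3 + 6 * u + u\<^sup>2)"
      using n by (simp add: nonzero_divide_eq_eq less_imp_neq[symmetric])
    then show ?thesis by (auto simp: algebra_simps)
  qed
  also have "\<dots> \<longleftrightarrow> u = t" using ratio_quadratic_root[OF T u(1)] by (simp add: t_def)
  also have "x = X * (2 * (1 + 2 * u)) / (3 + 6 * u + u\<^sup>2) \<and> u = t
      \<longleftrightarrow> u = t \<and> x = X * (2 * (1 + 2 * t)) / (3 + 6 * t + t\<^sup>2)" by blast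
  also have "u = t \<longleftrightarrow> y = t * x" using x unfolding u_def by (simp add: divide_eq_eq)
  finally show ?thesis .
qed

fun res_pair :: "real \<Rightarrow> real \<Rightarrow> nat \<Rightarrow> real \<times> real" where
  "res_pair X Y 0 = (X, Y)"
| "res_pair X Y (Suc n) = (let (x, y) = res_pair X Y n; t = ratio_inv (y / x);
     x' = x * (2 * (1 + 2 * t)) / (3 + 6 * t + t\<^sup>2) in (x', t * x'))"

lemma yjoin_order:
  assumes x: "0 < x" "0 < y" and eq: "yjoin (x, y, y) = (X, Y, Y)" and "Y < X"
  shows "y < x"
proof -
  have "X - Y = (x - y) * (3 / 2 - y / (2 * (x + y + y)))"
    using yjoin_diff[of x y y] x eq by (auto simp: yjoin_def)
  then have "(x - y) * (3 / 2 - y / (2 * (x + y + y))) > 0" using assms by simp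
  then show ?thesis using yjoin_factor_pos[of x y y] x by (simp add: zero_less_mult_iff)
qed

lemma res_pair_props:
  assumes "0 < Y" "Y < X"
  shows "case res_pair X Y n of (x, y) \<Rightarrow> 0 < y \<and> y < x"
    and "case (res_pair X Y n, res_pair X Y (Suc n)) of ((x, y), (x', y')) \<Rightarrow>
       yjoin (x', y', y') = (x, y, y)"
proof -
  have step: "0 < y' \<and> y' < x' \<and> yjoin (x', y', y') = (x, y, y)"
    if "res_pair X Y n = (x, y)" "0 < y" "y < x" "res_pair X Y (Suc n) = (x', y')" for n x y x' y'
  proof -
    define t where "t = ratio_inv (y / x)"
    have t: "t > 0" unfolding t_def using that(2,3) by (intro ratio_inv_pos) (auto simp: field_simps)
    have x': "x' = x * (2 * (1 + 2 * t)) / (3 + 6 * t + t\<^sup>2)" "y' = t * x'"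
      using that(1,4) by (auto simp: Let_def t_def)
    have p: "3 + 6 * t + t\<^sup>2 > 0" using t by (auto intro!: add_pos_nonneg)
    have x: "x > 0" "y < 6 * x" using that(2,3) by auto
    have pos: "0 < x'" unfolding x'(1) using x p t by (intro divide_pos_pos mult_pos_pos) auto
    then have pos': "0 < y'" using x'(2) t by simp
    have eq: "yjoin (x', y', y') = (x, y, y)"
      using yjoin_symmetric_iff[OF x(1) that(2) x(2) pos pos'] x' unfolding t_def by blast
    show ?thesis using yjoin_order[OF pos pos' eq that(3)] pos' eq by blast
  qed
  have *: "0 < snd (res_pair X Y n) \<and> snd (res_pair X Y n) < fst (res_pair X Y n)" for n
  proof (induction n)
    case 0 then show ?case using assms by simp
  next
    case (Suc n)
    then show ?case using step[OF prod.collapse[symmetric] _ _ prod.collapse[symmetric], of n] by blast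
  qed
  then show "case res_pair X Y n of (x, y) \<Rightarrow> 0 < y \<and> y < x" by (simp add: case_prod_beta)
  show "case (res_pair X Y n, res_pair X Y (Suc n)) of ((x, y), (x', y')) \<Rightarrow>
       yjoin (x', y', y') = (x, y, y)"
    using *[of n] step[OF prod.collapse[symmetric] _ _ prod.collapse[symmetric], of n]
    by (simp add: case_prod_beta del: res_pair.simps)
qed

locale resistances =
  fixes a0 b0 :: real
  assumes ab: "b0 < a0" "0 < b0"
begin

definition xs :: "nat \<Rightarrow> real" where
  "xs n = fst (res_pair (a0 / (a0 * b0 + b0 * b0 + b0 * a0)) (b0 / (a0 * b0 + b0 * b0 + b0 * a0)) n)"

definition ys :: "nat \<Rightarrow> real" where
  "ys n = snd (res_pair (a0 / (a0 * b0 + b0 * b0 + b0 * a0)) (b0 / (a0 * b0 + b0 * b0 + b0 * a0)) n)"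

lemma xy_pos: "0 < ys n" "ys n < xs n" "0 < xs n"
  and xy_step: "yjoin (xs (Suc n), ys (Suc n), ys (Suc n)) = (xs n, ys n, ys n)"
proof -
  define \<eta> where "\<eta> = a0 * b0 + b0 * b0 + b0 * a0"
  have \<eta>: "\<eta> > 0" using ab by (auto simp: \<eta>_def intro!: add_pos_pos)
  have 1: "0 < b0 / \<eta>" "b0 / \<eta> < a0 / \<eta>" using ab \<eta> by (auto simp: divide_strict_right_mono)
  note p = res_pair_props[OF 1]
  show "0 < ys n" "ys n < xs n" using p(1)[of n] by (auto simp: xs_def ys_def \<eta>_def split: prod.splits)
  then show "0 < xs n" by linarith
  show "yjoin (xs (Suc n), ys (Suc n), ys (Suc n)) = (xs n, ys n, ys n)"
    using p(2)[of n] by (auto simp: xs_def ys_def \<eta>_def split: prod.splits simp del: res_pair.simps)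
qed

lemma resistance_seq_eq: "resistance_seq a0 b0 b0 = (\<lambda>n. (xs n, ys n, ys n))"
  unfolding resistance_seq_def
proof (rule the_equality, goal_cases)
  case 1
  have 0: "xs 0 = a0 / (a0 * b0 + b0 * b0 + b0 * a0)" "ys 0 = b0 / (a0 * b0 + b0 * b0 + b0 * a0)"
    by (simp_all add: xs_def ys_def)
  have E: "xs (Suc n) + phi (xs (Suc n)) (ys (Suc n)) (ys (Suc n)) = xs n"
      "ys (Suc n) + phi (ys (Suc n)) (ys (Suc n)) (xs (Suc n)) = ys n"
      "ys (Suc n) + phi (ys (Suc n)) (xs (Suc n)) (ys (Suc n)) = ys n" for n
    using xy_step[of n] by (simp_all add: yjoin_def)
  show ?case by (simp add: Let_def 0 E xy_pos)
next
  case (2 s)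
  have s0: "s 0 = (xs 0, ys 0, ys 0)" using 2 by (simp add: Let_def xs_def ys_def)
  have pos: "case s n of (x, y, z) \<Rightarrow> 0 < x \<and> 0 < y \<and> 0 < z" for n
    using conjunct1[OF conjunct2[OF 2]] by (rule spec)
  have st: "s n = yjoin (s (Suc n))" for n using 2 by (auto simp: yjoin_def split: prod.splits)
  have "s n = (xs n, ys n, ys n)" for n
  proof (induction n)
    case 0 show ?case by (rule s0)
  next
    case (Suc n)
    obtain x y z where S: "s (Suc n) = (x, y, z)" by (cases "s (Suc n)") auto
    have xyz: "0 < x" "0 < y" "0 < z" using pos[of "Suc n"] S by auto
    have e: "yjoin (x, y, z) = (xs n, ys n, ys n)" using st[of n] S Suc by simp
    have z: "z = y" using yjoin_symmetric_preimage[OF xyz e] .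
    have 6: "ys n < 6 * xs n" using xy_pos[of n] by simp
    show ?case
      using yjoin_symmetric_iff[OF xy_pos(3,1) 6 xyz(1,2)] e z S xy_step[of n]
        yjoin_symmetric_iff[OF xy_pos(3,1) 6 xy_pos(3,1), of "Suc n" "Suc n"] by simp
  qed
  then show ?case by auto
qed

text \<open>
  In terms of $1/b = 2x+y$ and $1/(2a+b) = y$ the recursion becomes rational of low degree; these
  two quantities govern the symmetric and the antisymmetric part of the energy of a triangle.
\<close>

lemma xy_rec:
  shows "2 * xs n + ys n = 3 * xs (Suc n) + 2 * ys (Suc n)"
    and "ys n = ys (Suc n) * (2 * xs (Suc n) + 3 * ys (Suc n)) / (xs (Suc n) + 2 * ys (Suc n))"
    and "xs n = 3 / 2 * xs (Suc n) + (ys (Suc n))\<^sup>2 / (2 * (xs (Suc n) + 2 * ys (Suc n)))"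
proof -
  note p = xy_pos[of "Suc n"]
  have n: "xs (Suc n) + 2 * ys (Suc n) \<noteq> 0" using p by linarith
  have X: "xs n = 3 / 2 * xs (Suc n) + (ys (Suc n))\<^sup>2 / (2 * (xs (Suc n) + 2 * ys (Suc n)))"
   and Y: "ys n = 3 / 2 * ys (Suc n) + xs (Suc n) * ys (Suc n) / (2 * (xs (Suc n) + 2 * ys (Suc n)))"
    using xy_step[of n] yjoin_symmetric[of "xs (Suc n)" "ys (Suc n)"] p by auto
  show "2 * xs n + ys n = 3 * xs (Suc n) + 2 * ys (Suc n)"
    unfolding X Y using n by (simp add: divide_simps) (simp add: algebra_simps power2_eq_square)
  show "ys n = ys (Suc n) * (2 * xs (Suc n) + 3 * ys (Suc n)) / (xs (Suc n) + 2 * ys (Suc n))"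
    unfolding Y using n by (simp add: divide_simps) (simp add: algebra_simps power2_eq_square)
  show "xs n = 3 / 2 * xs (Suc n) + (ys (Suc n))\<^sup>2 / (2 * (xs (Suc n) + 2 * ys (Suc n)))" by (rule X)
qed

lemma a_b_seq:
  "b_seq a0 b0 n = 1 / (2 * xs n + ys n)"
  "2 * a_seq a0 b0 n + b_seq a0 b0 n = 1 / ys n"
  "b_seq a0 b0 n > 0" "a_seq a0 b0 n > 0"
proof -
  note p = xy_pos[of n]
  have r: "xs n * ys n + ys n * ys n + ys n * xs n = ys n * (2 * xs n + ys n)" by (simp add: algebra_simps)
  have b: "b_seq a0 b0 n = ys n / (ys n * (2 * xs n + ys n))"
   and a: "a_seq a0 b0 n = xs n / (ys n * (2 * xs n + ys n))"
    by (auto simp: b_seq_def a_seq_def conductance_seq_def resistance_seq_eq Let_def r)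
  show "b_seq a0 b0 n = 1 / (2 * xs n + ys n)" using b p by simp
  show "b_seq a0 b0 n > 0" "a_seq a0 b0 n > 0" using a b p by (auto intro!: divide_pos_pos mult_pos_pos)
  have n: "ys n * (2 * xs n + ys n) \<noteq> 0" "ys n \<noteq> 0" using p by auto
  show "2 * a_seq a0 b0 n + b_seq a0 b0 n = 1 / ys n"
    unfolding a b using n by (simp add: divide_simps)
qed

lemma xs_upper: "xs n \<le> xs 0 * (2 / 3) ^ n"
proof (induction n)
  case (Suc n)
  have "(ys (Suc n))\<^sup>2 / (2 * (xs (Suc n) + 2 * ys (Suc n))) \<ge> 0" using xy_pos[of "Suc n"] by simp
  then have "xs (Suc n) \<le> 2 / 3 * xs n" using xy_rec(3)[of n] by linarith
  also have "\<dots> \<le> 2 / 3 * (xs 0 * (2 / 3) ^ n)" using Suc by simp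
  finally show ?case by simp
qed simp

text \<open>
  A contraction rate for the ratio $y/x$: exactly, the ratio is multiplied by
  $1 - (1-t^2)/(4+6t)$, and $4+6t \le 10$ and $t^2 \le t \le y_0/x_0$.
\<close>

definition q :: real where "q = 1 - (1 - (ys 0 / xs 0)) / 10"

lemma q_bounds: "0 < q" "q < 1"
  using xy_pos[of 0] by (auto simp: q_def field_simps)

text \<open>
  The star arms $y$ at the second and third vertex become negligible compared with the arm $x$ at the first.
\<close>

lemma tau_decay: "ys n / xs n \<le> q ^ n * (ys 0 / xs 0)"
proof (induction n)
  case (Suc n)
  define x y where "x = xs (Suc n)" and "y = ys (Suc n)"
  define t where "t = y / x"
  define T where "T = ys n / xs n"
  have p: "0 < y" "y < x" "0 < x" using xy_pos[of "Suc n"] by (auto simp: x_def y_def)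
  have t: "0 < t" "t < 1" "y = t * x" using p by (auto simp: t_def)
  have T: "T \<le> ys 0 / xs 0"
  proof -
    have "q ^ n * (ys 0 / xs 0) \<le> 1 * (ys 0 / xs 0)"
      using xy_pos[of 0] q_bounds by (intro mult_right_mono) (auto intro: power_le_one)
    then show ?thesis using Suc by (simp add: T_def)
  qed
  have Tpos: "T > 0" using xy_pos[of n] by (simp add: T_def)
  have rel: "T * (3 + 6 * t + t\<^sup>2) = t * (4 + 6 * t)"
  proof -
    have X: "xs n * (2 * (x + 2 * y)) = 3 * x * (x + 2 * y) + y\<^sup>2"
      using p xy_rec(3)[of n] by (simp add: x_def[symmetric] y_def[symmetric] field_simps)
    have Y: "ys n * (x + 2 * y) = y * (2 * x + 3 * y)"
      using p xy_rec(2)[of n] by (simp add: x_def[symmetric] y_def[symmetric] field_simps)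
    have YT: "ys n = T * xs n" using xy_pos[of n] by (simp add: T_def)
    have "T * (xs n * (2 * (x + 2 * y))) = 2 * (y * (2 * x + 3 * y))"
      using Y YT by (simp add: algebra_simps)
    then have "T * (3 * x * (x + 2 * y) + y\<^sup>2) = 2 * (y * (2 * x + 3 * y))" using X by simp
    then have "x\<^sup>2 * (T * (3 + 6 * t + t\<^sup>2)) = x\<^sup>2 * (t * (4 + 6 * t))"
      unfolding t(3) by (simp add: algebra_simps power2_eq_square)
    then show ?thesis using p by simp
  qed
  have tT: "t \<le> T"
  proof -
    have "t * (3 + 6 * t + t\<^sup>2) \<le> t * (4 + 6 * t)" using t by (intro mult_left_mono) (auto simp: power_le_one)
    then have "t * (3 + 6 * t + t\<^sup>2) \<le> T * (3 + 6 * t + t\<^sup>2)" using rel by simp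
    moreover have "3 + 6 * t + t\<^sup>2 > 0" using t by (auto intro!: add_pos_nonneg)
    ultimately show ?thesis by (simp add: mult_le_cancel_right)
  qed
  have "t \<le> q * T"
  proof -
    have "t\<^sup>2 \<le> t" using t by (simp add: power2_eq_square mult_le_cancel_left1)
    then have t2: "t\<^sup>2 \<le> ys 0 / xs 0" using tT T by linarith
    have "3 + 6 * t + t\<^sup>2 \<le> q * (4 + 6 * t)"
    proof -
      have "(1 - q) * (4 + 6 * t) \<le> (1 - q) * 10" using t q_bounds by (intro mult_left_mono) auto
      also have "\<dots> = 1 - ys 0 / xs 0" by (simp add: q_def)
      also have "\<dots> \<le> 1 - t\<^sup>2" using t2 by simp
      finally show ?thesis by (simp add: algebra_simps)
    qed
    then have "T * (3 + 6 * t + t\<^sup>2) \<le> T * (q * (4 + 6 * t))" using Tpos by (intro mult_left_mono) auto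
    then have "t * (4 + 6 * t) \<le> (q * T) * (4 + 6 * t)" using rel by (simp add: algebra_simps)
    moreover have "4 + 6 * t > 0" using t by auto
    ultimately show ?thesis by (simp add: mult_le_cancel_right)
  qed
  also have "\<dots> \<le> q * (q ^ n * (ys 0 / xs 0))" using Suc q_bounds by (intro mult_left_mono) (auto simp: T_def)
  finally show ?case by (simp add: t_def x_def y_def)
qed simp

text \<open>
  In each step $x$ shrinks by $2/3$ and an extra factor of at least $\exp(-q^{n+1})$; the exponents are summable.
\<close>

lemma xs_lower: "\<exists>c>0. \<forall>n. c * (2 / 3) ^ n \<le> xs n"
proof -
  have step: "xs (Suc n) \<ge> 2 / 3 * xs n * exp (- (q ^ Suc n))" for n
  proof -
    define x y where "x = xs (Suc n)" and "y = ys (Suc n)"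
    have p: "0 < y" "y < x" "0 < x" using xy_pos[of "Suc n"] by (auto simp: x_def y_def)
    have "y / x \<le> q ^ Suc n * (ys 0 / xs 0)" using tau_decay[of "Suc n"] by (simp add: x_def y_def)
    also have "\<dots> \<le> q ^ Suc n * 1" using xy_pos[of 0] q_bounds by (intro mult_left_mono) auto
    finally have yx: "y / x \<le> q ^ Suc n" by simp
    have "y\<^sup>2 / (2 * (x + 2 * y)) \<le> y\<^sup>2 / (2 * y)" using p by (intro divide_left_mono) auto
    also have "\<dots> = y / 2" by (simp add: power2_eq_square)
    finally have "xs n \<le> 3 / 2 * x + y / 2" using xy_rec(3)[of n] by (simp add: x_def y_def)
    also have "\<dots> \<le> 3 / 2 * x * (1 + y / x)" using p by (simp add: field_simps)
    also have "\<dots> \<le> 3 / 2 * x * exp (q ^ Suc n)"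
      using p order_trans[OF add_left_mono[OF yx, of 1] exp_ge_add_one_self[of "q ^ Suc n"]]
      by (intro mult_left_mono) auto
    finally have "xs n \<le> 3 / 2 * x * exp (q ^ Suc n)" .
    then have "2 / 3 * xs n * exp (- (q ^ Suc n)) \<le> 2 / 3 * (3 / 2 * x * exp (q ^ Suc n)) * exp (- (q ^ Suc n))"
      by (intro mult_right_mono mult_left_mono) auto
    also have "\<dots> = x" by (simp add: exp_minus)
    finally show ?thesis by (simp add: x_def)
  qed
  have main: "xs n \<ge> xs 0 * (2 / 3) ^ n * exp (- (\<Sum>k<n. q ^ Suc k))" for n
  proof (induction n)
    case (Suc n)
    have "xs 0 * (2 / 3) ^ Suc n * exp (- (\<Sum>k<Suc n. q ^ Suc k))
       = 2 / 3 * (xs 0 * (2 / 3) ^ n * exp (- (\<Sum>k<n. q ^ Suc k))) * exp (- (q ^ Suc n))"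
      by (simp add: exp_diff exp_minus exp_add field_simps)
    also have "\<dots> \<le> 2 / 3 * xs n * exp (- (q ^ Suc n))" using Suc by (intro mult_right_mono mult_left_mono) auto
    also have "\<dots> \<le> xs (Suc n)" by (rule step)
    finally show ?case .
  qed simp
  have sum: "(\<Sum>k<n. q ^ Suc k) \<le> 1 / (1 - q)" for n
  proof -
    have "(\<Sum>k<n. q ^ Suc k) \<le> (\<Sum>k<n. q ^ k)" using q_bounds by (intro sum_mono) (simp add: mult_le_cancel_right1)
    also have "\<dots> \<le> (\<Sum>k. q ^ k)" using q_bounds by (intro sum_le_suminf summable_geometric) auto
    also have "\<dots> = 1 / (1 - q)" using q_bounds by (intro suminf_geometric) auto
    finally show ?thesis .
  qed
  show ?thesis
  proof (intro exI conjI allI)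
    show "xs 0 * exp (- (1 / (1 - q))) > 0" using xy_pos by simp
    fix n
    have "xs 0 * exp (- (1 / (1 - q))) * (2 / 3) ^ n = xs 0 * (2 / 3) ^ n * exp (- (1 / (1 - q)))" by simp
    also have "\<dots> \<le> xs 0 * (2 / 3) ^ n * exp (- (\<Sum>k<n. q ^ Suc k))"
      using sum[of n] xy_pos(3)[of 0] by (intro mult_left_mono) (auto intro!: mult_nonneg_nonneg)
    also have "\<dots> \<le> xs n" by (rule main)
    finally show "xs 0 * exp (- (1 / (1 - q))) * (2 / 3) ^ n \<le> xs n" .
  qed
qed

lemma b_seq_bounds:
  obtains c C where "0 < c" "0 < C" "\<And>n. c * (3 / 2) ^ n \<le> b_seq a0 b0 n" "\<And>n. b_seq a0 b0 n \<le> C * (3 / 2) ^ n"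
proof -
  obtain d where d: "d > 0" "\<And>n. d * (2 / 3) ^ n \<le> xs n" using xs_lower by blast
  have e: "(3 / 2 :: real) ^ n = 1 / (2 / 3) ^ n" for n by (simp add: power_divide)
  show ?thesis
  proof
    show "0 < 1 / (3 * xs 0)" "0 < 1 / d" using xy_pos d by auto
    show "1 / (3 * xs 0) * (3 / 2) ^ n \<le> b_seq a0 b0 n" for n
    proof -
      have "2 * xs n + ys n \<le> 3 * xs 0 * (2 / 3) ^ n" using xy_pos[of n] xs_upper[of n] by simp
      then have "1 / (3 * xs 0 * (2 / 3) ^ n) \<le> 1 / (2 * xs n + ys n)"
        using xy_pos[of n] by (intro divide_left_mono) (auto intro!: mult_pos_pos xy_pos)
      then show ?thesis by (simp add: a_b_seq(1) e)
    qed
    show "b_seq a0 b0 n \<le> 1 / d * (3 / 2) ^ n" for n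
    proof -
      have "d * (2 / 3) ^ n \<le> 2 * xs n + ys n" using xy_pos[of n] d(2)[of n] by simp
      then have "1 / (2 * xs n + ys n) \<le> 1 / (d * (2 / 3) ^ n)"
        using xy_pos[of n] d by (intro divide_left_mono) (auto intro!: mult_pos_pos)
      then show ?thesis by (simp add: a_b_seq(1) e)
    qed
  qed
qed

end

section \<open>Monotonicity of the discrete energies\<close>

text \<open>
  Two resistors in series: the energy is at least the squared total drop over the total resistance.
\<close>

lemma cauchy_resistors:
  fixes p q R S :: real
  assumes "0 < R" "0 < S"
  shows "(p + q)\<^sup>2 / (R + S) \<le> p\<^sup>2 / R + q\<^sup>2 / S"
proof -
  have "p\<^sup>2 / R + q\<^sup>2 / S - (p + q)\<^sup>2 / (R + S) = (S * p - R * q)\<^sup>2 / (R * S * (R + S))"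
    using assms by (simp add: divide_simps add_pos_pos) (simp add: algebra_simps power2_eq_square)
  also have "\<dots> \<ge> 0" using assms by simp
  finally show ?thesis by simp
qed

context resistances
begin

abbreviation "cond_a n \<equiv> a_seq a0 b0 n"
abbreviation "cond_b n \<equiv> b_seq a0 b0 n"

definition tri :: "nat \<Rightarrow> real \<Rightarrow> real \<Rightarrow> real \<Rightarrow> real" where
  "tri n u1 u2 u3 = cond_b n * (u1 - u2)\<^sup>2 + cond_b n * (u1 - u3)\<^sup>2 + cond_a n * (u2 - u3)\<^sup>2"

lemma tri_nonneg: "0 \<le> tri n u1 u2 u3"
  using a_b_seq(3,4)[of n] by (simp add: tri_def)

lemma tri_edge: "cond_b n * (u1 - u2)\<^sup>2 \<le> tri n u1 u2 u3" "cond_b n * (u1 - u3)\<^sup>2 \<le> tri n u1 u2 u3"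
  using a_b_seq(3,4)[of n] by (simp_all add: tri_def)

text \<open>
  The energy of a triangle is the trace of the energy of its subdivision. After splitting boundary and
  inner values into parts that are symmetric and antisymmetric in the last two vertices, the energies of
  both parts decouple: the symmetric part is a network of series and parallel resistors, the
  antisymmetric one a quadratic polynomial in one unknown, whose square is completed.
\<close>

lemma tri_mono:
  "tri n u1 u2 u3 \<le> tri (Suc n) u1 q12 q13 + tri (Suc n) q12 u2 q23 + tri (Suc n) q13 q23 u3"
proof -
  define x y a b where "x = xs (Suc n)" and "y = ys (Suc n)" and "a = cond_a (Suc n)" and "b = cond_b (Suc n)"
  have pos: "0 < x" "0 < y" "0 < a" "0 < b" using xy_pos[of "Suc n"] a_b_seq(3,4)[of "Suc n"]
    by (auto simp: x_def y_def a_def b_def)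
  have b: "b = 1 / (2 * x + y)" and ab: "2 * a + b = 1 / y"
    using a_b_seq(1,2)[of "Suc n"] by (simp_all add: x_def y_def a_def b_def)
  have a: "a = x / (y * (2 * x + y))"
  proof -
    have "2 * a = 1 / y - 1 / (2 * x + y)" using ab b by simp
    also have "\<dots> = 2 * (x / (y * (2 * x + y)))" using pos by (simp add: divide_simps)
    finally show ?thesis by simp
  qed
  have Bn: "cond_b n = 1 / (3 * x + 2 * y)" using a_b_seq(1)[of n] xy_rec(1)[of n] by (simp add: x_def y_def)
  have AB: "2 * cond_a n + cond_b n = (x + 2 * y) / (y * (2 * x + 3 * y))"
    using a_b_seq(2)[of n] xy_rec(2)[of n] by (simp add: x_def y_def)
  define s d \<sigma> \<delta> where "s = (u2 + u3) / 2" and "d = (u2 - u3) / 2" and "\<sigma> = (q12 + q13) / 2" and "\<delta> = (q12 - q13) / 2"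
  have u: "u2 = s + d" "u3 = s - d" "q12 = \<sigma> + \<delta>" "q13 = \<sigma> - \<delta>" by (simp_all add: s_def d_def \<sigma>_def \<delta>_def field_simps)
  define Sym where "Sym = 2 * b * (u1 - \<sigma>)\<^sup>2 + 2 * b * (\<sigma> - s)\<^sup>2 + 2 * b * (\<sigma> - q23)\<^sup>2 + 2 * a * (q23 - s)\<^sup>2"
  define Anti where "Anti = (6 * b + 4 * a) * \<delta>\<^sup>2 - 4 * b * \<delta> * d + (2 * b + 2 * a) * d\<^sup>2"
  have "tri (Suc n) u1 q12 q13 + tri (Suc n) q12 u2 q23 + tri (Suc n) q13 q23 u3 = Sym + Anti"
    unfolding tri_def u Sym_def Anti_def a_def[symmetric] b_def[symmetric]
    by (simp add: algebra_simps power2_eq_square)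
  moreover have "tri n u1 u2 u3 = 2 * cond_b n * (u1 - s)\<^sup>2 + 2 * (2 * cond_a n + cond_b n) * d\<^sup>2"
    unfolding tri_def u by (simp add: algebra_simps power2_eq_square)
  moreover have "2 * cond_b n * (u1 - s)\<^sup>2 \<le> Sym"
  proof -
    \<comment> \<open>Edges of conductances $b$ and $a$ in series.\<close>
    have 1: "b * (\<sigma> - q23)\<^sup>2 + a * (q23 - s)\<^sup>2 \<ge> (\<sigma> - s)\<^sup>2 * (x / ((2 * x + y) * (x + y)))"
    proof -
      have "(\<sigma> - s)\<^sup>2 / ((2 * x + y) + y * (2 * x + y) / x) \<le> (\<sigma> - q23)\<^sup>2 / (2 * x + y) + (q23 - s)\<^sup>2 / (y * (2 * x + y) / x)"
        using cauchy_resistors[of "2 * x + y" "y * (2 * x + y) / x" "\<sigma> - q23" "q23 - s"] pos by simp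
      also have "\<dots> = b * (\<sigma> - q23)\<^sup>2 + a * (q23 - s)\<^sup>2" by (simp add: a b)
      finally have *: "(\<sigma> - s)\<^sup>2 / ((2 * x + y) + y * (2 * x + y) / x) \<le> b * (\<sigma> - q23)\<^sup>2 + a * (q23 - s)\<^sup>2" .
      have "(2 * x + y) + y * (2 * x + y) / x = (2 * x + y) * (x + y) / x" using pos by (simp add: field_simps)
      then show ?thesis using * by simp
    qed
    \<comment> \<open>In parallel with another edge of conductance $b$ they form a resistor $x+y$.\<close>
    have 2: "b + x / ((2 * x + y) * (x + y)) = 1 / (x + y)"
      unfolding b using pos by (simp add: divide_simps add_pos_pos)
    have "b * (\<sigma> - s)\<^sup>2 + (\<sigma> - s)\<^sup>2 * (x / ((2 * x + y) * (x + y))) = (b + x / ((2 * x + y) * (x + y))) * (\<sigma> - s)\<^sup>2"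
      by (simp add: algebra_simps)
    also have "\<dots> = (\<sigma> - s)\<^sup>2 / (x + y)" unfolding 2 by simp
    finally have 3: "b * (\<sigma> - s)\<^sup>2 + (\<sigma> - s)\<^sup>2 * (x / ((2 * x + y) * (x + y))) = (\<sigma> - s)\<^sup>2 / (x + y)" .
    have "(u1 - s)\<^sup>2 / (3 * x + 2 * y) \<le> (u1 - \<sigma>)\<^sup>2 / (2 * x + y) + (\<sigma> - s)\<^sup>2 / (x + y)"
      using cauchy_resistors[of "2 * x + y" "x + y" "u1 - \<sigma>" "\<sigma> - s"] pos by (simp add: algebra_simps)
    then show ?thesis using 1 3 unfolding Sym_def Bn by (simp add: b)
  qed
  moreover have "2 * (2 * cond_a n + cond_b n) * d\<^sup>2 \<le> Anti"
  proof -
    define e where "e = 3 * b + 2 * a"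
    have e: "e > 0" using pos by (simp add: e_def)
    have e2: "e = (2 * x + 3 * y) / (y * (2 * x + y))"
      unfolding e_def a b using pos by (simp add: divide_simps add_pos_pos)
    have "b\<^sup>2 / e = y / ((2 * x + y) * (2 * x + 3 * y))"
      unfolding e2 b using pos by (simp add: divide_simps add_pos_pos) (simp add: power2_eq_square)
    moreover have "a + b = (x + y) / (y * (2 * x + y))"
      unfolding a b using pos by (simp add: divide_simps add_pos_pos)
    moreover have "(x + y) / (y * (2 * x + y)) - y / ((2 * x + y) * (2 * x + 3 * y)) = (x + 2 * y) / (y * (2 * x + 3 * y))"
      using pos by (simp add: divide_simps add_pos_pos) (simp add: algebra_simps)
    ultimately have eq: "2 * cond_a n + cond_b n = a + b - b\<^sup>2 / e" using AB by simp
    have "Anti - 2 * (a + b - b\<^sup>2 / e) * d\<^sup>2 = 2 * e * (\<delta> - b * d / e)\<^sup>2"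
      using e unfolding Anti_def power2_diff power_divide
      by (simp add: e_def[symmetric] field_simps power2_eq_square) (simp add: e_def algebra_simps)
    also have "\<dots> \<ge> 0" using e by simp
    finally show ?thesis unfolding eq by simp
  qed
  ultimately show ?thesis by simp
qed

definition cell_tri :: "nat \<Rightarrow> nat list \<Rightarrow> (complex \<Rightarrow> real) \<Rightarrow> real" where
  "cell_tri n w u = tri n (u (corner w 1))
     (u (corner w 2)) (u (corner w 3))"

text \<open>
  The level $n+k$ energy of $u$ inside the cell of the word $w$ of length $n$.
\<close>

definition cell_energy :: "nat \<Rightarrow> nat \<Rightarrow> nat list \<Rightarrow> (complex \<Rightarrow> real) \<Rightarrow> real" where
  "cell_energy n k w u = (\<Sum>v\<in>words k. cell_tri (n + k) (w @ v) u)"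

lemma cell_tri_nonneg: "0 \<le> cell_tri n w u"
  by (simp add: cell_tri_def tri_nonneg)

lemma cell_energy_nonneg: "0 \<le> cell_energy n k w u"
  by (simp add: cell_energy_def sum_nonneg cell_tri_nonneg)

lemma energy_n_eq: "energy_n a0 b0 n u = (\<Sum>w\<in>words n. cell_tri n w u)"
  by (simp add: energy_n_def cell_tri_def tri_def Let_def)

lemma energy_n_cells: "energy_n a0 b0 (n + k) u = (\<Sum>w\<in>words n. cell_energy n k w u)"
  by (simp add: energy_n_eq sum_words_add cell_energy_def)

lemma word_map_midpoint: "corner (w @ [i]) j = corner (w @ [j]) i"
  by (simp add: gasket_word_map_append gasket_map_eq add.commute)

lemma word_map_vertex: "corner (w @ [i]) i = corner w i"
  by (simp add: gasket_word_map_append gasket_map_eq)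

lemma cell_tri_mono:
  "cell_tri n w u \<le> cell_tri (Suc n) (w @ [1]) u + cell_tri (Suc n) (w @ [2]) u + cell_tri (Suc n) (w @ [3]) u"
  unfolding cell_tri_def word_map_vertex
    word_map_midpoint[of w 2 1] word_map_midpoint[of w 3 1] word_map_midpoint[of w 3 2]
  by (rule tri_mono)

lemma cell_energy_Suc: "cell_energy n (Suc k) w u =
    cell_energy (Suc n) k (w @ [1]) u + cell_energy (Suc n) k (w @ [2]) u + cell_energy (Suc n) k (w @ [3]) u"
  by (simp add: cell_energy_def sum_words_Suc sum.distrib)

lemma cell_energy_mono: "cell_energy n k w u \<le> cell_energy n (Suc k) w u"
proof (induction k arbitrary: n w)
  case 0
  show ?case unfolding cell_energy_Suc using cell_tri_mono[of n w u] by (simp add: cell_energy_def)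
next
  case (Suc k)
  show ?case unfolding cell_energy_Suc[of n] by (intro add_mono Suc)
qed

lemma energy_n_mono: "incseq (\<lambda>n. energy_n a0 b0 n u)"
proof (rule incseq_SucI)
  fix n
  have "cell_energy 0 k [] u = energy_n a0 b0 k u" for k
    by (simp add: cell_energy_def energy_n_eq)
  then show "energy_n a0 b0 n u \<le> energy_n a0 b0 (Suc n) u" using cell_energy_mono[of 0 n "[]" u] by simp
qed

lemma energy_n_nonneg: "0 \<le> energy_n a0 b0 n u"
  by (simp add: energy_n_eq sum_nonneg cell_tri_nonneg)

lemma energy_eq_SUP: "energy a0 b0 u = (SUP n. ereal (energy_n a0 b0 n u))"
  unfolding energy_def using energy_n_mono[of u]
  by (intro limI LIMSEQ_SUP) (auto simp: incseq_def)

section \<open>The limiting bilinear form\<close>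

definition finite_energy :: "(complex \<Rightarrow> real) \<Rightarrow> bool" where
  "finite_energy u \<longleftrightarrow> (\<exists>R. \<forall>n. energy_n a0 b0 n u \<le> R)"

text \<open>
  The energy as a real number; it is informative only for functions of finite energy.
\<close>

definition En :: "(complex \<Rightarrow> real) \<Rightarrow> real" where
  "En u = real_of_ereal (energy a0 b0 u)"

lemma energy_finite_iff: "energy a0 b0 u < \<infinity> \<longleftrightarrow> finite_energy u"
proof
  assume "energy a0 b0 u < \<infinity>"
  moreover have "ereal (energy_n a0 b0 n u) \<le> energy a0 b0 u" for n
    unfolding energy_eq_SUP by (intro SUP_upper) auto
  moreover from this[of 0] energy_n_nonneg[of 0 u] have "energy a0 b0 u \<noteq> -\<infinity>" by auto
  ultimately show "finite_energy u" unfolding finite_energy_def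
    by (cases "energy a0 b0 u") auto
next
  assume "finite_energy u"
  then obtain R where "\<And>n. energy_n a0 b0 n u \<le> R" by (auto simp: finite_energy_def)
  then have "energy a0 b0 u \<le> ereal R" unfolding energy_eq_SUP by (intro SUP_least) auto
  then show "energy a0 b0 u < \<infinity>" by auto
qed

lemma energy_lim:
  assumes "finite_energy u"
  shows "(\<lambda>n. energy_n a0 b0 n u) \<longlonglongrightarrow> En u" "energy_n a0 b0 n u \<le> En u"
proof -
  obtain R where R: "\<And>n. energy_n a0 b0 n u \<le> R" using assms by (auto simp: finite_energy_def)
  obtain l where l: "(\<lambda>n. energy_n a0 b0 n u) \<longlonglongrightarrow> l" "\<And>n. energy_n a0 b0 n u \<le> l"
    using incseq_convergent[OF energy_n_mono, of u R] R by blast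
  have eq: "energy a0 b0 u = ereal l" unfolding energy_def using l(1) by (intro limI) simp
  then show "(\<lambda>n. energy_n a0 b0 n u) \<longlonglongrightarrow> En u" "energy_n a0 b0 n u \<le> En u"
    using l eq by (auto simp: En_def)
qed

lemma En_nonneg: "finite_energy u \<Longrightarrow> 0 \<le> En u"
  using energy_lim(2)[of u 0] energy_n_nonneg[of 0 u] by linarith

lemma En_le: "(\<And>n. energy_n a0 b0 n u \<le> R) \<Longrightarrow> finite_energy u \<and> En u \<le> R"
proof -
  assume R: "\<And>n. energy_n a0 b0 n u \<le> R"
  then have f: "finite_energy u" by (auto simp: finite_energy_def)
  then show ?thesis using LIMSEQ_le_const2[OF energy_lim(1)[OF f]] R by blast
qed

lemma form_domain_iff: "u \<in> form_domain a0 b0 \<longleftrightarrow> u \<in> gasket_functions \<and> finite_energy u"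
  unfolding form_domain_def energy_finite_iff by simp

definition tri2 :: "nat \<Rightarrow> nat list \<Rightarrow> (complex \<Rightarrow> real) \<Rightarrow> (complex \<Rightarrow> real) \<Rightarrow> real" where
  "tri2 n w u v = (let P = (\<lambda>i. corner w i) in
     cond_b n * (u (P 1) - u (P 2)) * (v (P 1) - v (P 2)) + cond_b n * (u (P 1) - u (P 3)) * (v (P 1) - v (P 3))
     + cond_a n * (u (P 2) - u (P 3)) * (v (P 2) - v (P 3)))"

text \<open>
  The polarization of the discrete energy; bilinearity of the form is inherited in the limit.
\<close>

definition form_n :: "nat \<Rightarrow> (complex \<Rightarrow> real) \<Rightarrow> (complex \<Rightarrow> real) \<Rightarrow> real" where
  "form_n n u v = (\<Sum>w\<in>words n. tri2 n w u v)"

lemma form_n_self: "form_n n u u = energy_n a0 b0 n u"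
  by (simp add: form_n_def energy_n_eq tri2_def cell_tri_def tri_def Let_def power2_eq_square mult.assoc)

lemma form_n_commute: "form_n n u v = form_n n v u"
  by (simp add: form_n_def tri2_def Let_def mult_ac)

lemma form_n_add: "form_n n (u + v) t = form_n n u t + form_n n v t"
  by (simp add: form_n_def tri2_def Let_def sum.distrib[symmetric] algebra_simps)

lemma form_n_scale: "form_n n (\<lambda>x. c * u x) t = c * form_n n u t"
  by (simp add: form_n_def tri2_def Let_def sum_distrib_left algebra_simps)

lemma form_n_add_right: "form_n n t (u + v) = form_n n t u + form_n n t v"
  using form_n_add form_n_commute by metis

lemma form_n_scale_right: "form_n n t (\<lambda>x. c * u x) = c * form_n n t u"
  using form_n_scale form_n_commute by metis

lemma energy_n_add: "energy_n a0 b0 n (u + v) = energy_n a0 b0 n u + 2 * form_n n u v + energy_n a0 b0 n v"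
  by (simp add: form_n_self[symmetric] form_n_add form_n_add_right form_n_commute[of n v u])

lemma energy_n_scale: "energy_n a0 b0 n (\<lambda>x. c * u x) = c\<^sup>2 * energy_n a0 b0 n u"
  by (simp add: form_n_self[symmetric] form_n_scale form_n_scale_right power2_eq_square)

lemma diff_as_scale: "u - v = u + (\<lambda>x. (-1) * v x)" for u v :: "complex \<Rightarrow> real"
  by auto

lemma energy_n_diff: "energy_n a0 b0 n (u - v) = energy_n a0 b0 n u - 2 * form_n n u v + energy_n a0 b0 n v"
  unfolding diff_as_scale energy_n_add energy_n_scale form_n_scale_right by simp

lemma energy_n_parallelogram: "energy_n a0 b0 n (u + v) \<le> 2 * energy_n a0 b0 n u + 2 * energy_n a0 b0 n v"
  "energy_n a0 b0 n (u - v) \<le> 2 * energy_n a0 b0 n u + 2 * energy_n a0 b0 n v"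
  using energy_n_nonneg[of n "u - v"] energy_n_nonneg[of n "u + v"]
  unfolding energy_n_add energy_n_diff by linarith+

lemma finite_energy_add:
  assumes "finite_energy u" "finite_energy v"
  shows "finite_energy (u + v)" "finite_energy (u - v)"
proof -
  obtain R S where "\<And>n. energy_n a0 b0 n u \<le> R" "\<And>n. energy_n a0 b0 n v \<le> S"
    using assms by (auto simp: finite_energy_def)
  then have "energy_n a0 b0 n (u + v) \<le> 2 * R + 2 * S" "energy_n a0 b0 n (u - v) \<le> 2 * R + 2 * S" for n
    using energy_n_parallelogram[of n u v] by (meson add_mono mult_left_mono order_trans zero_le_numeral)+
  then show "finite_energy (u + v)" "finite_energy (u - v)" by (auto simp: finite_energy_def)
qed

lemma finite_energy_scale: "finite_energy u \<Longrightarrow> finite_energy (\<lambda>x. c * u x)"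
  unfolding finite_energy_def energy_n_scale by (meson mult_left_mono zero_le_power2)

lemma form_lim:
  assumes "finite_energy u" "finite_energy v"
  shows "(\<lambda>n. form_n n u v) \<longlonglongrightarrow> form a0 b0 u v"
proof -
  have "(\<lambda>n. (energy_n a0 b0 n (u + v) - energy_n a0 b0 n (u - v)) / 4) \<longlonglongrightarrow> (En (u + v) - En (u - v)) / 4"
    by (intro tendsto_intros energy_lim finite_energy_add assms) simp
  moreover have "(energy_n a0 b0 n (u + v) - energy_n a0 b0 n (u - v)) / 4 = form_n n u v" for n
    unfolding energy_n_add energy_n_diff by simp
  ultimately show ?thesis by (simp add: form_def En_def)
qed

lemma form_add:
  assumes "finite_energy u" "finite_energy v" "finite_energy t"
  shows "form a0 b0 (u + v) t = form a0 b0 u t + form a0 b0 v t"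
proof (rule LIMSEQ_unique)
  show "(\<lambda>n. form_n n (u + v) t) \<longlonglongrightarrow> form a0 b0 (u + v) t" by (intro form_lim finite_energy_add assms)
  show "(\<lambda>n. form_n n (u + v) t) \<longlonglongrightarrow> form a0 b0 u t + form a0 b0 v t"
    unfolding form_n_add by (intro tendsto_add form_lim assms)
qed

lemma form_scale:
  assumes "finite_energy u" "finite_energy t"
  shows "form a0 b0 (\<lambda>x. c * u x) t = c * form a0 b0 u t"
proof (rule LIMSEQ_unique)
  show "(\<lambda>n. form_n n (\<lambda>x. c * u x) t) \<longlonglongrightarrow> form a0 b0 (\<lambda>x. c * u x) t" by (intro form_lim finite_energy_scale assms)
  show "(\<lambda>n. form_n n (\<lambda>x. c * u x) t) \<longlonglongrightarrow> c * form a0 b0 u t"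
    unfolding form_n_scale by (intro tendsto_mult tendsto_const form_lim assms)
qed

lemma form_commute: "form a0 b0 u v = form a0 b0 v u"
proof -
  have "energy_n a0 b0 n (u - v) = energy_n a0 b0 n (v - u)" for n
    unfolding energy_n_diff form_n_commute[of n u v] by simp
  then have "energy a0 b0 (u - v) = energy a0 b0 (v - u)" by (simp add: energy_def)
  then show ?thesis by (simp add: form_def add.commute)
qed

lemma form_self: "finite_energy u \<Longrightarrow> form a0 b0 u u = En u"
  using form_lim[of u u] energy_lim(1)[of u] by (auto simp: form_n_self intro: LIMSEQ_unique)

end

section \<open>The inner product\<close>

lemma set_integrable_gasket:
  fixes f :: "complex \<Rightarrow> real"
  assumes "continuous_on gasket f"
  shows "set_integrable gasket_measure gasket f"
proof -
  have "compact (f ` gasket)" by (intro compact_continuous_image assms gasket_props)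
  then have "bounded (f ` gasket)" by (rule compact_imp_bounded)
  then obtain M where M: "\<forall>x\<in>gasket. norm (f x) \<le> M" by (auto simp: bounded_iff)
  have "(\<lambda>x. indicator gasket x *\<^sub>R f x) \<in> borel_measurable borel"
    using assms by (intro borel_measurable_continuous_on_indicator) auto
  then have "(\<lambda>x. indicator gasket x *\<^sub>R f x) \<in> borel_measurable gasket_measure"
    by (subst measurable_cong_sets[OF sets_gasket_measure refl])
  then show ?thesis unfolding set_integrable_def
    by (intro finite_measure.integrable_const_bound[OF finite_measure_gasket, of _ "\<bar>M\<bar>"])
      (use M in \<open>auto simp: indicator_def intro!: AE_I2\<close>)
qed

definition ip :: "(complex \<Rightarrow> real) \<Rightarrow> (complex \<Rightarrow> real) \<Rightarrow> real" where
  "ip u v = (LINT x:gasket|gasket_measure. u x * v x)"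

lemma gasket_functions_cont: "u \<in> gasket_functions \<Longrightarrow> continuous_on gasket u"
  by (simp add: gasket_functions_def)

lemma ip_commute: "ip u v = ip v u"
  by (simp add: ip_def mult.commute)

lemma ip_add:
  assumes "u \<in> gasket_functions" "v \<in> gasket_functions" "t \<in> gasket_functions"
  shows "ip (u + v) t = ip u t + ip v t"
  unfolding ip_def plus_fun_apply distrib_right
  by (intro set_integral_add set_integrable_gasket continuous_intros gasket_functions_cont assms)

lemma ip_scale: "ip (\<lambda>x. c * u x) t = c * ip u t"
  by (simp add: ip_def mult.assoc)

lemma ip_nonneg: "0 \<le> ip u u"
  unfolding ip_def set_lebesgue_integral_def by (intro Bochner_Integration.integral_nonneg) (simp add: indicator_def)

lemma gasket_functions_add: "u \<in> gasket_functions \<Longrightarrow> v \<in> gasket_functions \<Longrightarrow> u + v \<in> gasket_functions"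
  by (auto simp: gasket_functions_def intro!: continuous_on_add simp: plus_fun_def)

lemma gasket_functions_scale: "u \<in> gasket_functions \<Longrightarrow> (\<lambda>x. c * u x) \<in> gasket_functions"
  by (auto simp: gasket_functions_def intro!: continuous_intros)

lemma ip_limit:
  assumes u: "\<And>k. u k \<in> gasket_functions" "\<And>k. v k \<in> gasket_functions" "u0 \<in> gasket_functions" "v0 \<in> gasket_functions"
    and lim: "\<And>x. x \<in> gasket \<Longrightarrow> (\<lambda>k. u k x) \<longlonglongrightarrow> u0 x" "\<And>x. x \<in> gasket \<Longrightarrow> (\<lambda>k. v k x) \<longlonglongrightarrow> v0 x"
    and bd: "\<And>k x. x \<in> gasket \<Longrightarrow> \<bar>u k x\<bar> \<le> M" "\<And>k x. x \<in> gasket \<Longrightarrow> \<bar>v k x\<bar> \<le> M"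
  shows "(\<lambda>k. ip (u k) (v k)) \<longlonglongrightarrow> ip u0 v0"
  unfolding ip_def set_lebesgue_integral_def
proof (rule integral_dominated_convergence)
  have I: "integrable gasket_measure (\<lambda>x. indicator gasket x *\<^sub>R (f x * g x))"
    if "f \<in> gasket_functions" "g \<in> gasket_functions" for f g :: "complex \<Rightarrow> real"
  proof -
    have "continuous_on gasket (\<lambda>x. f x * g x)" using that by (intro continuous_intros gasket_functions_cont)
    from set_integrable_gasket[OF this] show ?thesis by (simp add: set_integrable_def)
  qed
  show "(\<lambda>x. indicator gasket x *\<^sub>R (u0 x * v0 x)) \<in> borel_measurable gasket_measure"
    "(\<lambda>x. indicator gasket x *\<^sub>R (u k x * v k x)) \<in> borel_measurable gasket_measure" for k
    using I u by (auto intro!: borel_measurable_integrable)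
  show "integrable gasket_measure (\<lambda>x. M * M)"
    by (rule finite_measure.integrable_const[OF finite_measure_gasket])
  show "AE x in gasket_measure. (\<lambda>k. indicator gasket x *\<^sub>R (u k x * v k x)) \<longlonglongrightarrow> indicator gasket x *\<^sub>R (u0 x * v0 x)"
    by (rule AE_I2) (auto simp: indicator_def intro!: tendsto_mult lim)
  show "AE x in gasket_measure. norm (indicator gasket x *\<^sub>R (u k x * v k x)) \<le> M * M" for k
  proof (rule AE_I2)
    fix x
    show "norm (indicator gasket x *\<^sub>R (u k x * v k x)) \<le> M * M"
    proof (cases "x \<in> gasket")
      case True
      have "0 \<le> M" using bd(1)[OF True, of k] abs_ge_zero[of "u k x"] by linarith
      then have "\<bar>u k x\<bar> * \<bar>v k x\<bar> \<le> M * M" using bd[OF True, of k] by (intro mult_mono) auto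
      then show ?thesis using True by (simp add: abs_mult)
    qed simp
  qed
qed

section \<open>Oscillation and Poincare estimates\<close>

context resistances
begin

text \<open>
  Passing from the first corner of a cell to the first corner of a subcell moves along at most one edge at the
  first vertex of a triangle of the next level, with conductance $b$. The letters of $v$ are
  the address of $x$ in the cell.
\<close>

lemma osc_chain:
  assumes "\<And>k. cell_energy n k w u \<le> e" and "x \<in> gasket"
  shows "\<exists>v\<in>words k. x \<in> cell v \<and>
     \<bar>u (corner (w @ v) 1) - u (corner w 1)\<bar>
       \<le> (\<Sum>j<k. sqrt (e / cond_b (n + 1 + j)))"
  using assms
proof (induction k arbitrary: n w x)
  case 0
  then show ?case by simp
next
  case (Suc k)
  obtain i y where iy: "i \<in> letters" "y \<in> gasket" "x = gasket_map i y"
    using Suc.prems(2) gasket_props(3) hutchinson_iff by metis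
  have e0: "0 \<le> e" using Suc.prems(1)[of 0] cell_energy_nonneg[of n 0 w u] by linarith
  have child: "cell_energy (Suc n) k' (w @ [i]) u \<le> e" if "i \<in> letters" for i k'
  proof -
    have "cell_energy (Suc n) k' (w @ [i]) u \<le> cell_energy n (Suc k') w u"
      unfolding cell_energy_Suc[of n] using cell_energy_nonneg[of "Suc n" k' _ u] that
      by (auto intro: add_increasing add_increasing2)
    then show ?thesis using Suc.prems(1)[of "Suc k'"] by linarith
  qed
  obtain v where v: "v \<in> words k" "y \<in> cell v"
    "\<bar>u (corner ((w @ [i]) @ v) 1) - u (corner (w @ [i]) 1)\<bar>
       \<le> (\<Sum>j<k. sqrt (e / cond_b (Suc n + 1 + j)))"
    using Suc.IH[OF child[OF iy(1)] iy(2)] by blast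
  have step: "\<bar>u (corner (w @ [i]) 1) - u (corner w 1)\<bar> \<le> sqrt (e / cond_b (n + 1))"
  proof -
    have "cond_b (n + 1) * (u (corner w 1) - u (corner (w @ [i]) 1))\<^sup>2
        \<le> cell_tri (n + 1) (w @ [1]) u"
    proof -
      have "i = 1 \<or> i = 2 \<or> i = 3" using iy(1) by simp
      then show ?thesis unfolding cell_tri_def word_map_vertex word_map_midpoint[of w 1]
        using tri_edge[of "n + 1"] tri_nonneg[of "n + 1"] word_map_vertex[of w 1] by auto
    qed
    also have "\<dots> \<le> e" using child[of 1 0] by (simp add: cell_energy_def)
    finally have "(u (corner (w @ [i]) 1) - u (corner w 1))\<^sup>2 \<le> e / cond_b (n + 1)"
      using a_b_seq(3)[of "n + 1"] by (simp add: field_simps power2_commute)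
    then show ?thesis by (rule real_le_rsqrt[of "\<bar>_\<bar>", simplified])
  qed
  have "\<bar>u (corner (w @ i # v) 1) - u (corner w 1)\<bar>
     \<le> sqrt (e / cond_b (n + 1)) + (\<Sum>j<k. sqrt (e / cond_b (Suc n + 1 + j)))"
    using v(3) step by simp
  also have "\<dots> = (\<Sum>j<Suc k. sqrt (e / cond_b (n + 1 + j)))"
    by (subst sum.lessThan_Suc_shift) simp
  finally have "\<bar>u (corner (w @ i # v) 1) - u (corner w 1)\<bar>
     \<le> (\<Sum>j<Suc k. sqrt (e / cond_b (n + 1 + j)))" .
  moreover have "i # v \<in> words (Suc k)" using iy v by (simp add: words_def)
  moreover have "x \<in> cell (i # v)" using v(2) iy(3) by auto
  ultimately show ?case by blast
qed

text \<open>
  The bound of the previous lemma is a geometric series with ratio $\sqrt{2/3}$; the corners of the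
  shrinking cells converge to the point, and $u$ is continuous.
\<close>

lemma oscillation:
  obtains C where "C > 0" "\<And>n w u e x. \<lbrakk>u \<in> gasket_functions; set w \<subseteq> letters; \<And>k. cell_energy n k w u \<le> e; x \<in> gasket\<rbrakk>
     \<Longrightarrow> (u (gasket_word_map w x) - u (corner w 1))\<^sup>2 \<le> C * (2 / 3) ^ n * e"
proof -
  obtain c C' where c: "0 < c" "0 < C'" "\<And>n. c * (3 / 2) ^ n \<le> cond_b n" "\<And>n. cond_b n \<le> C' * (3 / 2) ^ n"
    using b_seq_bounds by blast
  define t where "t = sqrt (2 / 3 :: real)"
  have t: "0 < t" "t < 1" "t\<^sup>2 = 2 / 3" by (auto simp: t_def)
  define D where "D = 1 / (sqrt c * (1 - t))"
  have D: "D > 0" using c t by (simp add: D_def)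
  show ?thesis
  proof
    show "D\<^sup>2 > 0" using D by simp
    fix n w u e x
    assume u: "u \<in> gasket_functions" and w: "set w \<subseteq> letters" and e: "\<And>k. cell_energy n k w u \<le> e" and x: "x \<in> gasket"
    have e0: "0 \<le> e" using e[of 0] cell_energy_nonneg[of n 0 w u] by linarith
    have edge: "sqrt (e / cond_b (n + 1 + j)) \<le> sqrt e / sqrt c * t ^ (n + j)" for j
    proof -
      have "e / cond_b (n + 1 + j) \<le> e / (c * (3 / 2) ^ (n + 1 + j))"
        by (intro divide_left_mono mult_pos_pos a_b_seq(3) c(3) zero_less_power) (use c e0 in auto)
      also have "\<dots> = e / c * (2 / 3) ^ (n + 1 + j)" by (simp add: power_divide field_simps)
      also have "\<dots> \<le> e / c * (2 / 3) ^ (n + j)" using c e0 by (intro mult_left_mono power_decreasing) auto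
      finally have "sqrt (e / cond_b (n + 1 + j)) \<le> sqrt (e / c * (2 / 3) ^ (n + j))" by simp
      also have "\<dots> = sqrt e / sqrt c * t ^ (n + j)" by (simp add: real_sqrt_mult real_sqrt_divide real_sqrt_power t_def)
      finally show ?thesis .
    qed
    have sum: "(\<Sum>j<k. sqrt (e / cond_b (n + 1 + j))) \<le> D * t ^ n * sqrt e" for k
    proof -
      have "(\<Sum>j<k. sqrt (e / cond_b (n + 1 + j))) \<le> (\<Sum>j<k. sqrt e / sqrt c * t ^ n * t ^ j)"
        using edge by (intro sum_mono) (simp add: power_add mult.assoc)
      also have "\<dots> = sqrt e / sqrt c * t ^ n * (\<Sum>j<k. t ^ j)" by (simp add: sum_distrib_left)
      also have "\<dots> \<le> sqrt e / sqrt c * t ^ n * (1 / (1 - t))"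
      proof (intro mult_left_mono)
        have "(\<Sum>j<k. t ^ j) \<le> (\<Sum>j. t ^ j)" using t by (intro sum_le_suminf summable_geometric) auto
        also have "\<dots> = 1 / (1 - t)" using t by (intro suminf_geometric) auto
        finally show "(\<Sum>j<k. t ^ j) \<le> 1 / (1 - t)" .
      qed (use e0 c t in auto)
      finally show ?thesis by (simp add: D_def field_simps)
    qed
    define p where "p = corner w 1"
    have "\<exists>v. v \<in> words k \<and> x \<in> cell v \<and>
        \<bar>u (corner (w @ v) 1) - u p\<bar> \<le> D * t ^ n * sqrt e" for k
      using osc_chain[OF e x, of k] sum[of k] unfolding p_def by (meson order_trans)
    then have "\<exists>v. \<forall>k. v k \<in> words k \<and> x \<in> cell (v k) \<and>
        \<bar>u (corner (w @ v k) 1) - u p\<bar> \<le> D * t ^ n * sqrt e"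
      by (intro choice allI)
    then obtain v where v: "\<And>k. v k \<in> words k" "\<And>k. x \<in> cell (v k)"
       "\<And>k. \<bar>u (corner (w @ v k) 1) - u p\<bar> \<le> D * t ^ n * sqrt e" by blast
    define z where "z k = corner (w @ v k) 1" for k
    have wn: "w \<in> words (length w)" using w by (simp add: words_def)
    have v1: "gasket_vertex 1 \<in> gasket" by (rule vertex_in_gasket) simp
    have zK: "z k \<in> gasket" for k
      unfolding z_def using append_words[OF wn v(1)] v1 by (intro word_map_gasket)
    have "z \<longlonglongrightarrow> gasket_word_map w x"
    proof (rule metric_LIMSEQ_I)
      fix r :: real assume r: "0 < r"
      obtain N where N: "2 / r < 2 ^ N" using real_arch_pow[of 2 "2 / r"] by auto
      show "\<exists>no. \<forall>k\<ge>no. dist (z k) (gasket_word_map w x) < r"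
      proof (intro exI allI impI)
        fix k assume k: "N \<le> k"
        obtain y where y: "y \<in> gasket" "x = gasket_word_map (v k) y" using v(2)[of k] by blast
        have "dist (z k) (gasket_word_map w x) = dist (gasket_vertex 1) y / 2 ^ length (w @ v k)"
          unfolding z_def y(2) using dist_gasket_word_map[of "w @ v k" "gasket_vertex 1" y]
          by (simp only: gasket_word_map_append comp_apply)
        also have "\<dots> \<le> 2 / 2 ^ k"
        proof (rule frac_le)
          show "dist (gasket_vertex 1) y \<le> 2" using v1 y(1) by (rule dist_gasket)
          show "(2::real) ^ k \<le> 2 ^ length (w @ v k)" using length_words[OF v(1)[of k]] by (intro power_increasing) auto
        qed auto
        also have "\<dots> \<le> 2 / 2 ^ N" using k by (intro divide_left_mono power_increasing) auto
        also have "\<dots> < r" using N r by (simp add: field_simps)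
        finally show "dist (z k) (gasket_word_map w x) < r" .
      qed
    qed
    moreover have "gasket_word_map w x \<in> gasket" using x wn by (rule word_map_gasket)
    ultimately have "(\<lambda>k. u (z k)) \<longlonglongrightarrow> u (gasket_word_map w x)"
      using gasket_functions_cont[OF u] zK by (auto simp: continuous_on_sequentially comp_def)
    then have "(\<lambda>k. \<bar>u (z k) - u p\<bar>) \<longlonglongrightarrow> \<bar>u (gasket_word_map w x) - u p\<bar>" by (intro tendsto_intros)
    then have le: "\<bar>u (gasket_word_map w x) - u p\<bar> \<le> D * t ^ n * sqrt e"
      by (rule LIMSEQ_le_const2) (use v(3) in \<open>auto simp: z_def\<close>)
    have "(u (gasket_word_map w x) - u p)\<^sup>2 \<le> (D * t ^ n * sqrt e)\<^sup>2"
      using power_mono[OF le abs_ge_zero, of 2] by (simp only: power2_abs)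
    also have "\<dots> = D\<^sup>2 * (2 / 3) ^ n * e"
    proof -
      have "(t ^ n)\<^sup>2 = (t\<^sup>2) ^ n" by (simp only: power_mult[symmetric] mult.commute)
      then show ?thesis using e0 t(3) by (simp add: power_mult_distrib)
    qed
    finally show "(u (gasket_word_map w x) - u (corner w 1))\<^sup>2 \<le> D\<^sup>2 * (2 / 3) ^ n * e"
      by (simp add: p_def)
  qed
qed

text \<open>
  A constant of the preceding estimate, fixed so that later statements can share it.
\<close>

definition Cosc :: real where
  "Cosc = (SOME C. C > 0 \<and> (\<forall>n w u e x. u \<in> gasket_functions \<longrightarrow> set w \<subseteq> letters \<longrightarrow> (\<forall>k. cell_energy n k w u \<le> e) \<longrightarrow> x \<in> gasket \<longrightarrow>
     (u (gasket_word_map w x) - u (corner w 1))\<^sup>2 \<le> C * (2 / 3) ^ n * e))"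

lemma Cosc: "Cosc > 0"
  "\<lbrakk>u \<in> gasket_functions; set w \<subseteq> letters; \<And>k. cell_energy n k w u \<le> e; x \<in> gasket\<rbrakk>
     \<Longrightarrow> (u (gasket_word_map w x) - u (corner w 1))\<^sup>2 \<le> Cosc * (2 / 3) ^ n * e"
proof -
  have "\<exists>C. C > 0 \<and> (\<forall>n w u e x. u \<in> gasket_functions \<longrightarrow> set w \<subseteq> letters \<longrightarrow> (\<forall>k. cell_energy n k w u \<le> e) \<longrightarrow> x \<in> gasket \<longrightarrow>
     (u (gasket_word_map w x) - u (corner w 1))\<^sup>2 \<le> C * (2 / 3) ^ n * e)"
    using oscillation by metis
  from someI_ex[OF this] show "Cosc > 0"
    "\<lbrakk>u \<in> gasket_functions; set w \<subseteq> letters; \<And>k. cell_energy n k w u \<le> e; x \<in> gasket\<rbrakk>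
     \<Longrightarrow> (u (gasket_word_map w x) - u (corner w 1))\<^sup>2 \<le> Cosc * (2 / 3) ^ n * e"
    unfolding Cosc_def by blast+
qed

lemma cell_energy_le_En:
  assumes "finite_energy u" "w \<in> words n"
  shows "cell_energy n k w u \<le> En u"
proof -
  have "cell_energy n k w u \<le> (\<Sum>w\<in>words n. cell_energy n k w u)"
    using assms(2) by (intro member_le_sum cell_energy_nonneg) auto
  also have "\<dots> = energy_n a0 b0 (n + k) u" by (simp add: energy_n_cells)
  also have "\<dots> \<le> En u" by (rule energy_lim(2)[OF assms(1)])
  finally show ?thesis .
qed

lemma osc_En:
  assumes "u \<in> gasket_functions" "finite_energy u" "w \<in> words n" "x \<in> gasket"
  shows "(u (gasket_word_map w x) - u (corner w 1))\<^sup>2 \<le> Cosc * (2 / 3) ^ n * En u"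
  using assms by (intro Cosc cell_energy_le_En) (auto simp: words_def)

text \<open>
  On a cell $u^2$ is at most the squared oscillation, which is controlled by the part of the energy
  living on that cell; summing over cells, the parts add up to the whole energy.
\<close>

lemma poincare:
  assumes u: "u \<in> gasket_functions" "finite_energy u"
    and 0: "\<And>w. w \<in> words n \<Longrightarrow> u (corner w 1) = 0"
  shows "ip u u \<le> Cosc * (2 / 9) ^ n * En u"
proof -
  have "\<exists>l. (\<lambda>k. cell_energy n k w u) \<longlonglongrightarrow> l \<and> (\<forall>k. cell_energy n k w u \<le> l)" if "w \<in> words n" for w
    using incseq_convergent[of "\<lambda>k. cell_energy n k w u" "En u"] cell_energy_le_En[OF u(2) that]
      cell_energy_mono[of n _ w u] by (metis incseq_SucI)
  then obtain ce where ce: "\<And>w. w \<in> words n \<Longrightarrow> (\<lambda>k. cell_energy n k w u) \<longlonglongrightarrow> ce w"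
    "\<And>w k. w \<in> words n \<Longrightarrow> cell_energy n k w u \<le> ce w" by metis
  have ce0: "0 \<le> ce w" if "w \<in> words n" for w using ce(2)[OF that, of 0] cell_energy_nonneg[of n 0 w u] by linarith
  have "(\<lambda>k. \<Sum>w\<in>words n. cell_energy n k w u) \<longlonglongrightarrow> (\<Sum>w\<in>words n. ce w)"
    by (intro tendsto_sum ce)
  moreover have "(\<lambda>k. \<Sum>w\<in>words n. cell_energy n k w u) \<longlonglongrightarrow> En u"
    using LIMSEQ_ignore_initial_segment[OF energy_lim(1)[OF u(2)], of n]
    by (simp add: energy_n_cells[symmetric] add.commute)
  ultimately have sum_ce: "(\<Sum>w\<in>words n. ce w) = En u" by (rule LIMSEQ_unique)
  define g where "g x = (\<Sum>w\<in>words n. indicator (cell w) x * (Cosc * (2 / 3) ^ n * ce w))" for x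
  have bound: "u x * u x \<le> g x" if "x \<in> gasket" for x
  proof -
    obtain w y where w: "w \<in> words n" "y \<in> gasket" "x = gasket_word_map w y"
      using gasket_cells[of n] \<open>x \<in> gasket\<close> by blast
    have "(u x)\<^sup>2 \<le> Cosc * (2 / 3) ^ n * ce w"
      using Cosc(2)[OF u(1) _ ce(2)[OF w(1)] w(2)] w 0[OF w(1)] by (simp add: words_def)
    also have "\<dots> = indicator (cell w) x * (Cosc * (2 / 3) ^ n * ce w)"
      using w by (simp add: indicator_def)
    also have "\<dots> \<le> g x" unfolding g_def using w(1) Cosc(1) ce0
      by (intro member_le_sum mult_nonneg_nonneg) auto
    finally show ?thesis by (simp add: power2_eq_square)
  qed
  have gi: "integrable gasket_measure g" unfolding g_def
    by (intro Bochner_Integration.integrable_sum integrable_mult_left integrable_real_indicator)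
      (auto simp: emeasure_cell less_top)
  have "ip u u \<le> integral\<^sup>L gasket_measure g" unfolding ip_def set_lebesgue_integral_def
  proof (rule integral_mono)
    show "integrable gasket_measure (\<lambda>x. indicator gasket x *\<^sub>R (u x * u x))"
      using set_integrable_gasket[of "\<lambda>x. u x * u x"] gasket_functions_cont[OF u(1)]
      by (auto simp: set_integrable_def intro!: continuous_intros)
    show "indicator gasket x *\<^sub>R (u x * u x) \<le> g x" for x
      using bound[of x] Cosc(1) ce0 by (auto simp: indicator_def g_def intro!: sum_nonneg)
  qed (rule gi)
  also have "\<dots> = (\<Sum>w\<in>words n. 1 / 3 ^ n * (Cosc * (2 / 3) ^ n * ce w))"
    unfolding g_def
    by (subst Bochner_Integration.integral_sum)
      (auto simp: emeasure_cell less_top measure_cell intro!: integrable_mult_left integrable_real_indicator sum.cong)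
  also have "\<dots> = 1 / 3 ^ n * (Cosc * (2 / 3) ^ n) * (\<Sum>w\<in>words n. ce w)"
    by (simp add: sum_distrib_left mult.assoc)
  also have "\<dots> = Cosc * (2 / 9) ^ n * En u"
  proof -
    have "(2 / 9 :: real) ^ n = 1 / 3 ^ n * (2 / 3) ^ n" by (simp add: power_mult_distrib[symmetric] flip: power_one_over)
    then show ?thesis unfolding sum_ce by simp
  qed
  finally show ?thesis .
qed

section \<open>Compactness\<close>

definition F0 :: "(complex \<Rightarrow> real) set" where "F0 = form_domain0 a0 b0"

lemma F0_iff: "u \<in> F0 \<longleftrightarrow> u \<in> gasket_functions \<and> finite_energy u \<and> (\<forall>x\<in>gasket_boundary. u x = 0)"
  by (auto simp: F0_def form_domain0_def form_domain_iff)

lemma F0D: "u \<in> F0 \<Longrightarrow> u \<in> gasket_functions" "u \<in> F0 \<Longrightarrow> finite_energy u"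
  by (auto simp: F0_iff)

lemma F0_sup:
  assumes "u \<in> F0" "x \<in> gasket"
  shows "(u x)\<^sup>2 \<le> Cosc * En u"
proof -
  have "u (gasket_vertex 1) = 0" using assms by (auto simp: F0_iff gasket_boundary_def)
  then show ?thesis using osc_En[of u "[]" 0 x] assms by (auto simp: F0_iff)
qed

lemma F0_zero: assumes "u \<in> F0" "En u \<le> 0" shows "u = 0"
proof
  fix x
  show "u x = 0 x"
  proof (cases "x \<in> gasket")
    case True
    have "Cosc * En u \<le> 0" using Cosc(1) assms(2) by (simp add: mult_le_0_iff)
    then have "(u x)\<^sup>2 \<le> 0" using F0_sup[OF assms(1) True] by linarith
    then show ?thesis by simp
  next
    case False then show ?thesis using F0D(1)[OF assms(1)] by (simp add: gasket_functions_def)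
  qed
qed

text \<open>
  Functions of bounded energy are, uniformly up to a small oscillation, determined by their values at the first
  corners of the cells of one level. Convergence at these countably many corners, which a diagonal sequence
  achieves, thus yields uniform convergence. The energy is lower semicontinuous because each discrete
  energy is continuous and below the full one.
\<close>

lemma F0_compact:
  assumes u: "\<And>k. u k \<in> F0" "\<And>k. En (u k) \<le> R" and J: "(\<lambda>k. En (u k)) \<longlonglongrightarrow> J"
  obtains r v M where "strict_mono (r :: nat \<Rightarrow> nat)" "v \<in> F0" "En v \<le> J"
    "\<And>x. x \<in> gasket \<Longrightarrow> (\<lambda>k. u (r k) x) \<longlonglongrightarrow> v x" "\<And>k x. x \<in> gasket \<Longrightarrow> \<bar>u k x\<bar> \<le> M"
proof -
  have R: "0 \<le> R" using u(2)[of 0] En_nonneg[OF F0D(2)[OF u(1)], of 0] by linarith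
  define M where "M = sqrt (Cosc * R)"
  have bd: "\<bar>u k x\<bar> \<le> M" if "x \<in> gasket" for k x
  proof -
    have "(u k x)\<^sup>2 \<le> Cosc * En (u k)" by (rule F0_sup[OF u(1) that])
    also have "\<dots> \<le> Cosc * R" using Cosc(1) u(2) by (intro mult_left_mono) auto
    finally show ?thesis unfolding M_def by (metis real_sqrt_abs real_sqrt_le_iff)
  qed
  define S where "S = (\<Union>n. (\<lambda>w. corner w 1) ` words n)"
  have v1: "gasket_vertex 1 \<in> gasket" by (rule vertex_in_gasket) simp
  have SK: "S \<subseteq> gasket" unfolding S_def using word_map_gasket[OF v1] by auto
  have "countable S" unfolding S_def by (intro countable_UN) (auto intro!: countable_finite)
  then obtain r where r: "strict_mono (r :: nat \<Rightarrow> nat)" "\<And>x. x \<in> S \<Longrightarrow> \<exists>l. (\<lambda>k. u (r k) x) \<longlonglongrightarrow> l"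
    by (rule function_convergent_subsequence[where f = u and M = M]) (use bd SK in auto)
  have "uniformly_Cauchy_on gasket (\<lambda>k. u (r k))"
  proof (rule uniformly_Cauchy_onI)
    fix e :: real assume e: "0 < e"
    define d where "d = (e / 4)\<^sup>2"
    have d: "d > 0" using e by (simp add: d_def)
    obtain n where n: "Cosc * (2 / 3) ^ n * R < d"
    proof -
      have p: "Cosc * R + 1 > 0" using Cosc(1) R by (simp add: add_nonneg_pos)
      then have "d / (Cosc * R + 1) > 0" "(2 / 3 :: real) < 1" using d by auto
      from real_arch_pow_inv[OF this] obtain n where "(2 / 3 :: real) ^ n < d / (Cosc * R + 1)" ..
      then have "(Cosc * R + 1) * (2 / 3) ^ n < d" using p by (simp only: pos_less_divide_eq mult.commute)
      moreover have "Cosc * (2 / 3) ^ n * R \<le> (Cosc * R + 1) * (2 / 3) ^ n" by (simp add: algebra_simps)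
      ultimately show ?thesis by (intro that[of n]) linarith
    qed
    have osc: "\<bar>u k (gasket_word_map w y) - u k (corner w 1)\<bar> \<le> e / 4"
      if "w \<in> words n" "y \<in> gasket" for k w y
    proof -
      have "(u k (gasket_word_map w y) - u k (corner w 1))\<^sup>2 \<le> Cosc * (2 / 3) ^ n * En (u k)"
        using osc_En[OF F0D(1)[OF u(1)] F0D(2)[OF u(1)] that] .
      also have "\<dots> \<le> Cosc * (2 / 3) ^ n * R" using Cosc(1) u(2) by (intro mult_left_mono) auto
      finally have "(u k (gasket_word_map w y) - u k (corner w 1))\<^sup>2 \<le> (e / 4)\<^sup>2" using n d_def by linarith
      then show ?thesis using e by (simp add: abs_le_square_iff[symmetric])
    qed
    have "\<exists>N. \<forall>j\<ge>N. \<forall>k\<ge>N. \<bar>u (r j) (corner w 1) - u (r k) (corner w 1)\<bar> < e / 4"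
      if "w \<in> words n" for w
    proof -
      have "corner w 1 \<in> S" using that by (auto simp: S_def)
      then have "Cauchy (\<lambda>k. u (r k) (corner w 1))"
        using r(2) LIMSEQ_imp_Cauchy by blast
      then show ?thesis using e unfolding Cauchy_def dist_real_def by (meson divide_pos_pos zero_less_numeral)
    qed
    then obtain N where N: "\<And>w j k. w \<in> words n \<Longrightarrow> N w \<le> j \<Longrightarrow> N w \<le> k \<Longrightarrow>
        \<bar>u (r j) (corner w 1) - u (r k) (corner w 1)\<bar> < e / 4"
      by metis
    define L where "L = Max (N ` words n)"
    show "\<exists>L. \<forall>x\<in>gasket. \<forall>j\<ge>L. \<forall>k\<ge>L. dist (u (r j) x) (u (r k) x) < e"
    proof (intro exI ballI allI impI)
      fix x j k assume x: "x \<in> gasket" and jk: "L \<le> j" "L \<le> k"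
      obtain w y where w: "w \<in> words n" "y \<in> gasket" "x = gasket_word_map w y"
        using gasket_cells[of n] x by blast
      have "N w \<le> L" using w(1) by (auto simp: L_def)
      then have "\<bar>u (r j) (corner w 1) - u (r k) (corner w 1)\<bar> < e / 4"
        using N[OF w(1)] jk by simp
      then show "dist (u (r j) x) (u (r k) x) < e"
        using osc[OF w(1,2), of "r j"] osc[OF w(1,2), of "r k"] unfolding w(3) dist_real_def by linarith
    qed
  qed
  then obtain l where l: "uniform_limit gasket (\<lambda>k. u (r k)) l sequentially"
    using Cauchy_uniformly_convergent uniformly_convergent_on_def by blast
  define v where "v x = (if x \<in> gasket then l x else 0)" for x
  have lim: "(\<lambda>k. u (r k) x) \<longlonglongrightarrow> v x" if "x \<in> gasket" for x
    using tendsto_uniform_limitI[OF l that] that by (simp add: v_def)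
  have "continuous_on gasket l"
    by (rule uniform_limit_theorem[OF _ l]) (auto intro!: always_eventually gasket_functions_cont F0D u)
  then have "continuous_on gasket v" by (rule continuous_on_eq) (simp add: v_def)
  then have vg: "v \<in> gasket_functions" by (simp add: gasket_functions_def v_def)
  have bdK: "x \<in> gasket" if "x \<in> gasket_boundary" for x
    using that by (auto simp: gasket_boundary_def intro!: vertex_in_gasket)
  have v0: "v x = 0" if "x \<in> gasket_boundary" for x
  proof (rule LIMSEQ_unique[OF lim[OF bdK[OF that]]])
    have "u (r k) x = 0" for k using u(1) that by (simp add: F0_iff)
    then show "(\<lambda>k. u (r k) x) \<longlonglongrightarrow> 0" by simp
  qed
  have "energy_n a0 b0 n v \<le> J" for n
  proof (rule LIMSEQ_le)
    have "(\<lambda>k. u (r k) (corner w i)) \<longlonglongrightarrow> v (corner w i)"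
      if "w \<in> words n" "i \<in> letters" for w i
      using that by (intro lim word_map_gasket vertex_in_gasket)
    then show "(\<lambda>k. energy_n a0 b0 n (u (r k))) \<longlonglongrightarrow> energy_n a0 b0 n v"
      unfolding energy_n_eq cell_tri_def tri_def by (intro tendsto_intros) auto
    show "(\<lambda>k. En (u (r k))) \<longlonglongrightarrow> J" using LIMSEQ_subseq_LIMSEQ[OF J r(1)] by (simp add: comp_def)
    show "\<exists>N. \<forall>k\<ge>N. energy_n a0 b0 n (u (r k)) \<le> En (u (r k))"
      using energy_lim(2)[OF F0D(2)[OF u(1)]] by blast
  qed
  then have "finite_energy v" "En v \<le> J" using En_le by blast+
  then show ?thesis using that[OF r(1), of v M] vg v0 lim bd by (auto simp: F0_iff)
qed

end

section \<open>Test functions\<close>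

text \<open>
  Iterates of the operator whose fixed point is the distribution function of a sequence of
  independent binary digits that are $0$ with probability $2/3$; the arguments are clamped to the unit interval.
\<close>

fun cdf_iter :: "nat \<Rightarrow> real \<Rightarrow> real" where
  "cdf_iter 0 h = h"
| "cdf_iter (Suc n) h = 2 / 3 * cdf_iter n (min 1 (2 * h)) + 1 / 3 * cdf_iter n (max 0 (2 * h - 1))"

lemma cdf_iter_ends: "cdf_iter n 0 = 0" "cdf_iter n 1 = 1"
  by (induction n) auto

lemma cdf_iter_left: "0 \<le> h \<Longrightarrow> h \<le> 1 \<Longrightarrow> cdf_iter (Suc n) (h / 2) = 2 / 3 * cdf_iter n h"
  by (simp add: cdf_iter_ends max_def)

lemma cdf_iter_right: "0 \<le> h \<Longrightarrow> h \<le> 1 \<Longrightarrow> cdf_iter (Suc n) ((1 + h) / 2) = 2 / 3 + cdf_iter n h / 3"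
  by (simp add: cdf_iter_ends min_def add_divide_distrib)

lemma unit_interval_half_cases:
  assumes "0 \<le> h" "h \<le> (1::real)"
  obtains h' where "0 \<le> h'" "h' \<le> 1" "h = h' / 2" | h' where "0 \<le> h'" "h' \<le> 1" "h = (1 + h') / 2"
proof (cases "h \<le> 1 / 2")
  case True then show ?thesis using assms by (intro that(1)[of "2 * h"]) auto
next
  case False then show ?thesis using assms by (intro that(2)[of "2 * h - 1"]) auto
qed

lemma cdf_iter_nonneg: "0 \<le> h \<Longrightarrow> h \<le> 1 \<Longrightarrow> 0 \<le> cdf_iter n h"
proof (induction n arbitrary: h)
  case (Suc n)
  from Suc.prems show ?case
    by (cases rule: unit_interval_half_cases) (use Suc.IH cdf_iter_left cdf_iter_right in auto)
qed simp

text \<open>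
  The operator contracts by the factor $2/3$, since at each point one of its two terms is constant.
\<close>

lemma cdf_iter_diff: "0 \<le> h \<Longrightarrow> h \<le> 1 \<Longrightarrow> \<bar>cdf_iter (Suc n) h - cdf_iter n h\<bar> \<le> (2 / 3) ^ n"
proof (induction n arbitrary: h)
  case 0
  then show ?case by (auto simp: min_def max_def abs_le_iff field_simps)
next
  case (Suc n)
  from Suc.prems show ?case
  proof (cases rule: unit_interval_half_cases)
    case (1 h')
    have "cdf_iter (Suc (Suc n)) h - cdf_iter (Suc n) h = 2 / 3 * (cdf_iter (Suc n) h' - cdf_iter n h')"
      unfolding 1(3) cdf_iter_left[OF 1(1,2)] by (simp only: right_diff_distrib)
    then have "\<bar>cdf_iter (Suc (Suc n)) h - cdf_iter (Suc n) h\<bar> = 2 / 3 * \<bar>cdf_iter (Suc n) h' - cdf_iter n h'\<bar>"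
      by (simp only: abs_mult abs_divide abs_numeral)
    then show ?thesis using Suc.IH[OF 1(1,2)] by simp
  next
    case (2 h')
    have "cdf_iter (Suc (Suc n)) h - cdf_iter (Suc n) h = (cdf_iter (Suc n) h' - cdf_iter n h') / 3"
      unfolding 2(3) cdf_iter_right[OF 2(1,2)] by (simp only: diff_divide_distrib)
    then have eq: "\<bar>cdf_iter (Suc (Suc n)) h - cdf_iter (Suc n) h\<bar> = \<bar>cdf_iter (Suc n) h' - cdf_iter n h'\<bar> / 3"
      by (simp only: abs_divide abs_numeral)
    have third: "X / 3 \<le> 2 / 3 * p" if "X \<le> p" "0 \<le> X" for X p :: real using that by linarith
    show ?thesis unfolding eq power_Suc by (rule third[OF Suc.IH[OF 2(1,2)] abs_ge_zero])
  qed
qed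

lemma cdf_iter_cont: "continuous_on UNIV (cdf_iter n)"
proof (induction n)
  case (Suc n)
  have "continuous_on UNIV (\<lambda>h. cdf_iter n (min 1 (2 * h)))" "continuous_on UNIV (\<lambda>h. cdf_iter n (max 0 (2 * h - 1)))"
    by (rule continuous_on_compose2[OF Suc]; auto intro!: continuous_intros)+
  then show ?case by (simp only: cdf_iter.simps(2)[abs_def]) (intro continuous_intros)
qed (simp add: continuous_on_id)

lemma bernoulli_cdf_exists:
  obtains f :: "real \<Rightarrow> real" where "continuous_on {0..1} f" "f 0 = 0" "f 1 = 1"
    "\<And>h. 0 \<le> h \<Longrightarrow> h \<le> 1 \<Longrightarrow> f (h / 2) = 2 / 3 * f h"
    "\<And>h. 0 \<le> h \<Longrightarrow> h \<le> 1 \<Longrightarrow> f ((1 + h) / 2) = 2 / 3 + f h / 3"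
    "\<And>h. 0 \<le> h \<Longrightarrow> h \<le> 1 \<Longrightarrow> 0 \<le> f h"
proof -
  define d where "d n h = cdf_iter (Suc n) h - cdf_iter n h" for n h
  have ul: "uniform_limit {0..1} (\<lambda>n h. \<Sum>i<n. d i h) (\<lambda>h. \<Sum>i. d i h) sequentially"
    by (rule Weierstrass_m_test[of _ _ "\<lambda>n. (2 / 3) ^ n"])
      (use cdf_iter_diff in \<open>auto simp: d_def summable_geometric simp del: cdf_iter.simps\<close>)
  define f where "f h = h + (\<Sum>i. d i h)" for h
  have tele: "(\<Sum>i<n. d i h) = cdf_iter n h - h" for n h
    unfolding d_def by (subst sum_lessThan_telescope) simp
  have lim: "(\<lambda>n. cdf_iter n h) \<longlonglongrightarrow> f h" if "0 \<le> h" "h \<le> 1" for h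
  proof -
    have "(\<lambda>n. \<Sum>i<n. d i h) \<longlonglongrightarrow> (\<Sum>i. d i h)" using that by (intro tendsto_uniform_limitI[OF ul]) auto
    then have "(\<lambda>n. h + (cdf_iter n h - h)) \<longlonglongrightarrow> h + (\<Sum>i. d i h)" unfolding tele by (intro tendsto_intros)
    then show ?thesis by (simp add: f_def)
  qed
  show ?thesis
  proof (rule that[of f])
    have "continuous_on {0..1} (\<lambda>h. \<Sum>i. d i h)"
    proof (rule uniform_limit_theorem[OF _ ul])
      show "\<forall>\<^sub>F n in sequentially. continuous_on {0..1} (\<lambda>h. \<Sum>i<n. d i h)"
        unfolding tele by (intro always_eventually allI continuous_intros continuous_on_subset[OF cdf_iter_cont]) auto
    qed simp
    then show "continuous_on {0..1} f" unfolding f_def by (intro continuous_intros)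
    show "f 0 = 0" "f 1 = 1" using lim[of 0] lim[of 1] by (simp_all add: cdf_iter_ends LIMSEQ_const_iff)
    fix h :: real assume h: "0 \<le> h" "h \<le> 1"
    show "0 \<le> f h" using cdf_iter_nonneg[OF h] by (intro LIMSEQ_le_const[OF lim[OF h]]) auto
    have "(\<lambda>n. cdf_iter (Suc n) (h / 2)) \<longlonglongrightarrow> f (h / 2)"
      by (rule LIMSEQ_Suc[OF lim]) (use h in auto)
    moreover have "(\<lambda>n. cdf_iter (Suc n) (h / 2)) \<longlonglongrightarrow> 2 / 3 * f h"
      unfolding cdf_iter_left[OF h] by (intro tendsto_intros lim h)
    ultimately show "f (h / 2) = 2 / 3 * f h" by (rule LIMSEQ_unique)
    have "(\<lambda>n. cdf_iter (Suc n) ((1 + h) / 2)) \<longlonglongrightarrow> f ((1 + h) / 2)"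
      by (rule LIMSEQ_Suc[OF lim]) (use h in auto)
    moreover have "(\<lambda>n. cdf_iter (Suc n) ((1 + h) / 2)) \<longlonglongrightarrow> 2 / 3 + f h / 3"
      unfolding cdf_iter_right[OF h] by (intro tendsto_intros lim h) simp
    ultimately show "f ((1 + h) / 2) = 2 / 3 + f h / 3" by (rule LIMSEQ_unique)
  qed
qed

lemma gasket_height: "z \<in> gasket \<Longrightarrow> 0 \<le> height z \<and> height z \<le> 1"
  using gasket_triangle[of z] by (simp add: height_def)

lemma height_word_map: "w \<in> words n \<Longrightarrow> height (gasket_word_map w z) = (real (code 2 w + code 3 w) + height z) / 2 ^ n"
  by (simp add: height_def coord_word_map add_divide_distrib)

lemma height_base: "w \<in> words n \<Longrightarrow> height (corner w 3) = height (corner w 2)"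
  by (simp add: height_word_map height_vertex)

text \<open>
  Passing to a subcell multiplies the increment by $2/3$ in one child and by $1/3$ in the two others,
  and $(2/3)^2 + 2(1/3)^2 = 2/3$ exactly balances the growth $(3/2)^n$ of the conductances.
\<close>

lemma sum_squares_cdf:
  assumes f1: "\<And>h. 0 \<le> h \<Longrightarrow> h \<le> 1 \<Longrightarrow> f (h / 2) = 2 / 3 * f h"
    and f2: "\<And>h. 0 \<le> h \<Longrightarrow> h \<le> 1 \<Longrightarrow> f ((1 + h) / 2) = 2 / 3 + f h / (3 :: real)"
    and f01: "f 0 = 0" "f 1 = 1"
  shows "(\<Sum>w\<in>words k. (f (height (corner w 2)) - f (height (corner w 1)))\<^sup>2) = (2 / 3) ^ k"
proof (induction k)
  case 0
  then show ?case by (simp add: height_vertex[unfolded One_nat_def] height_vertex f01)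
next
  case (Suc k)
  define D where "D w = f (height (corner w 2)) - f (height (corner w 1))" for w
  have K: "0 \<le> height (corner w i) \<and> height (corner w i) \<le> 1"
    if "w \<in> words k" "i \<in> letters" for w i
    using that by (intro gasket_height word_map_gasket vertex_in_gasket)
  have 1: "D (1 # w) = 2 / 3 * D w" if "w \<in> words k" for w
  proof -
    have "f (height (corner w i) / 2) = 2 / 3 * f (height (corner w i))"
      if "i \<in> letters" for i by (rule f1) (use K[OF \<open>w \<in> words k\<close> that] in auto)
    from this[of 1] this[of 2] show ?thesis by (simp add: D_def height_map)
  qed
  have 2: "D (i # w) = 1 / 3 * D w" if "w \<in> words k" "i = 2 \<or> i = 3" for w i
  proof -
    have "f ((1 + height (corner w i)) / 2) = 2 / 3 + f (height (corner w i)) / 3"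
      if "i \<in> letters" for i by (rule f2) (use K[OF \<open>w \<in> words k\<close> that] in auto)
    from this[of 1] this[of 2] show ?thesis using that(2) by (auto simp: D_def height_map add.commute[of _ 1])
  qed
  have "(\<Sum>w\<in>words (Suc k). (D w)\<^sup>2) = (\<Sum>w\<in>words k. 2 / 3 * (D w)\<^sup>2)"
    unfolding sum_words_Suc
  proof (rule sum.cong[OF refl])
    fix w assume w: "w \<in> words k"
    have "D (1 # w) = 2 / 3 * D w" "D (2 # w) = 1 / 3 * D w" "D (3 # w) = 1 / 3 * D w"
      using 1[OF w] 2[OF w] by auto
    then show "(D (1 # w))\<^sup>2 + (D (2 # w))\<^sup>2 + (D (3 # w))\<^sup>2 = 2 / 3 * (D w)\<^sup>2"
      by (simp only: power2_eq_square)
  qed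
  also have "\<dots> = 2 / 3 * (\<Sum>w\<in>words k. (D w)\<^sup>2)" by (simp add: sum_distrib_left)
  finally show ?case using Suc by (simp add: D_def)
qed

definition combine :: "(nat list \<Rightarrow> complex \<Rightarrow> real) \<Rightarrow> nat \<Rightarrow> (nat list \<Rightarrow> real) \<Rightarrow> complex \<Rightarrow> real" where
  "combine U n c x = (\<Sum>w\<in>words n. c w * U w x)"

locale bump =
  fixes f :: "real \<Rightarrow> real"
  assumes f_cont: "continuous_on {0..1} f" and f01: "f 0 = 0" "f 1 = 1"
    and f1: "\<And>h. 0 \<le> h \<Longrightarrow> h \<le> 1 \<Longrightarrow> f (h / 2) = 2 / 3 * f h"
    and f2: "\<And>h. 0 \<le> h \<Longrightarrow> h \<le> 1 \<Longrightarrow> f ((1 + h) / 2) = 2 / 3 + f h / 3"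
    and f0: "\<And>h. 0 \<le> h \<Longrightarrow> h \<le> 1 \<Longrightarrow> 0 \<le> f h"
begin

text \<open>
  Rises like $f$ from $0$ to $1$ on the first half and falls like $1-f$ on the second half.
\<close>

definition bmp :: "real \<Rightarrow> real" where
  "bmp h = f (min 1 (2 * h)) - f (max 0 (2 * h - 1))"

lemma bmp_cont: "continuous_on {0..1} bmp"
  unfolding bmp_def by (intro continuous_on_diff continuous_on_compose2[OF f_cont] continuous_intros) auto

lemma bmp_values:
  "bmp 0 = 0" "bmp 1 = 0"
  "0 \<le> h \<Longrightarrow> h \<le> 1 \<Longrightarrow> bmp (h / 2) = f h"
  "0 \<le> h \<Longrightarrow> h \<le> 1 \<Longrightarrow> bmp ((h + 1) / 2) = 1 - f h"
  by (auto simp: bmp_def f01 min_def max_def add_divide_distrib)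

definition cell_bump :: "nat list \<Rightarrow> complex \<Rightarrow> real" where
  "cell_bump w x = (if x \<in> cell w
     then bmp (2 ^ length w * height x - real (code 2 w + code 3 w)) else 0)"

lemma cell_bump_inside:
  assumes "w \<in> words n" "y \<in> gasket"
  shows "cell_bump w (gasket_word_map w y) = bmp (height y)"
  using assms height_word_map[OF assms(1), of y] by (simp add: cell_bump_def length_words)

text \<open>
  Cells meet only at points of height $0$ or $1$, where the bump vanishes; hence extending it by zero
  is consistent.
\<close>

lemma cell_bump_outside:
  assumes "v \<in> words n" "w \<in> words n" "v \<noteq> w" "y \<in> gasket"
  shows "cell_bump w (gasket_word_map v y) = 0"
proof (cases "gasket_word_map v y \<in> cell w")
  case True
  then obtain z where z: "z \<in> gasket" "gasket_word_map w z = gasket_word_map v y" by auto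
  have "height z = 0 \<or> height z = 1"
    using cells_meet_height[OF assms(2,1) _ z(1) assms(4) z(2)] assms(3) by blast
  moreover have "cell_bump w (gasket_word_map v y) = bmp (height z)"
    using cell_bump_inside[OF assms(2) z(1)] z(2) by simp
  ultimately show ?thesis using bmp_values by auto
qed (simp add: cell_bump_def)

lemma cell_bump_gasket_function:
  assumes w: "w \<in> words n"
  shows "cell_bump w \<in> gasket_functions"
proof -
  have "continuous_on (\<Union>v\<in>words n. cell v) (cell_bump w)"
  proof (rule continuous_on_closed_Union)
    fix v assume v: "v \<in> words n"
    show "closed (cell v)" by (rule compact_imp_closed[OF cell_closed])
    show "continuous_on (cell v) (cell_bump w)"
    proof (cases "v = w")
      case True
      have "continuous_on (cell w) (\<lambda>x. bmp (2 ^ length w * height x - real (code 2 w + code 3 w)))"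
      proof (rule continuous_on_compose2[OF bmp_cont])
        show "continuous_on (cell w) (\<lambda>x. 2 ^ length w * height x - real (code 2 w + code 3 w))"
          by (intro continuous_intros continuous_height)
        show "(\<lambda>x. 2 ^ length w * height x - real (code 2 w + code 3 w)) ` cell w \<subseteq> {0..1}"
          using gasket_height height_word_map[OF w] length_words[OF w] by auto
      qed
      then show ?thesis unfolding True by (rule continuous_on_eq) (simp add: cell_bump_def)
    next
      case False
      have "continuous_on (cell v) (\<lambda>_. 0 :: real)" by simp
      then show ?thesis by (rule continuous_on_eq) (use cell_bump_outside[OF v w False] in auto)
    qed
  qed simp
  moreover have "cell_bump w x = 0" if "x \<notin> gasket" for x
    using that word_map_gasket[OF _ w] by (auto simp: cell_bump_def)
  ultimately show ?thesis unfolding gasket_cells[of n, symmetric] by (simp add: gasket_functions_def)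
qed

abbreviation bumps :: "nat \<Rightarrow> (nat list \<Rightarrow> real) \<Rightarrow> complex \<Rightarrow> real" where
  "bumps \<equiv> combine cell_bump"

lemma bumps_inside:
  assumes "v \<in> words n" "y \<in> gasket"
  shows "bumps n c (gasket_word_map v y) = c v * bmp (height y)"
proof -
  have "bumps n c (gasket_word_map v y) = c v * cell_bump v (gasket_word_map v y)
      + (\<Sum>w\<in>words n - {v}. c w * cell_bump w (gasket_word_map v y))"
    using assms(1) by (simp add: combine_def sum.remove)
  also have "(\<Sum>w\<in>words n - {v}. c w * cell_bump w (gasket_word_map v y)) = 0"
    using cell_bump_outside[OF assms(1) _ _ assms(2)] by (intro sum.neutral) auto
  finally show ?thesis using cell_bump_inside[OF assms] by simp
qed

lemma bumps_gasket_function: "bumps n c \<in> gasket_functions"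
proof -
  have "continuous_on gasket (bumps n c)" unfolding combine_def[abs_def]
    by (intro continuous_on_sum continuous_on_mult continuous_on_const gasket_functions_cont cell_bump_gasket_function)
  moreover have "bumps n c x = 0" if "x \<notin> gasket" for x
    unfolding combine_def using that cell_bump_gasket_function
    by (intro sum.neutral) (auto simp: gasket_functions_def)
  ultimately show ?thesis by (simp add: gasket_functions_def)
qed

lemma bumps_boundary: "x \<in> gasket_boundary \<Longrightarrow> bumps n c x = 0"
proof -
  assume "x \<in> gasket_boundary"
  then obtain i where i: "i \<in> letters" "x = gasket_vertex i" by (auto simp: gasket_boundary_def)
  define v where "v = replicate n i"
  have fx: "corner (replicate m i) i = gasket_vertex i" for m
    by (induction m) (auto simp: gasket_map_eq)
  have v: "v \<in> words n" using i by (auto simp: v_def words_def)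
  have "bumps n c x = c v * bmp (height x)"
    using bumps_inside[OF v vertex_in_gasket[OF i(1)], of c] fx[of n] i by (simp add: v_def)
  moreover have "height x = 0 \<or> height x = 1" using i height_vertex by auto
  ultimately show ?thesis using bmp_values by auto
qed

text \<open>
  On the subcell with address $1, 2$ the bump is at least $2/3$, and these subcells of different cells are disjoint.
\<close>

lemma bumps_ip: "4 / 81 * (1 / 3) ^ n * (\<Sum>w\<in>words n. (c w)\<^sup>2) \<le> ip (bumps n c) (bumps n c)"
proof -
  define Q where "Q w = cell (w @ [1, 2])" for w
  define g where "g x = (\<Sum>w\<in>words n. indicator (Q w) x * (4 / 9 * (c w)\<^sup>2))" for x
  have wo: "w @ [1, 2] \<in> words (n + 2)" if "w \<in> words n" for w using that by (auto simp: words_def)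
  have Qx: "\<exists>y\<in>gasket. x = gasket_word_map w y \<and> 1 / 4 \<le> height y \<and> height y \<le> 1 / 2 \<and> 2 / 3 \<le> bmp (height y)"
    if xQ: "x \<in> Q w" "w \<in> words n" for x w
  proof -
    obtain z where z': "z \<in> gasket" "x = gasket_word_map (w @ [1, 2]) z"
      using xQ(1) unfolding Q_def by blast
    then have z: "z \<in> gasket" "x = gasket_word_map w (gasket_map 1 (gasket_map 2 z))"
      by (simp_all add: gasket_word_map_append)
    define y where "y = gasket_map 1 (gasket_map 2 z)"
    have y: "y \<in> gasket" using word_map_gasket[OF z(1), of "[1, 2]" 2] by (simp add: words_def y_def)
    have h: "height y = ((height z + 1) / 2) / 2" by (simp add: y_def height_map)
    have hz: "0 \<le> height z" "height z \<le> 1" using gasket_height[OF z(1)] by auto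
    have "bmp (height y) = f ((1 + height z) / 2)"
      unfolding h using hz by (subst bmp_values(3)) (auto simp: add.commute)
    also have "\<dots> \<ge> 2 / 3" using f2[OF hz] f0[OF hz] by simp
    finally show ?thesis using y z h hz by (intro bexI[of _ y]) (auto simp: y_def)
  qed
  have bound: "g x \<le> indicator gasket x *\<^sub>R (bumps n c x * bumps n c x)" for x
  proof (cases "\<exists>w\<in>words n. x \<in> Q w")
    case False
    then have "g x = 0" unfolding g_def by (intro sum.neutral) (auto simp: indicator_def)
    then show ?thesis by (simp add: indicator_def)
  next
    case True
    then obtain w where w: "w \<in> words n" "x \<in> Q w" by blast
    obtain y where y: "y \<in> gasket" "x = gasket_word_map w y" "1 / 4 \<le> height y" "height y \<le> 1 / 2" "2 / 3 \<le> bmp (height y)"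
      using Qx[OF w(2,1)] by blast
    have "x \<notin> Q v" if v: "v \<in> words n - {w}" for v
    proof
      assume "x \<in> Q v"
      then obtain z where z: "z \<in> gasket" "x = gasket_word_map v z" using Qx[of x v] v by blast
      have "height y = 0 \<or> height y = 1"
        using cells_meet_height[OF w(1) _ _ y(1) z(1)] v y(2) z(2) by auto
      then show False using y by auto
    qed
    then have "(\<Sum>v\<in>words n - {w}. indicator (Q v) x * (4 / 9 * (c v)\<^sup>2)) = 0"
      by (intro sum.neutral) (auto simp: indicator_def)
    then have "g x = 4 / 9 * (c w)\<^sup>2" unfolding g_def using w by (subst sum.remove[of _ w]) auto
    also have "\<dots> \<le> (bmp (height y))\<^sup>2 * (c w)\<^sup>2"
      using power_mono[OF y(5), of 2] by (intro mult_right_mono) (auto simp: power2_eq_square)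
    also have "\<dots> = bumps n c x * bumps n c x"
      unfolding y(2) bumps_inside[OF w(1) y(1)] by (simp add: power2_eq_square)
    finally show ?thesis using word_map_gasket[OF y(1) w(1)] y(2) by (simp add: indicator_def)
  qed
  have Q: "measure gasket_measure (Q w) = 1 / 3 ^ (n + 2)" "emeasure gasket_measure (Q w) < \<infinity>"
     "Q w \<in> sets gasket_measure" if "w \<in> words n" for w
    unfolding Q_def using measure_cell[OF wo[OF that]] emeasure_cell[OF wo[OF that]] by auto
  have "4 / 81 * (1 / 3) ^ n * (\<Sum>w\<in>words n. (c w)\<^sup>2) = (\<Sum>w\<in>words n. 1 / 3 ^ (n + 2) * (4 / 9 * (c w)\<^sup>2))"
    by (simp add: sum_distrib_left power_divide mult.assoc mult.left_commute)
  also have "\<dots> = integral\<^sup>L gasket_measure g" unfolding g_def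
    by (subst Bochner_Integration.integral_sum)
      (use Q in \<open>auto intro!: integrable_mult_left integrable_real_indicator sum.cong\<close>)
  also have "\<dots> \<le> ip (bumps n c) (bumps n c)" unfolding ip_def set_lebesgue_integral_def
  proof (rule integral_mono)
    show "integrable gasket_measure g" unfolding g_def
      by (intro Bochner_Integration.integrable_sum integrable_mult_left integrable_real_indicator)
        (use Q in auto)
    have "continuous_on gasket (\<lambda>x. bumps n c x * bumps n c x)"
      by (intro continuous_intros gasket_functions_cont bumps_gasket_function)
    then show "integrable gasket_measure (\<lambda>x. indicator gasket x *\<^sub>R (bumps n c x * bumps n c x))"
      using set_integrable_gasket by (auto simp: set_integrable_def)
  qed (rule bound)
  finally show ?thesis .
qed

text \<open>
  The second and third vertex of a cell have equal heights, so edges of conductance $a$ carry no energy. In the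
  first child the increments are those of $f$, in the other two those of $1-f$.
\<close>

lemma bumps_energy:
  assumes "resistances a0 b0"
  shows "energy_n a0 b0 (n + Suc k) (bumps n c) = 6 * b_seq a0 b0 (n + Suc k) * (2 / 3) ^ k * (\<Sum>v\<in>words n. (c v)\<^sup>2)"
proof -
  interpret resistances a0 b0 by fact
  define m where "m = n + Suc k"
  define D where "D w = f (height (corner w 2)) - f (height (corner w 1))" for w
  have K: "corner w i \<in> gasket" if "w \<in> words l" "i \<in> letters" for w i l
    using that by (intro word_map_gasket vertex_in_gasket)
  have val: "bumps n c (corner (v @ s) i) = c v * bmp (height (corner s i))"
    if "v \<in> words n" "s \<in> words l" "i \<in> letters" for v s i l
    unfolding gasket_word_map_append comp_apply by (rule bumps_inside[OF that(1) K[OF that(2,3)]])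
  have ct: "cell_tri m (v @ i # w) (bumps n c) = 2 * cond_b m * (c v)\<^sup>2 * (D w)\<^sup>2"
    if v: "v \<in> words n" and w: "w \<in> words k" and i: "i \<in> letters" for v w i
  proof -
    have iw: "i # w \<in> words (Suc k)" using w i by (auto simp: words_def)
    define p where "p j = bmp (height (corner (i # w) j))" for j
    have "cell_tri m (v @ i # w) (bumps n c) = tri m (c v * p 1) (c v * p 2) (c v * p 3)"
      unfolding cell_tri_def p_def using val[OF v iw, of 1] val[OF v iw, of 2] val[OF v iw, of 3] by simp
    moreover have "p 3 = p 2" unfolding p_def using height_base[OF iw] by simp
    ultimately have e: "cell_tri m (v @ i # w) (bumps n c) = 2 * cond_b m * (c v)\<^sup>2 * (p 2 - p 1)\<^sup>2"
      by (simp add: tri_def power2_eq_square algebra_simps)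
    have h: "0 \<le> height (corner w j) \<and> height (corner w j) \<le> 1" if "j \<in> letters" for j
      by (rule gasket_height[OF K[OF w that]])
    have pj: "p j = (if i = 1 then f (height (corner w j)) else 1 - f (height (corner w j)))"
      if "j \<in> letters" for j
      unfolding p_def gasket_word_map_simps comp_apply height_map[OF i]
      using h[OF that] bmp_values(3,4) by simp
    have "(p 2 - p 1)\<^sup>2 = (D w)\<^sup>2"
    proof -
      have "1 \<in> letters" "2 \<in> letters" by simp_all
      then show ?thesis using pj[of 1] pj[of 2] by (cases "i = 1") (simp_all only: D_def if_True if_False, simp_all add: power2_commute)
    qed
    then show ?thesis using e by simp
  qed
  have "energy_n a0 b0 m (bumps n c) = (\<Sum>v\<in>words n. \<Sum>s\<in>words (Suc k). cell_tri m (v @ s) (bumps n c))"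
    unfolding energy_n_eq m_def by (rule sum_words_add)
  also have "\<dots> = (\<Sum>v\<in>words n. \<Sum>w\<in>words k. 6 * cond_b m * (c v)\<^sup>2 * (D w)\<^sup>2)"
    unfolding sum_words_Suc using ct by (intro sum.cong refl) (simp add: ct[of _ _ 1, simplified])
  also have "\<dots> = (\<Sum>v\<in>words n. 6 * cond_b m * (c v)\<^sup>2 * (2 / 3) ^ k)"
    using sum_squares_cdf[OF f1 f2 f01, of k] by (simp add: sum_distrib_left[symmetric] D_def)
  also have "\<dots> = 6 * cond_b m * (2 / 3) ^ k * (\<Sum>v\<in>words n. (c v)\<^sup>2)"
    by (simp add: sum_distrib_left mult_ac)
  finally show ?thesis by (simp add: m_def)
qed

end

context resistances
begin

lemma test_functions:
  obtains K U where "K > 0" "\<And>n c. combine U n c \<in> F0"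
    "\<And>n c. En (combine U n c) \<le> K * (9 / 2) ^ n * ip (combine U n c) (combine U n c)"
    "\<And>n c. \<exists>w\<in>words n. c w \<noteq> 0 \<Longrightarrow> 0 < ip (combine U n c) (combine U n c)"
proof -
  obtain f where "bump f" using bernoulli_cdf_exists unfolding bump_def by metis
  then interpret bump f .
  obtain c0 C' where C: "0 < c0" "0 < C'" "\<And>n. c0 * (3 / 2) ^ n \<le> cond_b n" "\<And>n. cond_b n \<le> C' * (3 / 2) ^ n"
    using b_seq_bounds by blast
  define K where "K = 9 * C' * (81 / 4)"
  have main: "bumps n c \<in> F0 \<and> En (bumps n c) \<le> K * (9 / 2) ^ n * ip (bumps n c) (bumps n c) \<and>
      ((\<exists>w\<in>words n. c w \<noteq> 0) \<longrightarrow> 0 < ip (bumps n c) (bumps n c))" for n c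
  proof -
    define s where "s = (\<Sum>w\<in>words n. (c w)\<^sup>2)"
    have s0: "0 \<le> s" by (simp add: s_def sum_nonneg)
    have e: "energy_n a0 b0 m (bumps n c) \<le> 9 * C' * (3 / 2) ^ n * s" for m
    proof -
      have "energy_n a0 b0 m (bumps n c) \<le> energy_n a0 b0 (n + Suc m) (bumps n c)"
        by (rule incseqD[OF energy_n_mono]) simp
      also have "\<dots> = 6 * cond_b (n + Suc m) * (2 / 3) ^ m * s"
        unfolding s_def by (rule bumps_energy) (rule resistances_axioms)
      also have "\<dots> \<le> 6 * (C' * (3 / 2) ^ (n + Suc m)) * (2 / 3) ^ m * s"
        using s0 C(4)[of "n + Suc m"] by (intro mult_right_mono mult_left_mono) auto
      also have "\<dots> = 9 * C' * (3 / 2) ^ n * s * ((3 / 2) ^ m * (2 / 3) ^ m)"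
        by (simp add: power_add)
      also have "(3 / 2) ^ m * (2 / 3) ^ m = (1 :: real)" by (simp add: power_mult_distrib[symmetric])
      finally show ?thesis by simp
    qed
    have fe: "finite_energy (bumps n c)" "En (bumps n c) \<le> 9 * C' * (3 / 2) ^ n * s" using En_le[OF e] by auto
    have ips: "4 / 81 * (1 / 3) ^ n * s \<le> ip (bumps n c) (bumps n c)" unfolding s_def by (rule bumps_ip)
    have "9 * C' * (3 / 2) ^ n * s = K * (9 / 2) ^ n * (4 / 81 * (1 / 3) ^ n * s)"
    proof -
      have "(9 / 2) ^ n * (1 / 3) ^ n = (3 / 2 :: real) ^ n" by (simp add: power_mult_distrib[symmetric])
      then have "9 * C' * (3 / 2) ^ n * s = 9 * C' * ((9 / 2) ^ n * (1 / 3) ^ n) * s" by (simp only:)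
      also have "\<dots> = K * (9 / 2) ^ n * (4 / 81 * (1 / 3) ^ n * s)" unfolding K_def by simp
      finally show ?thesis .
    qed
    also have "\<dots> \<le> K * (9 / 2) ^ n * ip (bumps n c) (bumps n c)"
      using C(2) by (intro mult_left_mono ips) (auto simp: K_def)
    finally have "En (bumps n c) \<le> K * (9 / 2) ^ n * ip (bumps n c) (bumps n c)" using fe by linarith
    moreover have "0 < ip (bumps n c) (bumps n c)" if "\<exists>w\<in>words n. c w \<noteq> 0"
    proof -
      have "0 < s" unfolding s_def using that by (intro sum_pos2[of _ "SOME w. w \<in> words n \<and> c w \<noteq> 0"])
          (auto, (metis (mono_tags, lifting) someI_ex)+)
      then have "0 < 4 / 81 * (1 / 3) ^ n * s" by simp
      then show ?thesis using ips by linarith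
    qed
    ultimately show ?thesis using fe bumps_gasket_function bumps_boundary by (auto simp: F0_iff)
  qed
  show ?thesis
  proof (rule that[of K cell_bump])
    show "K > 0" using C by (simp add: K_def)
  qed (use main in blast)+
qed

end

section \<open>The energy space\<close>

abbreviation vscale :: "real \<Rightarrow> (complex \<Rightarrow> real) \<Rightarrow> complex \<Rightarrow> real" where
  "vscale \<equiv> \<lambda>c f x. c * f x"

text \<open>
  The first-variation argument: the linear term dominates near $s = 0$.
\<close>

lemma quadratic_nonneg_slope_zero:
  fixes a b c :: real
  assumes "\<And>s. 0 \<le> 2 * s * b + s\<^sup>2 * c"
  shows "b = 0"
proof (rule ccontr)
  assume b: "b \<noteq> 0"
  define k where "k = \<bar>c\<bar> + 1"
  have k: "k > 0" "c < k" by (auto simp: k_def)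
  have "0 \<le> 2 * (- b / k) * b + (- b / k)\<^sup>2 * c" by (rule assms)
  also have "\<dots> = (b\<^sup>2 / k) * (c / k - 2)" using k by (simp add: power2_eq_square field_simps)
  also have "\<dots> < 0"
  proof (rule mult_pos_neg)
    show "b\<^sup>2 / k > 0" using b k by simp
    have "c / k < 1" using k by (simp add: divide_less_eq)
    then show "c / k - 2 < 0" by simp
  qed
  finally show False by simp
qed

context resistances
begin

lemma F0_subspace: "real_fun.subspace F0"
proof (rule real_fun.subspaceI)
  have "energy_n a0 b0 n (0 :: complex \<Rightarrow> real) \<le> 0" for n
    by (simp add: energy_n_eq cell_tri_def tri_def)
  then show "0 \<in> F0" using En_le by (auto simp: F0_iff gasket_functions_def)
qed (auto simp: F0_iff gasket_functions_add finite_energy_add gasket_functions_scale finite_energy_scale)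

lemma F0_add: "u \<in> F0 \<Longrightarrow> v \<in> F0 \<Longrightarrow> u + v \<in> F0"
  by (rule real_fun.subspace_add[OF F0_subspace])

lemma F0_scale: "u \<in> F0 \<Longrightarrow> vscale c u \<in> F0"
  using real_fun.subspace_scale[OF F0_subspace] .

lemma F0_diff: "u \<in> F0 \<Longrightarrow> v \<in> F0 \<Longrightarrow> u - v \<in> F0"
  by (rule real_fun.subspace_diff[OF F0_subspace])

lemma F0_sum: "(\<And>i. i \<in> I \<Longrightarrow> g i \<in> F0) \<Longrightarrow> (\<Sum>i\<in>I. g i) \<in> F0"
  by (rule real_fun.subspace_sum[OF F0_subspace])

lemma sum_fun_apply: "(\<Sum>i\<in>I. g i) x = (\<Sum>i\<in>I. g i x)" for g :: "'i \<Rightarrow> complex \<Rightarrow> real"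
  by (induction I rule: infinite_finite_induct) auto

definition ef :: "(complex \<Rightarrow> real) \<Rightarrow> (complex \<Rightarrow> real) \<Rightarrow> real" where "ef = form a0 b0"

lemma ef_add: "u \<in> F0 \<Longrightarrow> v \<in> F0 \<Longrightarrow> t \<in> F0 \<Longrightarrow> ef (u + v) t = ef u t + ef v t"
  unfolding ef_def by (intro form_add F0D)

lemma ef_scale: "u \<in> F0 \<Longrightarrow> t \<in> F0 \<Longrightarrow> ef (vscale c u) t = c * ef u t"
  unfolding ef_def by (intro form_scale F0D)

lemma ef_commute: "ef u v = ef v u"
  unfolding ef_def by (rule form_commute)

lemma ef_self: "u \<in> F0 \<Longrightarrow> ef u u = En u"
  unfolding ef_def by (intro form_self F0D)

lemma ip_add0: "u \<in> F0 \<Longrightarrow> v \<in> F0 \<Longrightarrow> t \<in> F0 \<Longrightarrow> ip (u + v) t = ip u t + ip v t"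
  by (intro ip_add F0D)

lemma ip_zero: "ip 0 t = 0"
  by (simp add: ip_def)

lemma ef_zero: "t \<in> F0 \<Longrightarrow> ef 0 t = 0"
  using ef_scale[of 0 t 0] real_fun.subspace_0[OF F0_subspace] by (simp add: zero_fun_def)

lemma ip_sum:
  assumes "\<And>i. i \<in> I \<Longrightarrow> g i \<in> F0" "t \<in> F0"
  shows "ip (\<Sum>i\<in>I. g i) t = (\<Sum>i\<in>I. ip (g i) t)"
  using assms(1)
  by (induction I rule: infinite_finite_induct) (auto simp: ip_zero ip_add0 F0_sum assms(2))

lemma ef_sum:
  assumes "\<And>i. i \<in> I \<Longrightarrow> g i \<in> F0" "t \<in> F0"
  shows "ef (\<Sum>i\<in>I. g i) t = (\<Sum>i\<in>I. ef (g i) t)"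
  using assms(1)
  by (induction I rule: infinite_finite_induct) (auto simp: ef_zero ef_add F0_sum assms(2))

lemma quadratic_expand:
  assumes "u \<in> F0" "v \<in> F0"
  shows "En (u + vscale s v) = En u + 2 * s * ef u v + s\<^sup>2 * En v"
    "ip (u + vscale s v) (u + vscale s v) = ip u u + 2 * s * ip u v + s\<^sup>2 * ip v v"
proof -
  define t where "t = vscale s v"
  have t: "t \<in> F0" unfolding t_def by (rule F0_scale[OF assms(2)])
  have ut: "u + t \<in> F0" by (rule F0_add[OF assms(1) t])
  have e: "ef t x = s * ef v x" "ip t x = s * ip v x" if "x \<in> F0" for x
    unfolding t_def by (rule ef_scale[OF assms(2) that], rule ip_scale)
  have ef1: "ef (u + t) (u + t) = ef u (u + t) + ef t (u + t)" by (rule ef_add[OF assms(1) t ut])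
  have ef2: "ef u (u + t) = ef u u + ef t u"
    using ef_add[OF assms(1) t assms(1)] ef_commute[of u "u + t"] by simp
  have ef3: "ef t (u + t) = ef t u + ef t t"
    using ef_add[OF assms(1) t t] ef_commute[of t "u + t"] ef_commute[of u t] by simp
  have ef4: "ef t t = s * (s * ef v v)"
    using e(1)[OF t] e(1)[OF assms(2)] ef_commute[of v t] by simp
  have ef5: "ef t u = s * ef u v" using e(1)[OF assms(1)] ef_commute[of u v] by simp
  show "En (u + vscale s v) = En u + 2 * s * ef u v + s\<^sup>2 * En v"
    unfolding t_def[symmetric] ef_self[OF ut, symmetric] ef_self[OF assms(1), symmetric]
      ef_self[OF assms(2), symmetric] ef1 ef2 ef3 ef4 ef5 by (simp add: power2_eq_square)
  have ip1: "ip (u + t) (u + t) = ip u (u + t) + ip t (u + t)" by (rule ip_add0[OF assms(1) t ut])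
  have ip2: "ip u (u + t) = ip u u + ip t u"
    using ip_add0[OF assms(1) t assms(1)] ip_commute[of u "u + t"] by simp
  have ip3: "ip t (u + t) = ip t u + ip t t"
    using ip_add0[OF assms(1) t t] ip_commute[of t "u + t"] ip_commute[of u t] by simp
  have ip4: "ip t t = s * (s * ip v v)"
    using e(2)[OF t] e(2)[OF assms(2)] ip_commute[of v t] by simp
  have ip5: "ip t u = s * ip u v" using e(2)[OF assms(1)] ip_commute[of u v] by simp
  show "ip (u + vscale s v) (u + vscale s v) = ip u u + 2 * s * ip u v + s\<^sup>2 * ip v v"
    unfolding t_def[symmetric] ip1 ip2 ip3 ip4 ip5 by (simp add: power2_eq_square)
qed

text \<open>
  The degenerate case of Cauchy--Schwarz: along a null direction of the semidefinite product the squared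
  norm of a translate of $u$ is affine in the parameter, and it stays nonnegative only if the slope is zero.
\<close>

lemma ip_degenerate:
  assumes "u \<in> F0" "v \<in> F0" "ip v v = 0"
  shows "ip u v = 0"
proof (rule quadratic_nonneg_slope_zero[of _ "ip v v"])
  fix s :: real
  show "0 \<le> 2 * s * ip u v + s\<^sup>2 * ip v v"
  proof (rule ccontr)
    assume n: "\<not> ?thesis"
    define b where "b = ip u v"
    have b: "b \<noteq> 0" using n assms(3) by (auto simp: b_def)
    define r where "r = - (ip u u + 1) / (2 * b)"
    have "0 \<le> ip u u + 2 * r * b + r\<^sup>2 * ip v v"
      using quadratic_expand(2)[OF assms(1,2), of r] ip_nonneg[of "u + vscale r v"] by (simp add: b_def)
    also have "\<dots> = -1" using assms(3) b by (simp add: r_def field_simps)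
    finally show False by simp
  qed
qed

section \<open>Eigenspaces\<close>

definition eig :: "real \<Rightarrow> (complex \<Rightarrow> real) set" where "eig l = eigenspace a0 b0 l"

lemma eig_iff: "u \<in> eig l \<longleftrightarrow> u \<in> F0 \<and> (\<forall>v\<in>F0. ef u v = l * ip u v)"
  by (simp add: eig_def eigenspace_def ip_def F0_def ef_def)

lemma eig_subspace: "real_fun.subspace (eig l)"
proof (rule real_fun.subspaceI)
  show "0 \<in> eig l" using real_fun.subspace_0[OF F0_subspace] by (auto simp: eig_iff ef_zero ip_zero)
qed (auto simp: eig_iff F0_add F0_scale ef_add ef_scale ip_add0 ip_scale algebra_simps)

lemma eig_energy: "u \<in> eig l \<Longrightarrow> En u = l * ip u u"
  using ef_self by (auto simp: eig_iff)

lemma eig_orthogonal: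
  assumes "u \<in> eig l" "v \<in> eig m" "l \<noteq> m"
  shows "ip u v = 0"
proof -
  have "l * ip u v = m * ip u v"
    using assms ef_commute[of u v] ip_commute[of u v] by (auto simp: eig_iff)
  then show ?thesis using assms(3) by simp
qed

text \<open>
  If there were more eigenfunctions than points in $J$, a nontrivial combination $u$ would vanish at the
  first corners of all cells of level $n$. As eigenspaces are orthogonal for both forms, the energy of $u$
  is at most $t$ times its squared norm, against the Poincare inequality. The corners outside $J$ are
  those where the boundary condition already enforces zero.
\<close>

lemma eig_independent_bound:
  assumes L: "finite L" "\<And>l. l \<in> L \<Longrightarrow> l \<le> t"
    and Bs: "\<And>l. l \<in> L \<Longrightarrow> finite (Bs l)" "\<And>l. l \<in> L \<Longrightarrow> Bs l \<subseteq> eig l" "\<And>l. l \<in> L \<Longrightarrow> real_fun.independent (Bs l)"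
    and J: "J \<subseteq> words n" "\<And>w u. w \<in> words n - J \<Longrightarrow> u \<in> F0 \<Longrightarrow> u (corner w 1) = 0"
    and t: "Cosc * (2 / 9) ^ n * t < 1"
  shows "(\<Sum>l\<in>L. card (Bs l)) \<le> card J"
proof (rule ccontr)
  assume "\<not> ?thesis"
  then have card: "card J < card (Sigma L Bs)" using L Bs by simp
  have fJ: "finite J" by (rule finite_subset[OF J(1) finite_words])
  have fI: "finite (Sigma L Bs)" using L Bs by auto
  from homogeneous_system_nontrivial[OF fJ fI card,
      of "\<lambda>w (l, b). b (corner w 1)"]
  obtain c where c: "\<exists>i\<in>Sigma L Bs. c i \<noteq> 0"
    "\<And>w. w \<in> J \<Longrightarrow> (\<Sum>(l, b)\<in>Sigma L Bs. c (l, b) * b (corner w 1)) = 0"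
    by (auto simp: case_prod_beta')
  define ul where "ul l = (\<Sum>b\<in>Bs l. vscale (c (l, b)) b)" for l
  have ul: "ul l \<in> eig l" if "l \<in> L" for l
    unfolding ul_def using Bs(2)[OF that]
    by (intro real_fun.subspace_sum[OF eig_subspace] real_fun.subspace_scale[OF eig_subspace]) auto
  then have ulF: "ul l \<in> F0" if "l \<in> L" for l using that by (auto simp: eig_iff)
  define u where "u = (\<Sum>l\<in>L. ul l)"
  have uF: "u \<in> F0" unfolding u_def by (intro F0_sum ulF)
  have u0: "u (corner w 1) = 0" if "w \<in> words n" for w
  proof (cases "w \<in> J")
    case True
    have "u (corner w 1) = (\<Sum>(l, b)\<in>Sigma L Bs. c (l, b) * b (corner w 1))"
      unfolding u_def ul_def sum_fun_apply using L Bs by (subst sum.Sigma) auto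
    then show ?thesis using c(2)[OF True] by simp
  next
    case False then show ?thesis using J(2) that uF by blast
  qed
  have ipu: "ip (ul l) u = ip (ul l) (ul l)" if "l \<in> L" for l
  proof -
    have "ip (ul l) u = (\<Sum>m\<in>L. ip (ul l) (ul m))"
      unfolding ip_commute[of "ul l"] u_def using ulF that by (intro ip_sum) auto
    also have "\<dots> = ip (ul l) (ul l) + (\<Sum>m\<in>L - {l}. ip (ul l) (ul m))"
      using that L by (intro sum.remove) auto
    also have "(\<Sum>m\<in>L - {l}. ip (ul l) (ul m)) = 0"
      using eig_orthogonal[OF ul ul] that by (intro sum.neutral) auto
    finally show ?thesis by simp
  qed
  have ipuu: "ip u u = (\<Sum>l\<in>L. ip (ul l) (ul l))"
  proof -
    have "ip u u = (\<Sum>l\<in>L. ip (ul l) u)" using ip_sum[OF ulF uF, of L] by (simp add: u_def)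
    then show ?thesis using ipu by simp
  qed
  have "En u = (\<Sum>l\<in>L. l * ip (ul l) (ul l))"
  proof -
    have "En u = ef u u" using ef_self[OF uF] by simp
    also have "\<dots> = (\<Sum>l\<in>L. ef (ul l) u)" using ef_sum[OF ulF uF, of L] by (simp add: u_def)
    also have "\<dots> = (\<Sum>l\<in>L. l * ip (ul l) (ul l))"
      using ul uF ipu by (intro sum.cong) (auto simp: eig_iff)
    finally show ?thesis .
  qed
  also have "\<dots> \<le> (\<Sum>l\<in>L. t * ip (ul l) (ul l))" using L(2) ip_nonneg by (intro sum_mono mult_right_mono) auto
  also have "\<dots> = t * ip u u" by (simp add: ipuu sum_distrib_left)
  finally have "Cosc * (2 / 9) ^ n * En u \<le> Cosc * (2 / 9) ^ n * (t * ip u u)"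
    using Cosc(1) by (intro mult_left_mono) auto
  moreover have "ip u u \<le> Cosc * (2 / 9) ^ n * En u" using uF u0 by (intro poincare F0D)
  ultimately have "(1 - Cosc * (2 / 9) ^ n * t) * ip u u \<le> 0" by (simp add: algebra_simps)
  then have "ip u u \<le> 0" using t by (simp add: mult_le_0_iff)
  then have "(\<Sum>l\<in>L. ip (ul l) (ul l)) = 0" using ip_nonneg[of u] ipuu by linarith
  then have ipz: "ip (ul l) (ul l) = 0" if "l \<in> L" for l
    using that L ip_nonneg by (subst (asm) sum_nonneg_eq_0_iff) auto
  have ulz: "ul l = 0" if "l \<in> L" for l
    using F0_zero[OF ulF[OF that]] eig_energy[OF ul[OF that]] ipz[OF that] by simp
  obtain l b where lb: "l \<in> L" "b \<in> Bs l" "c (l, b) \<noteq> 0" using c(1) by auto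
  have "c (l, b) = 0"
    using real_fun.independentD[OF Bs(3)[OF lb(1)] Bs(1)[OF lb(1)] order_refl, of "\<lambda>b. c (l, b)" b] ulz[OF lb(1)] lb(2)
    unfolding ul_def by blast
  then show False using lb by simp
qed

section \<open>Minimizers of the Rayleigh quotient\<close>

text \<open>
  A minimizing sequence converges uniformly by compactness, so the constraints survive, and lower
  semicontinuity makes the limit a minimizer.
\<close>

lemma minimizer_exists:
  assumes Bt: "Bt \<subseteq> F0" and w: "w \<in> F0" "\<And>b. b \<in> Bt \<Longrightarrow> ip w b = 0" "0 < ip w w"
  obtains v where "v \<in> F0" "\<And>b. b \<in> Bt \<Longrightarrow> ip v b = 0" "ip v v = 1"
    "\<And>u. u \<in> F0 \<Longrightarrow> (\<And>b. b \<in> Bt \<Longrightarrow> ip u b = 0) \<Longrightarrow> En v * ip u u \<le> En u"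
proof -
  define S where "S = {u \<in> F0. (\<forall>b\<in>Bt. ip u b = 0) \<and> ip u u = 1}"
  have norm: "vscale (1 / sqrt (ip u u)) u \<in> S" "En (vscale (1 / sqrt (ip u u)) u) = En u / ip u u"
    if u: "u \<in> F0" "\<And>b. b \<in> Bt \<Longrightarrow> ip u b = 0" "0 < ip u u" for u
  proof -
    define c where "c = 1 / sqrt (ip u u)"
    have c2: "c * c = 1 / ip u u" using u(3) by (simp add: c_def)
    have "ip (vscale c u) (vscale c u) = c * c * ip u u"
      unfolding ip_scale ip_commute[of u "vscale c u"] by simp
    then have "ip (vscale c u) (vscale c u) = 1" using c2 u(3) by simp
    moreover have "ip (vscale c u) b = 0" if "b \<in> Bt" for b
      unfolding ip_scale u(2)[OF that] by simp
    ultimately have "vscale c u \<in> S" unfolding S_def using F0_scale[OF u(1), of c] by blast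
    then show "vscale (1 / sqrt (ip u u)) u \<in> S" by (simp only: c_def)
    have "En (vscale c u) = c * c * En u"
      unfolding ef_self[OF F0_scale[OF u(1)], symmetric] ef_scale[OF u(1) F0_scale[OF u(1)]]
        ef_commute[of u "vscale c u"] ef_scale[OF u(1) u(1)] ef_self[OF u(1)] by simp
    then show "En (vscale (1 / sqrt (ip u u)) u) = En u / ip u u" using c2 by (simp add: c_def)
  qed
  have ne: "S \<noteq> {}" using norm(1)[OF w] by blast
  have low: "0 \<le> En u" if "u \<in> S" for u using that En_nonneg F0D by (auto simp: S_def)
  have bdd: "bdd_below (En ` S)" using low by (intro bdd_belowI[of _ 0]) auto
  define J where "J = Inf (En ` S)"
  have J: "J \<le> En u" if "u \<in> S" for u unfolding J_def using that bdd by (intro cInf_lower) auto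
  have "\<exists>u\<in>S. En u < J + 1 / real (Suc k)" for k
  proof -
    have "Inf (En ` S) < J + 1 / real (Suc k)" by (simp add: J_def)
    then show ?thesis using cInf_lessD[of "En ` S"] ne by blast
  qed
  then obtain u where u: "\<And>k. u k \<in> S" "\<And>k. En (u k) < J + 1 / real (Suc k)" by metis
  have uF: "u k \<in> F0" for k using u(1) by (auto simp: S_def)
  have uR: "En (u k) \<le> J + 1" for k
  proof -
    have "1 / real (Suc k) \<le> 1" by simp
    then show ?thesis using u(2)[of k] by linarith
  qed
  have lim: "(\<lambda>k. En (u k)) \<longlonglongrightarrow> J"
  proof (rule tendsto_sandwich[of "\<lambda>_. J" _ _ "\<lambda>k. J + 1 / real (Suc k)"])
    show "(\<lambda>k. J + 1 / real (Suc k)) \<longlonglongrightarrow> J"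
      using tendsto_add[OF tendsto_const LIMSEQ_Suc[OF lim_1_over_n], of J] by simp
    show "\<forall>\<^sub>F k in sequentially. J \<le> En (u k)" by (intro always_eventually allI J u(1))
    show "\<forall>\<^sub>F k in sequentially. En (u k) \<le> J + 1 / real (Suc k)"
      by (intro always_eventually allI less_imp_le u(2))
  qed simp
  obtain r v M where r: "strict_mono (r :: nat \<Rightarrow> nat)" "v \<in> F0" "En v \<le> J"
    "\<And>x. x \<in> gasket \<Longrightarrow> (\<lambda>k. u (r k) x) \<longlonglongrightarrow> v x" "\<And>k x. x \<in> gasket \<Longrightarrow> \<bar>u k x\<bar> \<le> M"
    using F0_compact[OF uF uR lim] by blast
  have ip_lim: "(\<lambda>k. ip (u (r k)) (u (r k))) \<longlonglongrightarrow> ip v v"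
    by (rule ip_limit[OF F0D(1)[OF uF] F0D(1)[OF uF] F0D(1)[OF r(2)] F0D(1)[OF r(2)] r(4,4,5,5)])
  have v1: "ip v v = 1"
    using LIMSEQ_unique[OF ip_lim, of 1] u(1) by (simp add: S_def)
  have v0: "ip v b = 0" if b: "b \<in> Bt" for b
  proof -
    have bF: "b \<in> F0" using b Bt by blast
    have "(\<lambda>k. ip (u (r k)) b) \<longlonglongrightarrow> ip v b"
    proof (rule ip_limit[OF F0D(1)[OF uF] F0D(1)[OF bF] F0D(1)[OF r(2)] F0D(1)[OF bF] r(4)])
      have bb: "\<bar>b x\<bar> \<le> sqrt (Cosc * En b)" if "x \<in> gasket" for x
        using F0_sup[OF bF that] real_le_rsqrt[of "\<bar>b x\<bar>"] by simp
      show "\<bar>b x\<bar> \<le> max M (sqrt (Cosc * En b))" "\<bar>u (r k) x\<bar> \<le> max M (sqrt (Cosc * En b))" if "x \<in> gasket" for k x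
        using bb[OF that] r(5)[OF that, of "r k"] by auto
    qed auto
    moreover have "ip (u (r k)) b = 0" for k using u(1) b by (auto simp: S_def)
    ultimately show ?thesis using LIMSEQ_unique[of "\<lambda>_. 0" 0] by auto
  qed
  show ?thesis
  proof (rule that[OF r(2) v0 v1])
    fix z assume z: "z \<in> F0" "\<And>b. b \<in> Bt \<Longrightarrow> ip z b = 0"
    show "En v * ip z z \<le> En z"
    proof (cases "ip z z = 0")
      case True then show ?thesis using En_nonneg[OF F0D(2)[OF z(1)]] by simp
    next
      case False
      then have pos: "0 < ip z z" using ip_nonneg[of z] by linarith
      have "En v \<le> En z / ip z z" using r(3) J[OF norm(1)[OF z pos]] norm(2)[OF z pos] by simp
      then show ?thesis using pos by (simp add: field_simps)
    qed
  qed
qed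

lemma orthogonal_span:
  assumes "u \<in> F0" "V \<subseteq> F0" "\<And>b. b \<in> V \<Longrightarrow> ip u b = 0" "p \<in> real_fun.span V"
  shows "ip u p = 0"
proof -
  have "real_fun.span V \<subseteq> {x \<in> F0. ip x u = 0}"
  proof (rule real_fun.span_minimal)
    show "V \<subseteq> {x \<in> F0. ip x u = 0}" using assms by (auto simp: ip_commute[of _ u])
    show "real_fun.subspace {x \<in> F0. ip x u = 0}"
      using real_fun.subspace_0[OF F0_subspace] assms(1)
      by (intro real_fun.subspaceI) (auto simp: ip_zero F0_add F0_scale ip_add0 ip_scale)
  qed
  then show ?thesis using assms(4) by (auto simp: ip_commute[of u])
qed

text \<open>
  Gram--Schmidt, one vector at a time. A direction of zero norm needs no correction, by the
  degenerate case above.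
\<close>

lemma projection_exists:
  assumes "finite V" "V \<subseteq> F0" "u \<in> F0"
  shows "\<exists>p\<in>real_fun.span V. \<forall>b\<in>V. ip (u - p) b = 0"
  using assms
proof (induction V arbitrary: u rule: finite_induct)
  case empty
  then show ?case by (intro bexI[of _ 0]) auto
next
  case (insert b V)
  have sub: "real_fun.span V' \<subseteq> F0" if "V' \<subseteq> F0" for V'
    using that by (rule real_fun.span_minimal[OF _ F0_subspace])
  have bF: "b \<in> F0" "V \<subseteq> F0" using insert.prems by auto
  from insert.IH[OF bF(2,1)] obtain pb where pb: "pb \<in> real_fun.span V" "\<And>x. x \<in> V \<Longrightarrow> ip (b - pb) x = 0" by blast
  from insert.IH[OF bF(2) insert.prems(2)] obtain pu where pu: "pu \<in> real_fun.span V" "\<And>x. x \<in> V \<Longrightarrow> ip (u - pu) x = 0" by blast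
  have F: "pb \<in> F0" "pu \<in> F0" using sub[OF bF(2)] pb pu by auto
  define b' where "b' = b - pb"
  define u1 where "u1 = u - pu"
  have F': "b' \<in> F0" "u1 \<in> F0" unfolding b'_def u1_def using F bF insert.prems by (auto intro: F0_diff)
  have beq: "b = b' + pb" by (simp add: b'_def)
  have mono: "real_fun.span V \<subseteq> real_fun.span (insert b V)" by (rule real_fun.span_mono) auto
  have b's: "b' \<in> real_fun.span (insert b V)"
    unfolding b'_def
    by (rule real_fun.span_diff[OF real_fun.span_base subsetD[OF mono pb(1)]]) simp
  have u1pb: "ip u1 pb = 0"
    by (rule orthogonal_span[OF F'(2) bF(2) _ pb(1)]) (use pu in \<open>simp add: u1_def\<close>)
  define c where "c = ip u1 b' / ip b' b'"
  define p where "p = pu + vscale c b'"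
  have ps: "p \<in> real_fun.span (insert b V)"
    unfolding p_def by (rule real_fun.span_add[OF subsetD[OF mono pu(1)] real_fun.span_scale[OF b's]])
  have up: "u - p = u1 + vscale (- c) b'" by (auto simp: p_def u1_def)
  have expand: "ip (u - p) x = ip u1 x - c * ip b' x" if "x \<in> F0" for x
    unfolding up using ip_add0[OF F'(2) F0_scale[OF F'(1)] that, of "- c"] ip_scale[of "- c" b' x] by simp
  have "ip (u - p) x = 0" if x: "x \<in> V" for x
    using expand[of x] pb(2)[OF x] pu(2)[OF x] bF x by (auto simp: b'_def u1_def)
  moreover have "ip (u - p) b = 0"
  proof -
    have b'pb: "ip b' pb = 0"
      by (rule orthogonal_span[OF F'(1) bF(2) _ pb(1)]) (use pb in \<open>simp add: b'_def\<close>)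
    have split: "ip x b = ip x b' + ip x pb" if "x \<in> F0" for x
      unfolding beq[symmetric] using ip_add0[OF F'(1) F(1) that] beq by (metis ip_commute)
    have "ip (u - p) b = ip u1 b' - c * ip b' b'"
      using expand[OF bF(1)] split[OF F'(2)] split[OF F'(1)] u1pb b'pb by simp
    also have "\<dots> = 0"
    proof (cases "ip b' b' = 0")
      case True
      then show ?thesis using ip_degenerate[OF F'(2,1) True] by simp
    next
      case False then show ?thesis by (simp add: c_def)
    qed
    finally show ?thesis .
  qed
  ultimately have "\<forall>x\<in>insert b V. ip (u - p) x = 0" by blast
  with ps show ?case by blast
qed

text \<open>
  The first variation gives the eigenvalue equation against functions orthogonal to \<open>Bt\<close>. Against
  the eigenfunctions in \<open>Bt\<close> both sides vanish, and these two kinds of functions span everything.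
\<close>

lemma minimizer_eigenfunction:
  assumes B: "finite Bt" "\<And>b. b \<in> Bt \<Longrightarrow> \<exists>m. b \<in> eig m"
    and v: "v \<in> F0" "\<And>b. b \<in> Bt \<Longrightarrow> ip v b = 0" "ip v v = 1"
    and min: "\<And>u. u \<in> F0 \<Longrightarrow> (\<And>b. b \<in> Bt \<Longrightarrow> ip u b = 0) \<Longrightarrow> En v * ip u u \<le> En u"
  shows "v \<in> eig (En v)"
proof -
  have BF: "Bt \<subseteq> F0" using B(2) by (auto simp: eig_iff)
  have perp: "ef v u = En v * ip v u" if u: "u \<in> F0" "\<And>b. b \<in> Bt \<Longrightarrow> ip u b = 0" for u
  proof -
    have "ef v u - En v * ip v u = 0"
    proof (rule quadratic_nonneg_slope_zero[of _ "En u - En v * ip u u"])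
      fix s :: real
      have "En v * ip (v + vscale s u) (v + vscale s u) \<le> En (v + vscale s u)"
      proof (rule min)
        show F: "v + vscale s u \<in> F0" using u v by (intro F0_add F0_scale)
        fix b assume b: "b \<in> Bt"
        then have "b \<in> F0" using BF by blast
        then show "ip (v + vscale s u) b = 0"
          using ip_add0[OF v(1) F0_scale[OF u(1)], of b s] v(2)[OF b] u(2)[OF b] by (simp add: ip_scale)
      qed
      then show "0 \<le> 2 * s * (ef v u - En v * ip v u) + s\<^sup>2 * (En u - En v * ip u u)"
        unfolding quadratic_expand[OF v(1) u(1)] v(3) by (simp add: algebra_simps)
    qed
    then show ?thesis by simp
  qed
  have span0: "ef v p = En v * ip v p" if "p \<in> real_fun.span Bt" for p
  proof -
    have "real_fun.span Bt \<subseteq> {x \<in> F0. ef x v = En v * ip x v}"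
    proof (rule real_fun.span_minimal)
      show "Bt \<subseteq> {x \<in> F0. ef x v = En v * ip x v}"
      proof
        fix b assume b: "b \<in> Bt"
        then obtain m where m: "b \<in> eig m" using B(2) by blast
        have "ip b v = 0" using v(2)[OF b] ip_commute by metis
        then have "ef b v = En v * ip b v" using m v(1) by (simp add: eig_iff)
        then show "b \<in> {x \<in> F0. ef x v = En v * ip x v}" using m by (simp add: eig_iff)
      qed
      show "real_fun.subspace {x \<in> F0. ef x v = En v * ip x v}"
        using real_fun.subspace_0[OF F0_subspace] v(1)
        by (intro real_fun.subspaceI)
          (auto simp: ip_zero ef_zero F0_add F0_scale ip_add0 ip_scale ef_add ef_scale algebra_simps)
    qed
    then show ?thesis using that by (auto simp: ef_commute[of v] ip_commute[of v])
  qed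
  have "ef v u = En v * ip v u" if u: "u \<in> F0" for u
  proof -
    obtain p where p: "p \<in> real_fun.span Bt" "\<And>b. b \<in> Bt \<Longrightarrow> ip (u - p) b = 0"
      using projection_exists[OF B(1) BF u] by blast
    have pF: "p \<in> F0" using p(1) real_fun.span_minimal[OF BF F0_subspace] by blast
    have d: "u - p \<in> F0" by (rule F0_diff[OF u pF])
    have e: "u = (u - p) + p" by simp
    have "ef v u = ef (u - p) v + ef p v" by (subst e, subst ef_commute) (rule ef_add[OF d pF v(1)])
    also have "\<dots> = En v * ip (u - p) v + En v * ip p v"
      using perp[OF d p(2)] span0[OF p(1)] by (simp add: ef_commute[of v] ip_commute[of v])
    also have "\<dots> = En v * ip u v" using ip_add0[OF d pF v(1)] e by (simp add: distrib_left[symmetric])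
    finally show ?thesis by (simp add: ip_commute)
  qed
  then show ?thesis using v(1) by (simp add: eig_iff)
qed

end

section \<open>Counting eigenvalues\<close>

lemma sum_enat: "(\<Sum>i\<in>I. enat (g i)) = enat (\<Sum>i\<in>I. g i)"
  by (induction I rule: infinite_finite_induct) (auto simp: zero_enat_def)

lemma eigen_count_SUP:
  "eigen_count a0 b0 t = (SUP L\<in>{L. finite L \<and> L \<subseteq> {l. l \<le> t \<and> is_eigenvalue a0 b0 l}}. \<Sum>l\<in>L. eigen_mult a0 b0 l)"
  unfolding eigen_count_def by (rule nonneg_infsum_complete) simp

lemma eigen_count_mono: "s \<le> t \<Longrightarrow> eigen_count a0 b0 s \<le> eigen_count a0 b0 t"
  unfolding eigen_count_SUP by (rule SUP_subset_mono) auto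

context resistances
begin

text \<open>
  Multiplicities are finite because independent sets of eigenfunctions are bounded in size.
\<close>

lemma eigenspace_basis:
  assumes t: "Cosc * (2 / 9) ^ n * t < 1" and l: "l \<le> t"
  obtains V where "finite V" "V \<subseteq> eig l" "real_fun.independent V" "eig l \<subseteq> real_fun.span V"
    "eigen_mult a0 b0 l = enat (card V)"
proof -
  have "\<exists>Q. finite Q \<and> eig l \<subseteq> real_fun.span Q"
  proof (rule ccontr)
    assume "\<not> ?thesis"
    then obtain V where V: "finite V" "V \<subseteq> eig l" "real_fun.independent V" "card V = 3 ^ n + 1"
      using independent_subset_of_card[of "eig l" "3 ^ n + 1"] by blast
    have "(\<Sum>l\<in>{l}. card V) \<le> card (words n)"
      by (rule eig_independent_bound[of "{l}" t "\<lambda>_. V" "words n" n]) (use V t l in auto)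
    then show False using V(4) by (simp add: card_words)
  qed
  then obtain Q where Q: "finite Q" "eig l \<subseteq> real_fun.span Q" by blast
  obtain V where V: "V \<subseteq> eig l" "real_fun.independent V" "eig l \<subseteq> real_fun.span V" "card V = real_fun.dim (eig l)"
    by (rule real_fun.basis_exists)
  have "finite V" using real_fun.independent_span_bound[OF Q(1) V(2)] V(1) Q(2) by blast
  moreover have "eigen_mult a0 b0 l = enat (card V)"
    using Q V(4) unfolding eigen_mult_def eig_def by auto
  ultimately show ?thesis using V by (intro that)
qed

lemma eigenspace_bases:
  assumes "Cosc * (2 / 9) ^ n * t < 1"
  shows "\<exists>V. \<forall>l\<in>{..t}. finite (V l) \<and> V l \<subseteq> eig l \<and> real_fun.independent (V l)
      \<and> eig l \<subseteq> real_fun.span (V l) \<and> eigen_mult a0 b0 l = enat (card (V l))"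
proof (rule bchoice, rule ballI)
  fix l assume "l \<in> {..t}"
  then have "l \<le> t" by simp
  show "\<exists>V. finite V \<and> V \<subseteq> eig l \<and> real_fun.independent V
      \<and> eig l \<subseteq> real_fun.span V \<and> eigen_mult a0 b0 l = enat (card V)"
    by (rule eigenspace_basis[OF assms \<open>l \<le> t\<close>]) (intro exI conjI)
qed

lemma eigen_count_upper:
  assumes t: "Cosc * (2 / 9) ^ n * t < 1"
    and J: "J \<subseteq> words n" "\<And>w u. w \<in> words n - J \<Longrightarrow> u \<in> F0 \<Longrightarrow> u (corner w 1) = 0"
  shows "eigen_count a0 b0 t \<le> enat (card J)"
  unfolding eigen_count_SUP
proof (rule SUP_least)
  fix L assume "L \<in> {L. finite L \<and> L \<subseteq> {l. l \<le> t \<and> is_eigenvalue a0 b0 l}}"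
  then have L: "finite L" "\<And>l. l \<in> L \<Longrightarrow> l \<le> t" by auto
  obtain V where V: "\<forall>l\<in>{..t}. finite (V l) \<and> V l \<subseteq> eig l \<and> real_fun.independent (V l)
      \<and> eig l \<subseteq> real_fun.span (V l) \<and> eigen_mult a0 b0 l = enat (card (V l))"
    using eigenspace_bases[OF t] ..
  have "(\<Sum>l\<in>L. eigen_mult a0 b0 l) = enat (\<Sum>l\<in>L. card (V l))" using L(2) V by (simp add: sum_enat)
  also have "\<dots> \<le> enat (card J)"
    using eig_independent_bound[of L t V J n] L V J t by simp
  finally show "(\<Sum>l\<in>L. eigen_mult a0 b0 l) \<le> enat (card J)" .
qed

lemma eigen_count_le: "Cosc * (2 / 9) ^ n * t < 1 \<Longrightarrow> eigen_count a0 b0 t \<le> enat (3 ^ n)"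
  using eigen_count_upper[of n t "words n"] by (simp add: card_words)

text \<open>
  At level zero the only first corner is a boundary vertex, so no condition is left to impose.
\<close>

lemma eigen_count_zero: "Cosc * t < 1 \<Longrightarrow> eigen_count a0 b0 t = 0"
  using eigen_count_upper[of 0 t "{}"] by (simp add: F0_iff gasket_boundary_def zero_enat_def[symmetric])

text \<open>
  If there were fewer than $3^n$ eigenvalues, a test function could be chosen orthogonal to all their
  eigenfunctions, and the minimizer orthogonal to them would be an eigenfunction with eigenvalue at most
  $t$, that is, one of them, hence orthogonal to itself.
\<close>

lemma eigen_count_lower:
  obtains K where "K > 0" "\<And>n t. K * (9 / 2) ^ n \<le> t \<Longrightarrow> enat (3 ^ n) \<le> eigen_count a0 b0 t"
proof -
  obtain K U where K: "K > 0" and U: "\<And>n c. combine U n c \<in> F0"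
    "\<And>n c. En (combine U n c) \<le> K * (9 / 2) ^ n * ip (combine U n c) (combine U n c)"
    "\<And>n c. \<exists>w\<in>words n. c w \<noteq> 0 \<Longrightarrow> 0 < ip (combine U n c) (combine U n c)"
    using test_functions by blast
  have "enat (3 ^ n) \<le> eigen_count a0 b0 t" if t: "K * (9 / 2) ^ n \<le> t" for n t
  proof (rule ccontr)
    assume small: "\<not> ?thesis"
    define M where "M = {l. l \<le> t \<and> is_eigenvalue a0 b0 l}"
    have p: "0 < 1 / (Cosc * (\<bar>t\<bar> + 1))" "(2 / 9 :: real) < 1"
      using Cosc(1) by (intro divide_pos_pos mult_pos_pos, auto)
    obtain m where "(2 / 9 :: real) ^ m < 1 / (Cosc * (\<bar>t\<bar> + 1))" using real_arch_pow_inv[OF p] ..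
    moreover have "0 < Cosc * (\<bar>t\<bar> + 1)" using Cosc(1) by (intro mult_pos_pos) auto
    ultimately have "(2 / 9) ^ m * (Cosc * (\<bar>t\<bar> + 1)) < 1" by (simp only: pos_less_divide_eq)
    moreover have "(2 / 9) ^ m * (Cosc * t) \<le> (2 / 9) ^ m * (Cosc * (\<bar>t\<bar> + 1))"
      using Cosc(1) by (intro mult_left_mono) auto
    moreover have "Cosc * (2 / 9) ^ m * t = (2 / 9) ^ m * (Cosc * t)" by (simp only: mult_ac)
    ultimately have m: "Cosc * (2 / 9) ^ m * t < 1" by linarith
    obtain V where V': "\<forall>l\<in>{..t}. finite (V l) \<and> V l \<subseteq> eig l \<and> real_fun.independent (V l)
      \<and> eig l \<subseteq> real_fun.span (V l) \<and> eigen_mult a0 b0 l = enat (card (V l))"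
      using eigenspace_bases[OF m] ..
    have V: "finite (V l)" "V l \<subseteq> eig l" "real_fun.independent (V l)" "eig l \<subseteq> real_fun.span (V l)"
      "eigen_mult a0 b0 l = enat (card (V l))" if "l \<in> M" for l
      using V' that by (simp_all add: M_def)
    have Vpos: "1 \<le> card (V l)" if l: "l \<in> M" for l
    proof -
      obtain u where u: "u \<in> eig l" "u \<noteq> 0" using l by (auto simp: M_def is_eigenvalue_def eig_def)
      have "V l \<noteq> {}"
      proof
        assume "V l = {}"
        then have "u \<in> real_fun.span {}" using V(4)[OF l] u(1) by auto
        then show False using u(2) by (simp add: real_fun.span_empty)
      qed
      then show ?thesis using V(1)[OF l] by (simp add: Suc_le_eq card_gt_0_iff)
    qed
    have "finite M \<and> card M \<le> card (words m)"
    proof (rule finite_if_finite_subsets_card_bdd)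
      fix L assume L: "L \<subseteq> M" "finite L"
      have "card L = (\<Sum>l\<in>L. 1)" by simp
      also have "\<dots> \<le> (\<Sum>l\<in>L. card (V l))" using Vpos L by (intro sum_mono) auto
      also have "\<dots> \<le> card (words m)"
      proof (rule eig_independent_bound[OF L(2), of t V "words m" m])
        show "\<And>l. l \<in> L \<Longrightarrow> l \<le> t" using L by (auto simp: M_def)
      qed (use L V m in auto)
      finally show "card L \<le> card (words m)" .
    qed
    then have fM: "finite M" ..
    have count: "eigen_count a0 b0 t = enat (\<Sum>l\<in>M. card (V l))"
      unfolding eigen_count_def M_def[symmetric] using fM by (simp add: infsum_finite V(5) sum_enat)
    define Bt where "Bt = (\<Union>l\<in>M. V l)"
    have fB: "finite Bt" unfolding Bt_def using fM V(1) by blast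
    have "card Bt \<le> (\<Sum>l\<in>M. card (V l))" unfolding Bt_def by (rule card_UN_le[OF fM])
    also have "\<dots> < 3 ^ n" using small count by simp
    finally have cB: "card Bt < card (words n)" by (simp add: card_words)
    have UF: "U w \<in> F0" if "w \<in> words n" for w
    proof -
      have "combine U n (\<lambda>v. if v = w then 1 else 0) = U w"
        using that by (intro ext) (simp add: combine_def if_distrib[of "\<lambda>c. c * _"] cong: if_cong)
      then show ?thesis using U(1)[of n "\<lambda>v. if v = w then 1 else 0"] by simp
    qed
    from homogeneous_system_nontrivial[OF fB finite_words cB, of "\<lambda>b w. ip (U w) b"]
    obtain c where c: "\<exists>w\<in>words n. c w \<noteq> 0" "\<And>b. b \<in> Bt \<Longrightarrow> (\<Sum>w\<in>words n. c w * ip (U w) b) = 0" by blast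
    define w0 where "w0 = combine U n c"
    have w0_sum: "w0 = (\<Sum>w\<in>words n. vscale (c w) (U w))"
      unfolding w0_def by (rule ext) (simp add: sum_fun_apply combine_def)
    have eigF: "eig l \<subseteq> F0" for l by (auto simp: eig_iff)
    have BtF: "Bt \<subseteq> F0" unfolding Bt_def using V(2) eigF by blast
    have w0_perp: "ip w0 b = 0" if "b \<in> Bt" for b
    proof -
      have "ip w0 b = (\<Sum>w\<in>words n. ip (vscale (c w) (U w)) b)"
        unfolding w0_sum using that BtF UF by (intro ip_sum F0_scale) auto
      also have "\<dots> = (\<Sum>w\<in>words n. c w * ip (U w) b)" by (intro sum.cong refl ip_scale)
      finally show ?thesis using c(2)[OF that] by simp
    qed
    have w0F: "w0 \<in> F0" unfolding w0_def by (rule U(1))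
    have w0pos: "0 < ip w0 w0" unfolding w0_def by (rule U(3)[OF c(1)])
    obtain v where v: "v \<in> F0" "\<And>b. b \<in> Bt \<Longrightarrow> ip v b = 0" "ip v v = 1"
      "\<And>u. u \<in> F0 \<Longrightarrow> (\<And>b. b \<in> Bt \<Longrightarrow> ip u b = 0) \<Longrightarrow> En v * ip u u \<le> En u"
      using minimizer_exists[OF BtF w0F w0_perp w0pos] by blast
    have veig: "v \<in> eig (En v)"
    proof (rule minimizer_eigenfunction[OF fB _ v])
      show "\<And>b. b \<in> Bt \<Longrightarrow> \<exists>m. b \<in> eig m" unfolding Bt_def using V(2) by blast
    qed
    have "En v * ip w0 w0 \<le> En w0" by (rule v(4)[OF w0F w0_perp])
    also have "\<dots> \<le> K * (9 / 2) ^ n * ip w0 w0" unfolding w0_def by (rule U(2))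
    also have "\<dots> \<le> t * ip w0 w0" using t w0pos by (intro mult_right_mono) auto
    finally have "En v \<le> t" using w0pos by simp
    moreover have "v \<noteq> 0" using v(3) by (auto simp: ip_zero)
    ultimately have vM: "En v \<in> M" using veig by (auto simp: M_def is_eigenvalue_def eig_def)
    have "v \<in> real_fun.span (V (En v))" using V(4)[OF vM] veig by blast
    also have "\<dots> \<subseteq> real_fun.span Bt" using vM by (intro real_fun.span_mono) (auto simp: Bt_def)
    finally have "ip v v = 0" by (intro orthogonal_span[OF v(1) BtF v(2)])
    then show False using v(3) by simp
  qed
  then show ?thesis by (rule that[OF K])
qed

end

lemma geometric_bracket:
  fixes s :: real
  assumes "1 \<le> s"
  obtains n where "(9 / 2) ^ n \<le> s" "s < (9 / 2) ^ Suc n"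
proof -
  obtain m where m: "s < (9 / 2) ^ m" using real_arch_pow[of "9 / 2" s] by auto
  define l where "l = (LEAST m. s < (9 / 2) ^ m)"
  have l: "s < (9 / 2) ^ l" unfolding l_def using LeastI[of "\<lambda>m. s < (9 / 2) ^ m" m] m by simp
  have l0: "l \<noteq> 0" using l assms by (cases l) auto
  have "\<not> s < (9 / 2) ^ (l - 1)"
    using not_less_Least[of "l - 1" "\<lambda>m. s < (9 / 2) ^ m"] l0 unfolding l_def by simp
  then show ?thesis using l l0 by (intro that[of "l - 1"]) auto
qed

lemma spectral_power: "((9 / 2 :: real) ^ n) powr (ln 3 / ln (9 / 2)) = 3 ^ n"
proof -
  have "(9 / 2 :: real) powr (ln 3 / ln (9 / 2)) = 3" by (simp add: powr_def)
  moreover have "((9 / 2 :: real) ^ n) powr (ln 3 / ln (9 / 2)) = ((9 / 2) powr (ln 3 / ln (9 / 2))) powr real n"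
    by (simp add: powr_realpow[symmetric] powr_powr mult.commute)
  ultimately show ?thesis by (simp add: powr_realpow)
qed

text \<open>
  Between two powers of $9/2$ the upper and lower counts differ by constant factors. The lower bound of
  the spectrum is positive, and just above it the count is at least one, which extends the lower estimate down
  to $t_0$.
\<close>

theorem theorem1p3:
  fixes a0 b0 t0 :: real
  assumes "a0 > b0" and "b0 > 0"
    and "t0 = Inf {t. eigen_count a0 b0 t > 0}"
  shows "\<exists>C::real. C > 0 \<and> (\<forall>t>t0.
           ereal (inverse C * t powr (ln 3 / ln (9 / 2))) \<le> ereal_of_enat (eigen_count a0 b0 t) \<and>
           ereal_of_enat (eigen_count a0 b0 t) \<le> ereal (C * t powr (ln 3 / ln (9 / 2))))"
proof -
  interpret resistances a0 b0 using assms by unfold_locales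
  define \<alpha> where "\<alpha> = ln 3 / ln (9 / 2 :: real)"
  have \<alpha>: "\<alpha> > 0" by (simp add: \<alpha>_def)
  have pow: "((9 / 2 :: real) ^ n) powr \<alpha> = 3 ^ n" for n unfolding \<alpha>_def by (rule spectral_power)
  obtain K where K: "K > 0" "\<And>n t. K * (9 / 2) ^ n \<le> t \<Longrightarrow> enat (3 ^ n) \<le> eigen_count a0 b0 t"
    using eigen_count_lower by blast
  define S where "S = {t. eigen_count a0 b0 t > 0}"
  have "eigen_count a0 b0 K \<ge> enat 1" using K(2)[of 0 K] by simp
  then have "K \<in> S" unfolding S_def mem_Collect_eq by (rule less_le_trans[rotated]) (simp add: zero_enat_def)
  then have ne: "S \<noteq> {}" by blast
  have S_low: "1 / Cosc \<le> s" if "s \<in> S" for s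
  proof (rule ccontr)
    assume "\<not> ?thesis"
    then have "Cosc * s < 1" using Cosc(1) by (simp add: field_simps)
    then show False using eigen_count_zero[of s] that by (simp add: S_def)
  qed
  then have t0: "1 / Cosc \<le> t0" unfolding assms(3) S_def[symmetric] by (intro cInf_greatest ne)
  have tpos: "0 < t" if "t > t0" for t
  proof -
    have "0 < 1 / Cosc" using Cosc(1) by simp
    then show ?thesis using that t0 by linarith
  qed
  have one: "enat 1 \<le> eigen_count a0 b0 t" if tt: "t > t0" for t
  proof -
    have "Inf S < t" using tt by (simp add: assms(3) S_def)
    from cInf_lessD[OF ne this] obtain s where s: "s \<in> S" "s < t" by blast
    have "0 < eigen_count a0 b0 s" using s(1) by (simp add: S_def)
    also have "\<dots> \<le> eigen_count a0 b0 t" using s(2) by (intro eigen_count_mono) simp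
    finally have "eSuc 0 \<le> eigen_count a0 b0 t" by (rule ileI1)
    then show ?thesis by (simp only: one_eSuc[symmetric] one_enat_def)
  qed
  define C where "C = max (3 * Cosc powr \<alpha>) (3 * K powr \<alpha>)"
  have C: "C > 0" "3 * Cosc powr \<alpha> \<le> C" "3 * K powr \<alpha> \<le> C" using K(1) by (auto simp: C_def less_max_iff_disj)
  have upper: "ereal_of_enat (eigen_count a0 b0 t) \<le> ereal (C * t powr \<alpha>)" if "t > t0" for t
  proof -
    have "1 / Cosc \<le> t" using that t0 by linarith
    then have t: "1 \<le> Cosc * t" "t > 0" using tpos[OF that] Cosc(1) by (simp_all add: pos_divide_le_eq mult.commute)
    obtain n where n: "(9 / 2) ^ n \<le> Cosc * t" "Cosc * t < (9 / 2) ^ Suc n" using geometric_bracket[OF t(1)] .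
    have "(2 / 9 :: real) ^ Suc n * (Cosc * t) < (2 / 9) ^ Suc n * (9 / 2) ^ Suc n"
      by (intro mult_strict_left_mono n(2)) simp
    also have "(2 / 9 :: real) ^ Suc n * (9 / 2) ^ Suc n = 1" by (simp only: power_mult_distrib[symmetric]) simp
    finally have "eigen_count a0 b0 t \<le> enat (3 ^ Suc n)" by (intro eigen_count_le) (simp add: mult_ac)
    then have "ereal_of_enat (eigen_count a0 b0 t) \<le> ereal_of_enat (enat (3 ^ Suc n))"
      by (simp only: ereal_of_enat_le_iff)
    also have "\<dots> = ereal (3 * 3 ^ n)" by simp
    also have "\<dots> \<le> ereal (3 * (Cosc * t) powr \<alpha>)"
      using powr_mono2[of \<alpha> "(9 / 2) ^ n" "Cosc * t"] n(1) \<alpha> by (simp add: pow)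
    also have "\<dots> = ereal (3 * Cosc powr \<alpha> * t powr \<alpha>)" using Cosc(1) t by (simp add: powr_mult)
    also have "\<dots> \<le> ereal (C * t powr \<alpha>)" using C by (simp add: mult_right_mono)
    finally show ?thesis .
  qed
  have lower: "ereal (inverse C * t powr \<alpha>) \<le> ereal_of_enat (eigen_count a0 b0 t)" if tt: "t > t0" for t
  proof -
    have t: "t > 0" by (rule tpos[OF tt])
    have "\<exists>n. enat (3 ^ n) \<le> eigen_count a0 b0 t \<and> t \<le> K * (9 / 2) ^ Suc n"
    proof (cases "K \<le> t")
      case True
      then have "1 \<le> t / K" using K(1) by simp
      then obtain n where n: "(9 / 2) ^ n \<le> t / K" "t / K < (9 / 2) ^ Suc n" by (rule geometric_bracket)
      have "K * (9 / 2) ^ n \<le> t" "t \<le> K * (9 / 2) ^ Suc n" using n K(1) by (simp_all add: field_simps)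
      then show ?thesis using K(2) by blast
    next
      case False
      then show ?thesis using one[OF tt] K(1) by (intro exI[of _ 0]) auto
    qed
    then obtain n where n: "enat (3 ^ n) \<le> eigen_count a0 b0 t" "t \<le> K * (9 / 2) ^ Suc n" by blast
    have "t powr \<alpha> \<le> (K * (9 / 2) ^ Suc n) powr \<alpha>" using n(2) t \<alpha> by (intro powr_mono2) auto
    also have "\<dots> = K powr \<alpha> * 3 ^ Suc n" unfolding powr_mult pow[symmetric] ..
    also have "\<dots> \<le> C * 3 ^ n" using C(3) by (simp add: mult_right_mono)
    finally have "inverse C * t powr \<alpha> \<le> 3 ^ n" using C(1) by (simp add: field_simps)
    then have "ereal (inverse C * t powr \<alpha>) \<le> ereal_of_enat (enat (3 ^ n))" by simp
    also have "\<dots> \<le> ereal_of_enat (eigen_count a0 b0 t)" using n(1) by (simp only: ereal_of_enat_le_iff)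
    finally show ?thesis .
  qed
  show ?thesis unfolding \<alpha>_def[symmetric] using C(1) upper lower by blast
qed

end
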